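(* Let $A \subset \mathbb{R}$ be finite. Then $$|A(A-A)| \gtrsim |A|^{3/2 + 7/226}, \qquad |A(A+A)| \gtrsim |A|^{3/2+1/46},$$ and $$\max_{a\in A} |A(A+a)| \gtrsim |A|^{3/2+1/182}, \qquad \max_{a\in A} |A(A-a)| \gtrsim |A|^{3/2+1/182}.$$
   Context: For finite $X,Y\subset\mathbb{R}$, $X+Y=\{x+y\}$, $X-Y=\{x-y\}$, $XY=\{xy\}$ (with $x\in X,y\in Y$), and $A\pm a = \{b\pm a : b\in A\}$. The notation $b \gtrsim a$ means $a = O(b \log^c |A|)$ for some absolute constant $c>0$. *)

theory Defs
  imports "HOL-Analysis.Analysis" "HOL-Library.Set_Algebras"
begin

text \<open>
  The sum set \<open>X + Y\<close> and the product set \<open>X * Y\<close> are the ones of the set-algebra library. The operator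
  \<open>-\<close> on sets is relative complement, so the difference set \<open>X - Y = {x - y}\<close> needs its own
  name.
\<close>

definition difference_set :: "real set \<Rightarrow> real set \<Rightarrow> real set" where
  "difference_set X Y = {x - y |x y. x \<in> X \<and> y \<in> Y}"

definition translate :: "real set \<Rightarrow> real \<Rightarrow> real set" where
  "translate A t = (\<lambda>b. b + t) ` A"

text \<open>
  \<open>gtrsim b a\<close> means \<open>a = O(b log\<^sup>c |A|)\<close> for an absolute constant
  \<open>c > 0\<close>, where \<open>a\<close> and \<open>b\<close> are nonnegative quantities that depend on a finite set \<open>A\<close> of reals. Both \<open>c\<close> and
  the implied constant \<open>C\<close> are chosen before \<open>A\<close>. Sets with at most one element are excluded
  because \<open>log |A|\<close> is not positive for them.
\<close>

definition gtrsim :: "(real set \<Rightarrow> real) \<Rightarrow> (real set \<Rightarrow> real) \<Rightarrow> bool" where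
  "gtrsim b a \<longleftrightarrow>
     (\<exists>c>0. \<exists>C>0. \<forall>A. finite A \<and> card A \<ge> 2 \<longrightarrow>
        a A \<le> C * (b A * ln (real (card A)) powr c))"

end

theory Submission
  imports Defs
begin

text \<open>
  Write \<open>n = |A|\<close>; one may assume that \<open>A\<close> is positive, so that its multiplicative energy is the
  additive energy of \<open>ln A\<close>. Counting collinear triples shows that if all \<open>|A (A + \<epsilon> a)|\<close> are at
  most \<open>M\<close>, then the multiplicative energy is at least about \<open>n\<^sup>6 / M\<^sup>2\<close>. All incidence bounds concern
  Cartesian products, where the Szemeredi-Trotter theorem has a short proof by blocks.

  A set \<open>A\<close> splits into a part \<open>X\<close> whose third order additive energies are small and a part \<open>Y\<close>
  whose third order multiplicative energies are small, with \<open>d\<^sub>3\<^sup>+(X) d\<^sub>3\<^sup>\<times>(Y)\<close> about \<open>n\<close>. If \<open>Y\<close> is large, its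
  multiplicative energy is small and the first remark applies. If \<open>X\<close> is large, then \<open>X - X\<close> and
  \<open>X + X\<close> are large. For the translates of a single element one uses instead that a large
  multiplicative energy makes the set of popular products rich in additive quadruples, although
  the incidence bound gives it small third order additive energy.

  The bounds on energies, differences and sums all come from one Cauchy-Schwarz step for the map
  \<open>(x, y, z) \<mapsto> (x - y, x - z)\<close>, whose collisions are counted by the third moment of the number of
  representations of a difference.
\<close>

section \<open>Counting and dyadic decomposition\<close>

text \<open>Third moments are the natural quantity here: an n by n grid has at most a constant times
  n^4 / k^3 lines with at least k points, so each dyadic level contributes the same bound to the sum
  of cubes and only a logarithm is lost. Under \<open>cubic_control A \<kappa>\<close> one gets, up
  to logarithms and constants, E^65 <= \<kappa>^35 n^125, |A - A|^5 >= n^11 / \<kappa>^3 and |A +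
  A|^14 >= n^30 / \<kappa>^8. The first leads to M^130 >= n^265 / \<kappa>^35; the other two lead to
  M^5 >= n^2 \<kappa>^3 and M^14 >= n^6 \<kappa>^8, because the complementary part has control n^3 /
  \<kappa>. Comparing these in \<kappa> gives the exponents for differences and sums. A single
  translate offers no such second branch: b (A + a) has only n elements whatever the size of A + A,
  and this is why popular products take over there. Estimates are kept as polynomial inequalities
  with natural exponents and one quantity L >= 1 for all logarithms; roots are extracted only at the
  end.\<close>

lemma card_matching_pairs:
  assumes "finite S" "finite T" "finite I" "f ` S \<subseteq> I"
  shows "card {p \<in> S \<times> T. f (fst p) = g (snd p)}
    = (\<Sum>i\<in>I. card {s \<in> S. f s = i} * card {t \<in> T. g t = i})"
proof -
  have "{p \<in> S \<times> T. f (fst p) = g (snd p)} = Sigma S (\<lambda>s. {t \<in> T. g t = f s})" by auto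
  then have "card {p \<in> S \<times> T. f (fst p) = g (snd p)} = (\<Sum>s\<in>S. card {t \<in> T. g t = f s})"
    using assms by (simp add: card_SigmaI)
  also have "\<dots> = (\<Sum>i\<in>I. of_nat (card {s \<in> S. f s = i}) * card {t \<in> T. g t = i})"
    by (rule sum_fun_comp[OF assms(1,3,4)])
  finally show ?thesis by simp
qed

text \<open>The squared fibre sizes of f add up to the number of collisions. Weight 1 gives a lower
  bound for the image; a representation count as weight is what \<open>energy_upper_bound\<close>
  uses.\<close>

lemma sum_fibres_Cauchy_Schwarz:
  fixes w :: "'b \<Rightarrow> real"
  assumes "finite S"
  shows "(\<Sum>s\<in>S. w (f s))\<^sup>2
    \<le> (\<Sum>i\<in>f ` S. (w i)\<^sup>2) * real (card {p \<in> S \<times> S. f (fst p) = f (snd p)})"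
proof -
  have "(\<Sum>s\<in>S. w (f s)) = (\<Sum>i\<in>f ` S. of_nat (card {s \<in> S. f s = i}) * w i)"
    by (rule sum_fun_comp) (use assms in auto)
  also have "\<dots>\<^sup>2 \<le> (\<Sum>i\<in>f ` S. (real (card {s \<in> S. f s = i}))\<^sup>2) * (\<Sum>i\<in>f ` S. (w i)\<^sup>2)"
    by (rule Cauchy_Schwarz_ineq_sum)
  also have "(\<Sum>i\<in>f ` S. (real (card {s \<in> S. f s = i}))\<^sup>2)
      = real (card {p \<in> S \<times> S. f (fst p) = f (snd p)})"
    using card_matching_pairs[of S S "f ` S" f f] assms by (simp add: power2_eq_square)
  finally show ?thesis by (simp add: mult.commute)
qed

lemma card_sq_le_image_mult_collisions:
  assumes "finite S"
  shows "(real (card S))\<^sup>2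
    \<le> real (card (f ` S)) * real (card {p \<in> S \<times> S. f (fst p) = f (snd p)})"
  using sum_fibres_Cauchy_Schwarz[OF assms, of "\<lambda>_. 1" f] by simp

lemma card_matching_pairs_Cauchy_Schwarz:
  assumes "finite S" "finite T"
  shows "(real (card {p \<in> S \<times> T. f (fst p) = g (snd p)}))\<^sup>2
    \<le> real (card {p \<in> S \<times> S. f (fst p) = f (snd p)}) * real (card {p \<in> T \<times> T. g (fst p) = g (snd p)})"
proof -
  define I where "I = f ` S \<union> g ` T"
  have I: "finite I" "f ` S \<subseteq> I" "g ` T \<subseteq> I" using assms by (auto simp: I_def)
  note c = card_matching_pairs[OF _ _ I(1)]
  have "real (card {p \<in> S \<times> T. f (fst p) = g (snd p)})
      = (\<Sum>i\<in>I. real (card {s \<in> S. f s = i}) * real (card {t \<in> T. g t = i}))"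
    using c[of S T f g] assms I by simp
  then show ?thesis
    using Cauchy_Schwarz_ineq_sum[of "\<lambda>i. real (card {s \<in> S. f s = i})" "\<lambda>i. real (card {t \<in> T. g t = i})" I]
      c[of S S f f] c[of T T g g] assms I by (simp add: power2_eq_square)
qed

section \<open>Superlevel sets and dyadic levels\<close>

text \<open>The least of n values is at most c / n, since its superlevel set is everything, and it
  can be removed. So the i-th largest value is at most c / i, and the sum picks up only a harmonic
  factor.\<close>

lemma sum_le_harm_superlevel:
  fixes f :: "'a \<Rightarrow> real"
  assumes "finite A" "\<And>t. t > 0 \<Longrightarrow> t * real (card {a \<in> A. f a \<ge> t}) \<le> c" "c \<ge> 0"
  shows "sum f A \<le> c * harm (card A)"
  using assms
proof (induction "card A" arbitrary: A)
  case 0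
  then show ?case by (simp add: harm_def)
next
  case (Suc n)
  then have ne: "A \<noteq> {}" by auto
  define m where "m = arg_min_on f A"
  have m: "m \<in> A" "\<And>a. a \<in> A \<Longrightarrow> f m \<le> f a"
    using ne Suc.prems(1) unfolding m_def by (auto intro: arg_min_if_finite arg_min_least)
  have fm: "f m \<le> c * inverse (real (Suc n))"
  proof (cases "f m > 0")
    case True
    have "{a \<in> A. f a \<ge> f m} = A" using m by auto
    then show ?thesis using Suc.prems(2)[OF True] Suc.hyps(2) by (simp add: field_simps)
  next
    case False
    have "0 \<le> c * inverse (real (Suc n))" using Suc.prems(3) by simp
    with False show ?thesis by linarith
  qed
  have "sum f (A - {m}) \<le> c * harm (card (A - {m}))"
  proof (rule Suc.hyps(1))
    show "n = card (A - {m})" using Suc.hyps(2) m(1) Suc.prems(1) by simp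
    show "finite (A - {m})" "c \<ge> 0" using Suc.prems by auto
    fix t :: real assume t: "t > 0"
    have "card {a \<in> A - {m}. f a \<ge> t} \<le> card {a \<in> A. f a \<ge> t}"
      by (rule card_mono) (use Suc.prems in auto)
    then have "t * real (card {a \<in> A - {m}. f a \<ge> t}) \<le> t * real (card {a \<in> A. f a \<ge> t})"
      using t by simp
    with Suc.prems(2)[OF t] show "t * real (card {a \<in> A - {m}. f a \<ge> t}) \<le> c" by linarith
  qed
  moreover have "card (A - {m}) = n" using Suc.hyps(2) m(1) Suc.prems(1) by simp
  moreover have "sum f A = f m + sum f (A - {m})" using m Suc.prems(1) by (simp add: sum.remove)
  moreover have "harm (card A) = harm n + inverse (real (Suc n))"
    unfolding Suc.hyps(2)[symmetric] by (simp add: harm_Suc)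
  ultimately show ?case using fm by (simp add: distrib_left)
qed

lemma harm_le: "n \<ge> 1 \<Longrightarrow> harm n \<le> 1 + log 2 (real n)"
proof -
  assume n: "n \<ge> 1"
  have "harm n - ln (real n) \<le> harm 1 - ln (real 1)"
    using decseqD[OF decseq_harm_diff_ln, of 0 "n - 1"] n by simp
  moreover have "ln (real n) \<le> log 2 (real n)"
  proof -
    have "ln 2 \<le> (1::real)" using ln_le_minus_one[of 2] by simp
    then show ?thesis using n by (simp add: log_def field_simps mult_left_le)
  qed
  ultimately show ?thesis by (simp add: harm_def)
qed

text \<open>Otherwise \<open>sum_le_harm_superlevel\<close> would apply with c equal to the sum
  divided by twice the logarithmic factor, and the sum would be at most half of itself.\<close>

lemma exists_superlevel:
  fixes f :: "'a \<Rightarrow> real"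
  assumes "finite A" "sum f A > 0"
  shows "\<exists>t>0. sum f A \<le> 2 * (1 + log 2 (real (card A))) * (t * real (card {a \<in> A. f a \<ge> t}))"
proof (rule ccontr)
  let ?L = "1 + log 2 (real (card A))"
  assume *: "\<not> ?thesis"
  have "A \<noteq> {}" using assms by auto
  then have c: "card A \<ge> 1" using assms by (simp add: Suc_leI card_gt_0_iff)
  then have L: "?L \<ge> 1" by simp
  have "t * real (card {a \<in> A. f a \<ge> t}) \<le> sum f A / (2 * ?L)" if "t > 0" for t
  proof -
    have "sum f A > 2 * ?L * (t * real (card {a \<in> A. f a \<ge> t}))" using * that by force
    then show ?thesis using L by (simp add: field_simps)
  qed
  then have "sum f A \<le> sum f A / (2 * ?L) * harm (card A)"
    by (rule sum_le_harm_superlevel[OF assms(1)]) (use assms L in simp_all)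
  also have "\<dots> \<le> sum f A / (2 * ?L) * ?L"
    by (rule mult_left_mono) (use harm_le[OF c] assms L in simp_all)
  also have "\<dots> = sum f A / 2" using L by (simp add: field_simps)
  finally show False using assms(2) by simp
qed

text \<open>The values of f meet at most L dyadic intervals, so one of these carries the fraction 1
  / L of the sum of g.\<close>

lemma dyadic_pigeonhole:
  fixes f :: "'a \<Rightarrow> nat" and g :: "'a \<Rightarrow> real"
  assumes "finite S" "\<And>x. x \<in> S \<Longrightarrow> 1 \<le> f x \<and> f x \<le> N" "\<And>x. x \<in> S \<Longrightarrow> g x \<ge> 0"
    and L: "L \<ge> 1" "L \<ge> 1 + log 2 (real N)"
  shows "\<exists>j. sum g S \<le> L * sum g {x \<in> S. 2 ^ j \<le> f x \<and> f x < 2 ^ Suc j}"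
proof (rule ccontr)
  assume *: "\<not> ?thesis"
  define j where "j x = nat \<lfloor>log 2 (real (f x))\<rfloor>" for x
  define W where "W i = sum g {x \<in> S. 2 ^ i \<le> f x \<and> f x < 2 ^ Suc i}" for i :: nat
  have W: "W i < sum g S / L" for i
  proof -
    have "sum g S > L * W i" using * unfolding W_def not_ex not_le by blast
    then show ?thesis using L by (simp add: field_simps)
  qed
  have W0: "W i \<ge> 0" for i unfolding W_def by (rule sum_nonneg) (use assms in auto)
  \<comment> \<open>Level 0 of the negated claim makes the sum of g positive, so S is nonempty and N
    is at least 1; this excludes the default value of \<open>log 2 0\<close>.\<close>
  have "0 < sum g S / L" using W[of 0] W0[of 0] by linarith
  then have pos: "sum g S > 0" using L by (simp add: zero_less_divide_iff)
  then have "S \<noteq> {}" by auto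
  then have N: "N \<ge> 1" using assms(2) by fastforce
  have js: "2 ^ j x \<le> f x \<and> f x < 2 ^ Suc (j x)" if "x \<in> S" for x
  proof -
    have f1: "real (f x) \<ge> 1" using assms(2)[OF that] by simp
    then have l0: "log 2 (real (f x)) \<ge> 0" by simp
    have "real (j x) \<le> log 2 (real (f x))" "log 2 (real (f x)) < real (Suc (j x))"
      unfolding j_def using l0 by linarith+
    then have "2 powr real (j x) \<le> real (f x)" "real (f x) < 2 powr real (Suc (j x))"
      using f1 by (simp_all add: le_log_iff log_less_iff del: of_nat_Suc)
    then have "(2::real) ^ j x \<le> real (f x)" "real (f x) < 2 ^ Suc (j x)"
      by (simp_all only: powr_realpow[of 2, simplified])
    moreover have "(2::real) ^ j x = real (2 ^ j x)" "(2::real) ^ Suc (j x) = real (2 ^ Suc (j x))" by simp_all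
    ultimately show ?thesis by (simp only: of_nat_le_iff of_nat_less_iff)
  qed
  define J where "J = {..nat \<lfloor>log 2 (real N)\<rfloor>}"
  have jJ: "j ` S \<subseteq> J"
  proof
    fix i assume "i \<in> j ` S"
    then obtain x where x: "x \<in> S" "i = j x" by auto
    have "log 2 (real (f x)) \<le> log 2 (real N)" using assms(2)[OF x(1)] by simp
    then show "i \<in> J" unfolding J_def x(2) j_def by (auto intro!: nat_mono floor_mono)
  qed
  have "sum g S = (\<Sum>i\<in>J. sum g {x \<in> S. j x = i})"
    using sum.group[OF assms(1) _ jJ, of g] by (simp add: J_def)
  also have "\<dots> \<le> (\<Sum>i\<in>J. W i)"
    unfolding W_def by (intro sum_mono sum_mono2) (use assms js in auto)
  also have "\<dots> < real (card J) * (sum g S / L)"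
    by (rule order.strict_trans2[OF sum_strict_mono[of _ _ "\<lambda>_. sum g S / L"]])
      (use W in \<open>auto simp: J_def\<close>)
  also have "\<dots> \<le> L * (sum g S / L)"
  proof (rule mult_right_mono)
    have "log 2 (real N) \<ge> 0" using N by simp
    then have "real (card J) \<le> 1 + log 2 (real N)" unfolding J_def by (simp add: )
    then show "real (card J) \<le> L" using L by linarith
  qed (use pos L in simp)
  finally show False using L by simp
qed

lemma sum_powers_le_dyadic_level:
  fixes f :: "'a \<Rightarrow> nat"
  assumes "finite S" "\<And>x. x \<in> S \<Longrightarrow> 1 \<le> f x \<and> f x \<le> N" "L \<ge> 1" "L \<ge> 1 + log 2 (real N)"
  shows "\<exists>j. (\<Sum>x\<in>S. real (f x) ^ k)
    \<le> 2 ^ k * L * (real (card {x \<in> S. 2 ^ j \<le> f x \<and> f x < 2 ^ Suc j}) * (2 ^ j) ^ k)"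
proof -
  obtain j where j: "(\<Sum>x\<in>S. real (f x) ^ k)
      \<le> L * (\<Sum>x\<in>{x \<in> S. 2 ^ j \<le> f x \<and> f x < 2 ^ Suc j}. real (f x) ^ k)"
    by (rule exE[OF dyadic_pigeonhole[of S f N "\<lambda>x. real (f x) ^ k" L]]) (use assms in auto)
  let ?P = "{x \<in> S. 2 ^ j \<le> f x \<and> f x < 2 ^ Suc j}"
  have "(\<Sum>x\<in>?P. real (f x) ^ k) \<le> real (card ?P) * (2 ^ Suc j) ^ k"
  proof (rule sum_bounded_above)
    fix x assume "x \<in> ?P"
    then have "f x \<le> 2 ^ Suc j" by auto
    then have "real (f x) \<le> real (2 ^ Suc j)" by (simp only: of_nat_le_iff)
    then have "real (f x) \<le> 2 ^ Suc j" by simp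
    then show "real (f x) ^ k \<le> (2 ^ Suc j) ^ k" by (rule power_mono) simp
  qed
  then have "L * (\<Sum>x\<in>?P. real (f x) ^ k) \<le> L * (real (card ?P) * (2 ^ Suc j) ^ k)"
    using assms by (intro mult_left_mono) auto
  also have "\<dots> = 2 ^ k * L * (real (card ?P) * (2 ^ j) ^ k)" by (simp add: power_mult_distrib)
  finally show ?thesis using j by (intro exI[of _ j]) linarith
qed

lemma sum_squares_le_dyadic_level:
  fixes f :: "'a \<Rightarrow> nat"
  assumes "finite S" "\<And>x. x \<in> S \<Longrightarrow> 1 \<le> f x \<and> f x \<le> N" "L \<ge> 1" "L \<ge> 1 + log 2 (real N)"
  shows "\<exists>j. (\<Sum>x\<in>S. (real (f x))\<^sup>2)
    \<le> 4 * L * (real (card {x \<in> S. 2 ^ j \<le> f x \<and> f x < 2 ^ Suc j}) * (2 ^ j)\<^sup>2)"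
proof -
  have "\<exists>j. (\<Sum>x\<in>S. (real (f x))\<^sup>2)
      \<le> 2\<^sup>2 * L * (real (card {x \<in> S. 2 ^ j \<le> f x \<and> f x < 2 ^ Suc j}) * (2 ^ j)\<^sup>2)"
    by (rule sum_powers_le_dyadic_level[OF assms(1) _ assms(3,4)]) (rule assms(2))
  then show ?thesis by simp
qed

lemma sum_cube_le_of_superlevel:
  fixes f :: "'a \<Rightarrow> nat"
  assumes "finite S" "\<And>x. x \<in> S \<Longrightarrow> 1 \<le> f x \<and> f x \<le> N" "L \<ge> 1" "L \<ge> 1 + log 2 (real N)"
  shows "\<exists>j. (\<Sum>x\<in>S. real (f x) ^ 3) \<le> 8 * L * (real (card {x \<in> S. 2 ^ j \<le> f x}) * (2 ^ j) ^ 3)"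
proof -
  have "\<exists>j. (\<Sum>x\<in>S. real (f x) ^ 3)
      \<le> 2 ^ 3 * L * (real (card {x \<in> S. 2 ^ j \<le> f x \<and> f x < 2 ^ Suc j}) * (2 ^ j) ^ 3)"
    by (rule sum_powers_le_dyadic_level[OF assms(1) _ assms(3,4)]) (rule assms(2))
  then obtain j where "(\<Sum>x\<in>S. real (f x) ^ 3)
      \<le> 2 ^ 3 * L * (real (card {x \<in> S. 2 ^ j \<le> f x \<and> f x < 2 ^ Suc j}) * (2 ^ j) ^ 3)" by blast
  also have "\<dots> \<le> 2 ^ 3 * L * (real (card {x \<in> S. 2 ^ j \<le> f x}) * (2 ^ j) ^ 3)"
    by (intro mult_left_mono mult_right_mono of_nat_mono card_mono) (use assms in auto)
  finally show ?thesis by (intro exI[of _ j]) simp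
qed

text \<open>Cubic decay of the superlevel sets makes the dyadic levels of the plain sum geometric,
  so no logarithm is lost. With q the least value, the elements below 2q contribute at most 2 H /
  q^2 and the rest, by induction with threshold 2q, at most H / q^2.\<close>

lemma sum_le_of_cubic_superlevel:
  fixes f :: "'a \<Rightarrow> real"
  assumes "finite S" "k > 0" "\<And>x. x \<in> S \<Longrightarrow> f x \<ge> k"
    "\<And>t. t \<ge> k \<Longrightarrow> real (card {x \<in> S. f x \<ge> t}) * t ^ 3 \<le> H" "H \<ge> 0"
  shows "sum f S \<le> 4 * H / k\<^sup>2"
  using assms
proof (induction "card S" arbitrary: S k rule: less_induct)
  case less
  show ?case
  proof (cases "S = {}")
    case True
    then show ?thesis using less.prems by simp
  next
    case False
    define m where "m = arg_min_on f S"
    have m: "m \<in> S" "\<And>a. a \<in> S \<Longrightarrow> f m \<le> f a"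
      using False less.prems(1) unfolding m_def by (auto intro: arg_min_if_finite arg_min_least)
    \<comment> \<open>Starting from the least value instead of k makes T a proper subset of S, which
      drives the induction on the cardinality.\<close>
    define q where "q = f m"
    have q: "q \<ge> k" "q > 0" using less.prems m unfolding q_def by (auto intro: order.strict_trans2)
    define T where "T = {x \<in> S. f x \<ge> 2 * q}"
    have "m \<notin> T" using q unfolding T_def q_def by auto
    then have "card T < card S" using m(1) less.prems(1)
      by (intro psubset_card_mono) (auto simp: T_def)
    moreover have "real (card {x \<in> T. f x \<ge> t}) * t ^ 3 \<le> H" if "t \<ge> 2 * q" for t
    proof -
      have "real (card {x \<in> T. f x \<ge> t}) * t ^ 3 \<le> real (card {x \<in> S. f x \<ge> t}) * t ^ 3"
        by (intro mult_right_mono of_nat_mono card_mono) (use less.prems that q in \<open>auto simp: T_def\<close>)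
      also have "\<dots> \<le> H" using less.prems(4)[of t] that q by auto
      finally show ?thesis .
    qed
    ultimately have T: "sum f T \<le> 4 * H / (2 * q)\<^sup>2"
      by (intro less.hyps) (use less.prems q in \<open>auto simp: T_def\<close>)
    have "sum f (S - T) \<le> real (card (S - T)) * (2 * q)"
      by (rule sum_bounded_above) (auto simp: T_def)
    also have "\<dots> \<le> real (card {x \<in> S. f x \<ge> q}) * (2 * q)"
      by (intro mult_right_mono of_nat_mono card_mono) (use less.prems q m in \<open>auto simp: q_def\<close>)
    also have "\<dots> = 2 * (real (card {x \<in> S. f x \<ge> q}) * q ^ 3) / q\<^sup>2"
      using q by (simp add: power2_eq_square power3_eq_cube)
    also have "\<dots> \<le> 2 * H / q\<^sup>2"
      using less.prems(4)[of q] q by (intro divide_right_mono) auto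
    finally have "sum f (S - T) \<le> 2 * H / q\<^sup>2" .
    moreover have "sum f S = sum f (S - T) + sum f T"
      using less.prems(1) by (intro sum.subset_diff) (auto simp: T_def)
    ultimately have "sum f S \<le> 2 * H / q\<^sup>2 + 4 * H / (2 * q)\<^sup>2" using T by linarith
    also have "\<dots> = 3 * H / q\<^sup>2" by (simp add: power_mult_distrib)
    also have "\<dots> \<le> 4 * H / k\<^sup>2"
      using less.prems q by (intro frac_le mult_right_mono power_mono) auto
    finally show ?thesis .
  qed
qed

text \<open>Convexity of the cube with weights a / (a + b) and b / (a + b), cleared of
  denominators.\<close>

lemma cube_weighted_convex:
  fixes a b p q :: real
  assumes "a \<ge> 0" "b \<ge> 0" "p \<ge> 0" "q \<ge> 0"
  shows "(a * p + b * q) ^ 3 \<le> (a + b)\<^sup>2 * (a * p ^ 3 + b * q ^ 3)"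
proof -
  have "(a + b)\<^sup>2 * (a * p ^ 3 + b * q ^ 3) - (a * p + b * q) ^ 3
      = a * b * (p - q)\<^sup>2 * ((2 * a + b) * p + (a + 2 * b) * q)"
    by (simp add: power2_eq_square power3_eq_cube algebra_simps)
  also have "\<dots> \<ge> 0" using assms by simp
  finally show ?thesis by simp
qed

text \<open>The triangle inequality for the l^3 norm without cube roots: norms at most K^(1/3) a and
  K^(1/3) b add up. It is the convexity inequality with weights a and b at the points u / a and v /
  b.\<close>

lemma Minkowski_cubes:
  fixes u v :: "'a \<Rightarrow> real"
  assumes nn: "\<And>x. x \<in> S \<Longrightarrow> u x \<ge> 0" "\<And>x. x \<in> S \<Longrightarrow> v x \<ge> 0"
    and a: "a > 0" "b > 0"
    and u: "(\<Sum>x\<in>S. u x ^ 3) \<le> K * a ^ 3" and v: "(\<Sum>x\<in>S. v x ^ 3) \<le> K * b ^ 3"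
  shows "(\<Sum>x\<in>S. (u x + v x) ^ 3) \<le> K * (a + b) ^ 3"
proof -
  have "(\<Sum>x\<in>S. (u x + v x) ^ 3) \<le> (\<Sum>x\<in>S. (a + b)\<^sup>2 * (u x ^ 3 / a\<^sup>2 + v x ^ 3 / b\<^sup>2))"
  proof (rule sum_mono)
    fix x assume "x \<in> S"
    then have "(a * (u x / a) + b * (v x / b)) ^ 3 \<le> (a + b)\<^sup>2 * (a * (u x / a) ^ 3 + b * (v x / b) ^ 3)"
      using nn a by (intro cube_weighted_convex) auto
    moreover have "a * (u x / a) ^ 3 = u x ^ 3 / a\<^sup>2" "b * (v x / b) ^ 3 = v x ^ 3 / b\<^sup>2"
      using a by (simp_all add: power2_eq_square power3_eq_cube field_simps)
    ultimately show "(u x + v x) ^ 3 \<le> (a + b)\<^sup>2 * (u x ^ 3 / a\<^sup>2 + v x ^ 3 / b\<^sup>2)"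
      using a by simp
  qed
  also have "\<dots> = (a + b)\<^sup>2 * ((\<Sum>x\<in>S. u x ^ 3) / a\<^sup>2 + (\<Sum>x\<in>S. v x ^ 3) / b\<^sup>2)"
    by (simp add: sum_distrib_left sum.distrib sum_divide_distrib distrib_left)
  also have "\<dots> \<le> (a + b)\<^sup>2 * (K * a ^ 3 / a\<^sup>2 + K * b ^ 3 / b\<^sup>2)"
    using u v by (intro mult_left_mono add_mono divide_right_mono) auto
  also have "\<dots> = K * (a + b) ^ 3"
    using a by (simp add: power2_eq_square power3_eq_cube field_simps)
  finally show ?thesis .
qed

section \<open>Incidences in Cartesian products\<close>

lemma exists_monotone_blocks:
  fixes X :: "real set"
  assumes "finite X" "0 < r" "r \<le> card X"
  shows "\<exists>\<beta>::real \<Rightarrow> nat. (\<forall>x y. x \<le> y \<longrightarrow> \<beta> x \<le> \<beta> y) \<and> (\<forall>x\<in>X. \<beta> x < r) \<and>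
    (\<forall>v. r * card {x \<in> X. \<beta> x = v} \<le> 2 * card X)"
proof -
  \<comment> \<open>Points are numbered by rank and cut into blocks of length q. As q r exceeds |X|,
    the block indices stay below r; as r <= |X|, one has r q <= 2 |X|.\<close>
  define q where "q = card X div r + 1"
  define \<rho> where "\<rho> x = card {y \<in> X. y < x}" for x
  have q: "q > 0" by (simp add: q_def)
  have mono: "\<rho> x \<le> \<rho> y" if "x \<le> y" for x y
    unfolding \<rho>_def by (rule card_mono) (use assms that in auto)
  have smono: "\<rho> x < \<rho> y" if "x < y" "x \<in> X" for x y
    unfolding \<rho>_def by (rule psubset_card_mono) (use assms that in auto)
  have inj: "inj_on \<rho> X"
  proof (rule inj_onI)
    fix x y assume "x \<in> X" "y \<in> X" "\<rho> x = \<rho> y"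
    then show "x = y" using smono[of x y] smono[of y x] by (cases x y rule: linorder_cases) auto
  qed
  have lt: "\<rho> x < card X" if "x \<in> X" for x
    unfolding \<rho>_def by (rule psubset_card_mono) (use assms that in auto)
  have qr: "card X < q * r"
    unfolding q_def using assms(2) by (metis add.commute dividend_less_times_div mult.commute mult_Suc_right plus_1_eq_Suc)
  have rq: "r * q \<le> 2 * card X"
    proof -
    have "r * (card X div r) \<le> card X" by simp
    with assms(3) show ?thesis unfolding q_def distrib_left by linarith
  qed
  have "r * card {x \<in> X. \<rho> x div q = v} \<le> 2 * card X" for v
  proof -
    have "card {x \<in> X. \<rho> x div q = v} = card (\<rho> ` {x \<in> X. \<rho> x div q = v})"
      by (rule card_image[symmetric]) (rule inj_on_subset[OF inj], auto)
    also have "\<dots> \<le> card {v * q..<v * q + q}"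
    proof (rule card_mono)
      show "\<rho> ` {x \<in> X. \<rho> x div q = v} \<subseteq> {v * q..<v * q + q}"
      proof safe
        fix x
        have "\<rho> x = \<rho> x div q * q + \<rho> x mod q" by simp
        moreover have "\<rho> x mod q < q" using q by simp
        ultimately show "\<rho> x \<in> {\<rho> x div q * q..<\<rho> x div q * q + q}"
          by (metis atLeastLessThan_iff le_add1 nat_add_left_cancel_less)
      qed
    qed simp
    finally have "r * card {x \<in> X. \<rho> x div q = v} \<le> r * q" by simp
    with rq show ?thesis by linarith
  qed
  moreover have "\<rho> x div q < r" if "x \<in> X" for x
    using lt[OF that] qr q by (simp add: div_less_iff_less_mult mult.commute)
  ultimately show ?thesis
    by (intro exI[of _ "\<lambda>x. \<rho> x div q"]) (auto intro: div_le_mono mono)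
qed

lemma card_same_block_pairs:
  fixes \<beta> :: "'a \<Rightarrow> nat"
  assumes "finite X" "\<And>x. x \<in> X \<Longrightarrow> \<beta> x < r" "\<And>v. r * card {x \<in> X. \<beta> x = v} \<le> 2 * card X"
  shows "r * card {p \<in> X \<times> X. \<beta> (fst p) = \<beta> (snd p)} \<le> 2 * (card X)\<^sup>2"
proof -
  have "r * card {p \<in> X \<times> X. \<beta> (fst p) = \<beta> (snd p)}
      = (\<Sum>v<r. card {x \<in> X. \<beta> x = v} * (r * card {x \<in> X. \<beta> x = v}))"
  proof -
    have "\<beta> ` X \<subseteq> {..<r}" using assms(2) by auto
    from card_matching_pairs[OF assms(1,1) _ this, of \<beta>] show ?thesis
      by (simp add: sum_distrib_left ac_simps)
  qed
  also have "\<dots> \<le> (\<Sum>v<r. card {x \<in> X. \<beta> x = v} * (2 * card X))"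
    by (intro sum_mono mult_left_mono assms(3)) simp
  also have "\<dots> = card X * (2 * card X)"
  proof -
    have "(\<Sum>x\<in>X. 1) = (\<Sum>v<r. of_nat (card {x \<in> X. \<beta> x = v}) * (1::nat))"
      by (rule sum_fun_comp) (use assms in auto)
    then show ?thesis by (simp add: sum_distrib_right)
  qed
  finally show ?thesis by (simp add: power2_eq_square)
qed

text \<open>A line is the pair of its slope and its intercept, and its points in the grid
  \<open>X \<times> Y\<close> are recorded by their abscissas.\<close>

definition rich_points :: "real set \<Rightarrow> real set \<Rightarrow> real \<times> real \<Rightarrow> real set" where
  "rich_points X Y l = {x \<in> X. fst l * x + snd l \<in> Y}"

lemma card_rich_points_le:
  assumes "finite X" "finite Y" "fst l \<noteq> 0"
  shows "card (rich_points X Y l) \<le> card X" "card (rich_points X Y l) \<le> card Y"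
proof -
  show "card (rich_points X Y l) \<le> card X"
    by (rule card_mono) (use assms in \<open>auto simp: rich_points_def\<close>)
  have "card (rich_points X Y l) = card ((\<lambda>x. fst l * x + snd l) ` rich_points X Y l)"
    by (rule card_image[symmetric]) (use assms in \<open>auto simp: inj_on_def\<close>)
  also have "\<dots> \<le> card Y"
    by (rule card_mono) (use assms in \<open>auto simp: rich_points_def\<close>)
  finally show "card (rich_points X Y l) \<le> card Y" .
qed

text \<open>
  A line that is neither horizontal nor vertical passes through few cells of an \<open>r \<times> r\<close> block
  decomposition of the grid, because the block indices are monotone along it. A rich line
  therefore has many pairs of points inside a common cell, and a pair of points determines the line.
\<close>

theorem Szemeredi_Trotter_grid:
  fixes X Y :: "real set" and F :: "(real \<times> real) set"
  assumes fin: "finite X" "finite Y" "finite F" and k: "k \<ge> 2"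
    and slope: "\<And>l. l \<in> F \<Longrightarrow> fst l \<noteq> 0"
    and rich: "\<And>l. l \<in> F \<Longrightarrow> k \<le> real (card (rich_points X Y l))"
  shows "real (card F) * k ^ 3 \<le> 144 * (real (card X))\<^sup>2 * (real (card Y))\<^sup>2"
proof (cases "F = {}")
  case False
  then obtain l0 where l0: "l0 \<in> F" by blast
  \<comment> \<open>The bound r <= (k + 2) / 4 gives 2 r - 1 <= k / 2. A line meets at most 2 r - 1
    cells, so a line with at least k points averages two or more per cell. Conversely r >= k / 6,
    since r is also at least 1.\<close>
  define r where "r = nat \<lfloor>(k + 2) / 4\<rfloor>"
  have r1: "r \<ge> 1" using k by (simp add: r_def le_nat_floor)
  have r2: "real r \<le> (k + 2) / 4" "(k + 2) / 4 < real r + 1"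
  proof -
    have "real r = of_int \<lfloor>(k + 2) / 4\<rfloor>" unfolding r_def using k by simp
    then show "real r \<le> (k + 2) / 4" "(k + 2) / 4 < real r + 1" by linarith+
  qed
  have r6: "k / 6 \<le> real r" using of_nat_mono[OF r1, where 'a = real] r2 by simp
  have "k \<le> real (card X)" "k \<le> real (card Y)"
    using rich[OF l0] card_rich_points_le[OF fin(1,2) slope[OF l0]] by linarith+
  then have "real r \<le> real (card X)" "real r \<le> real (card Y)" using r2(1) k by simp_all
  then have rXY: "r \<le> card X" "r \<le> card Y" by simp_all
  obtain \<beta> :: "real \<Rightarrow> nat" where \<beta>: "\<And>x y. x \<le> y \<Longrightarrow> \<beta> x \<le> \<beta> y" "\<And>x. x \<in> X \<Longrightarrow> \<beta> x < r"
      "\<And>v. r * card {x \<in> X. \<beta> x = v} \<le> 2 * card X"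
    using exists_monotone_blocks[of X r] fin r1 rXY by auto
  obtain \<gamma> :: "real \<Rightarrow> nat" where \<gamma>: "\<And>x y. x \<le> y \<Longrightarrow> \<gamma> x \<le> \<gamma> y" "\<And>x. x \<in> Y \<Longrightarrow> \<gamma> x < r"
      "\<And>v. r * card {x \<in> Y. \<gamma> x = v} \<le> 2 * card Y"
    using exists_monotone_blocks[of Y r] fin r1 rXY by auto
  define PX where "PX = {p \<in> X \<times> X. \<beta> (fst p) = \<beta> (snd p)}"
  define PY where "PY = {p \<in> Y \<times> Y. \<gamma> (fst p) = \<gamma> (snd p)}"
  have fP: "finite PX" "finite PY" using fin by (auto simp: PX_def PY_def)
  have cX: "r * card PX \<le> 2 * (card X)\<^sup>2" and cY: "r * card PY \<le> 2 * (card Y)\<^sup>2"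
    unfolding PX_def PY_def by (rule card_same_block_pairs; use fin \<beta> \<gamma> in auto)+
  define Q where "Q l = {p \<in> rich_points X Y l \<times> rich_points X Y l. fst p \<noteq> snd p \<and>
      \<beta> (fst p) = \<beta> (snd p) \<and> \<gamma> (fst l * fst p + snd l) = \<gamma> (fst l * snd p + snd l)}" for l
  have fR: "finite (rich_points X Y l)" for l using fin by (simp add: rich_points_def)
  have fQ: "finite (Q l)" for l using fR by (simp add: Q_def)
  have Qk: "k \<le> real (card (Q l))" if l: "l \<in> F" for l
  proof -
    let ?S = "rich_points X Y l" and ?g = "\<lambda>x. \<gamma> (fst l * x + snd l)"
    \<comment> \<open>The sum of the two block indices, the second one reversed for negative slope,
      is monotone along the line and takes at most 2 r - 1 values. Equal values force both indices
      to agree.\<close>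
    define \<sigma> where "\<sigma> x = (if fst l > 0 then \<beta> x + ?g x else \<beta> x + (r - 1 - ?g x))" for x
    have gr: "?g x < r" if "x \<in> ?S" for x using that \<gamma>(2) by (simp add: rich_points_def)
    have br: "\<beta> x < r" if "x \<in> ?S" for x using that \<beta>(2) by (simp add: rich_points_def)
    have eq: "\<beta> x = \<beta> y \<and> ?g x = ?g y" if xy: "x \<in> ?S" "y \<in> ?S" "x \<le> y" "\<sigma> x = \<sigma> y" for x y
    proof (cases "fst l > 0")
      case True
      then have "?g x \<le> ?g y" using xy by (intro \<gamma>(1)) simp
      with \<beta>(1)[OF xy(3)] xy(4) True show ?thesis by (simp add: \<sigma>_def)
    next
      case False
      then have "?g y \<le> ?g x" using xy by (intro \<gamma>(1)) (simp add: mult_left_mono_neg)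
      moreover have "\<beta> x + (r - 1 - ?g x) = \<beta> y + (r - 1 - ?g y)"
        using xy(4) False unfolding \<sigma>_def by (simp only: if_False)
      ultimately have "\<beta> x = \<beta> y" "?g x = ?g y"
        using \<beta>(1)[OF xy(3)] gr[OF xy(1)] by linarith+
      then show ?thesis by simp
    qed
    have im: "\<sigma> ` ?S \<subseteq> {..<2 * r - 1}"
    proof safe
      fix x assume "x \<in> ?S"
      then show "\<sigma> x < 2 * r - 1" using gr[of x] br[of x] by (auto simp: \<sigma>_def)
    qed
    have sub: "{p \<in> ?S \<times> ?S. \<sigma> (fst p) = \<sigma> (snd p)} \<subseteq> Q l \<union> (\<lambda>x. (x, x)) ` ?S"
    proof
      fix p assume p: "p \<in> {p \<in> ?S \<times> ?S. \<sigma> (fst p) = \<sigma> (snd p)}"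
      then have p': "fst p \<in> ?S" "snd p \<in> ?S" "\<sigma> (fst p) = \<sigma> (snd p)" by auto
      have e: "\<beta> (fst p) = \<beta> (snd p) \<and> ?g (fst p) = ?g (snd p)"
      proof (cases "fst p \<le> snd p")
        case True
        then show ?thesis by (rule eq[OF p'(1,2) _ p'(3)])
      next
        case False
        then have "snd p \<le> fst p" by simp
        from eq[OF p'(2,1) this p'(3)[symmetric]] show ?thesis by argo
      qed
      show "p \<in> Q l \<union> (\<lambda>x. (x, x)) ` ?S"
      proof (cases "fst p = snd p")
        case True
        then have "p = (fst p, fst p)" by (simp add: prod_eq_iff)
        with p'(1) show ?thesis by blast
      next
        case False
        with p e show ?thesis unfolding Q_def by blast
      qed
    qed
    have "card {p \<in> ?S \<times> ?S. \<sigma> (fst p) = \<sigma> (snd p)} \<le> card (Q l) + card ?S"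
    proof -
      have "card {p \<in> ?S \<times> ?S. \<sigma> (fst p) = \<sigma> (snd p)} \<le> card (Q l \<union> (\<lambda>x. (x, x)) ` ?S)"
        by (rule card_mono[OF _ sub]) (simp add: fQ[of l] fR[of l])
      also have "\<dots> \<le> card (Q l) + card ((\<lambda>x. (x, x)) ` ?S)" by (rule card_Un_le)
      also have "\<dots> \<le> card (Q l) + card ?S" by (rule add_left_mono) (rule card_image_le[OF fR])
      finally show ?thesis .
    qed
    then have cc: "real (card {p \<in> ?S \<times> ?S. \<sigma> (fst p) = \<sigma> (snd p)}) \<le> real (card (Q l)) + real (card ?S)"
      by linarith
    have ci: "real (card (\<sigma> ` ?S)) \<le> 2 * real r - 1"
      using card_mono[OF _ im] r1 by simp
    \<comment> \<open>With s points the chain below reads s^2 <= (s / 2) (|Q| + s), hence |Q| >= s: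
      the off-diagonal pairs in a common cell are at least as many as the points.\<close>
    let ?s = "real (card ?S)"
    have "?s\<^sup>2 \<le> real (card (\<sigma> ` ?S)) * real (card {p \<in> ?S \<times> ?S. \<sigma> (fst p) = \<sigma> (snd p)})"
      by (rule card_sq_le_image_mult_collisions[OF fR])
    also have "\<dots> \<le> (2 * real r - 1) * (real (card (Q l)) + ?s)"
      by (rule mult_mono[OF ci cc]) (use r1 in auto)
    also have "\<dots> \<le> (?s / 2) * (real (card (Q l)) + ?s)"
      by (rule mult_right_mono) (use r2 rich[OF l] in auto)
    finally have "?s * ?s \<le> ?s * ((real (card (Q l)) + ?s) / 2)" by (simp add: power2_eq_square)
    then have "?s \<le> (real (card (Q l)) + ?s) / 2"
      using rich[OF l] k by (simp add: mult_le_cancel_left)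
    then have "?s \<le> real (card (Q l))" by (simp add: field_simps)
    with rich[OF l] show ?thesis by (rule order.trans)
  qed
  define h where "h = (\<lambda>(l :: real \<times> real, p :: real \<times> real).
    (p, (fst l * fst p + snd l, fst l * snd p + snd l)))"
  have inj: "inj_on h (Sigma F Q)"
  proof (rule inj_onI)
    fix u v assume uv: "u \<in> Sigma F Q" "v \<in> Sigma F Q" "h u = h v"
    obtain m b p m' b' p' where d: "u = ((m, b), p)" "v = ((m', b'), p')"
      by (metis surj_pair)
    have p: "p' = p" "m * fst p + b = m' * fst p + b'" "m * snd p + b = m' * snd p + b'"
      using uv(3) by (auto simp: h_def d)
    have "fst p \<noteq> snd p" using uv(1) by (auto simp: d Q_def)
    moreover have "(m - m') * (fst p - snd p) = 0" using p by (simp add: algebra_simps)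
    ultimately show "u = v" using p by (simp add: d)
  qed
  have "h ` Sigma F Q \<subseteq> PX \<times> PY"
    by (auto simp: h_def Q_def PX_def PY_def rich_points_def)
  then have "card (Sigma F Q) \<le> card (PX \<times> PY)"
    by (intro card_inj_on_le[OF inj]) (use fP in auto)
  then have "(\<Sum>l\<in>F. card (Q l)) \<le> card PX * card PY"
    using fin fQ by (simp add: card_cartesian_product)
  then have "(\<Sum>l\<in>F. real (card (Q l))) \<le> real (card PX) * real (card PY)"
    by (simp flip: of_nat_sum of_nat_mult)
  moreover have "real (card F) * k \<le> (\<Sum>l\<in>F. real (card (Q l)))"
    by (rule sum_bounded_below) (use Qk in auto)
  ultimately have Fk: "real (card F) * k \<le> real (card PX) * real (card PY)" by linarith
  have "real (card F) * k * (real r)\<^sup>2 \<le> (real r * real (card PX)) * (real r * real (card PY))"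
    using mult_right_mono[OF Fk, of "(real r)\<^sup>2"] by (simp add: power2_eq_square ac_simps)
  also have "\<dots> \<le> (2 * (real (card X))\<^sup>2) * (2 * (real (card Y))\<^sup>2)"
    by (rule mult_mono)
      (use of_nat_mono[OF cX, where 'a = real] of_nat_mono[OF cY, where 'a = real] in simp_all)
  finally have 1: "real (card F) * k * (real r)\<^sup>2 \<le> 4 * (real (card X))\<^sup>2 * (real (card Y))\<^sup>2" by simp
  \<comment> \<open>Replacing r by k / 6 turns the factor 4 into 4 * 36 = 144.\<close>
  have "real (card F) * k * (k / 6)\<^sup>2 \<le> real (card F) * k * (real r)\<^sup>2"
    using k r6 by (intro mult_left_mono power_mono) auto
  with 1 show ?thesis by (simp add: power2_eq_square power3_eq_cube)
qed simp

text \<open>Each level of lines with at least 2^j points contributes the same bound to the sum of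
  cubes, so summing over the levels costs only a factor L.\<close>

lemma sum_rich_points_cubes:
  fixes X Y :: "real set" and F :: "(real \<times> real) set"
  assumes fin: "finite X" "finite Y" "finite F"
    and slope: "\<And>l. l \<in> F \<Longrightarrow> fst l \<noteq> 0"
    and rich: "\<And>l. l \<in> F \<Longrightarrow> 2 \<le> card (rich_points X Y l)"
    and L: "L \<ge> 1" "L \<ge> 1 + log 2 (real (card X))"
  shows "(\<Sum>l\<in>F. real (card (rich_points X Y l)) ^ 3)
    \<le> 2 ^ 14 * L * (real (card X))\<^sup>2 * (real (card Y))\<^sup>2"
proof -
  let ?c = "\<lambda>l. card (rich_points X Y l)" and ?B = "(real (card X))\<^sup>2 * (real (card Y))\<^sup>2"
  have b: "1 \<le> ?c l \<and> ?c l \<le> card X" if "l \<in> F" for l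
    using rich[OF that] card_rich_points_le[OF fin(1,2) slope[OF that]] by auto
  obtain j where j: "(\<Sum>l\<in>F. real (?c l) ^ 3) \<le> 8 * L * (real (card {l \<in> F. 2 ^ j \<le> ?c l}) * (2 ^ j) ^ 3)"
    by (rule exE[OF sum_cube_le_of_superlevel[of F ?c "card X" L]]) (use fin b L in auto)
  have "real (card {l \<in> F. 2 ^ j \<le> ?c l}) * (2 ^ j) ^ 3 \<le> 2048 * ?B"
  proof (cases "j = 0")
    case True
    \<comment> \<open>The grid bound asks for a threshold of at least 2, so level 2^0 is treated
      with threshold 2, which all lines of F meet.\<close>
    have "real (card F) * 2 ^ 3 \<le> 144 * (real (card X))\<^sup>2 * (real (card Y))\<^sup>2"
      by (rule Szemeredi_Trotter_grid) (use fin slope rich in auto)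
    moreover have "{l \<in> F. 2 ^ j \<le> ?c l} = F" using True b by auto
    ultimately show ?thesis using True by simp
  next
    case False
    have "real (card {l \<in> F. 2 ^ j \<le> ?c l}) * (2 ^ j) ^ 3 \<le> 144 * (real (card X))\<^sup>2 * (real (card Y))\<^sup>2"
    proof (rule Szemeredi_Trotter_grid)
      show "2 \<le> (2::real) ^ j" using power_increasing[of 1 j "2::real"] False by simp
      fix l assume "l \<in> {l \<in> F. 2 ^ j \<le> ?c l}"
      then show "2 ^ j \<le> real (?c l)" by simp
    qed (use fin slope in auto)
    moreover have "0 \<le> ?B" by simp
    ultimately show ?thesis by linarith
  qed
  then have "8 * L * (real (card {l \<in> F. 2 ^ j \<le> ?c l}) * (2 ^ j) ^ 3) \<le> 8 * L * (2048 * ?B)"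
    by (rule mult_left_mono) (use L in simp)
  also have "\<dots> = 2 ^ 14 * L * (real (card X))\<^sup>2 * (real (card Y))\<^sup>2" by simp
  finally show ?thesis using j by linarith
qed

section \<open>Energies and control of third moments\<close>

text \<open>The representation function of the difference set, often written r_{A-B}; a
  representation x = a - b is recorded by b.\<close>

definition rep :: "real set \<Rightarrow> real set \<Rightarrow> real \<Rightarrow> nat" where
  "rep A B x = card {b \<in> B. b + x \<in> A}"

definition energy :: "real set \<Rightarrow> real set \<Rightarrow> real" where
  "energy A B = (\<Sum>x\<in>difference_set A B. (real (rep A B x))\<^sup>2)"

text \<open>
  \<open>cubic_control A \<kappa>\<close> says that \<open>d\<^sub>3\<^sup>+(A) \<le> \<kappa> / |A|\<close> in the notation of the higher energy literature.
\<close>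

definition cubic_control :: "real set \<Rightarrow> real \<Rightarrow> bool" where
  "cubic_control A \<kappa> \<longleftrightarrow> (\<forall>B. finite B \<longrightarrow>
    (\<Sum>x\<in>difference_set A B. real (rep A B x) ^ 3) \<le> \<kappa> * (real (card B))\<^sup>2)"

lemma difference_set_eq_image: "difference_set A B = (\<lambda>p. fst p - snd p) ` (A \<times> B)"
proof (intro set_eqI iffI)
  fix z assume "z \<in> difference_set A B"
  then obtain x y where "z = x - y" "x \<in> A" "y \<in> B" by (auto simp: difference_set_def)
  then show "z \<in> (\<lambda>p. fst p - snd p) ` (A \<times> B)" by (intro image_eqI[of _ _ "(x, y)"]) auto
next
  fix z assume "z \<in> (\<lambda>p. fst p - snd p) ` (A \<times> B)"
  then show "z \<in> difference_set A B" unfolding difference_set_def by fastforce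
qed

lemma finite_difference_set [simp]: "finite A \<Longrightarrow> finite B \<Longrightarrow> finite (difference_set A B)"
  by (simp add: difference_set_eq_image)

lemma rep_eq_fibre: "rep A B x = card {p \<in> A \<times> B. fst p - snd p = x}"
proof -
  have "{p \<in> A \<times> B. fst p - snd p = x} = (\<lambda>b. (b + x, b)) ` {b \<in> B. b + x \<in> A}"
    by (auto simp: image_iff)
  then show ?thesis by (simp add: rep_def card_image inj_on_def)
qed

lemma rep_eq_0: "x \<notin> difference_set A B \<Longrightarrow> rep A B x = 0"
  by (auto simp: rep_eq_fibre difference_set_def card_eq_0_iff)

lemma rep_pos: "finite B \<Longrightarrow> x \<in> difference_set A B \<Longrightarrow> 1 \<le> rep A B x"
  by (force simp: rep_def difference_set_def Suc_le_eq card_gt_0_iff)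

lemma rep_le_left: "finite A \<Longrightarrow> finite B \<Longrightarrow> rep A B x \<le> card A"
  unfolding rep_def by (rule card_inj_on_le[of "\<lambda>b. b + x"]) (auto simp: inj_on_def)

lemma rep_mono: "finite B' \<Longrightarrow> A \<subseteq> A' \<Longrightarrow> B \<subseteq> B' \<Longrightarrow> rep A B x \<le> rep A' B' x"
  unfolding rep_def by (rule card_mono) auto

lemma rep_minus: "rep A A (- x) = rep A A x"
  unfolding rep_def
  by (rule bij_betw_same_card[of "\<lambda>b. b - x"]) (rule bij_betwI[of _ _ _ "\<lambda>b. b + x"], auto)

lemma sum_rep_power_superset:
  assumes "finite I" "difference_set A B \<subseteq> I" "k > 0"
  shows "(\<Sum>x\<in>I. real (rep A B x) ^ k) = (\<Sum>x\<in>difference_set A B. real (rep A B x) ^ k)"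
  by (rule sum.mono_neutral_right) (use assms rep_eq_0 in auto)

lemma card_matching_differences:
  assumes "finite A" "finite B" "finite C" "finite D" "finite I" "difference_set A B \<subseteq> I"
  shows "card {p \<in> (A \<times> B) \<times> (C \<times> D). fst (fst p) - snd (fst p) = fst (snd p) - snd (snd p)}
    = (\<Sum>x\<in>I. rep A B x * rep C D x)"
proof -
  have "(\<lambda>p. fst p - snd p) ` (A \<times> B) \<subseteq> I" using assms(6) by (simp add: difference_set_eq_image)
  from card_matching_pairs[OF _ _ assms(5) this, of "C \<times> D" "\<lambda>p. fst p - snd p"] assms
  show ?thesis by (simp add: rep_eq_fibre)
qed

lemma sum_rep: "finite A \<Longrightarrow> finite B \<Longrightarrow> (\<Sum>x\<in>difference_set A B. rep A B x) = card A * card B"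
proof -
  assume "finite A" "finite B"
  then have "(\<Sum>p\<in>A \<times> B. 1) = (\<Sum>x\<in>difference_set A B. of_nat (card {p \<in> A \<times> B. fst p - snd p = x}) * (1::nat))"
    by (intro sum_fun_comp) (simp_all add: difference_set_eq_image)
  then show ?thesis by (simp add: rep_eq_fibre card_cartesian_product)
qed

lemma energy_eq_card:
  assumes "finite A" "finite B"
  shows "energy A B
    = real (card {p \<in> (A \<times> B) \<times> (A \<times> B). fst (fst p) - snd (fst p) = fst (snd p) - snd (snd p)})"
  using card_matching_differences[of A B A B "difference_set A B"] assms
  by (simp add: energy_def power2_eq_square)

lemma energy_nonneg [simp]: "0 \<le> energy A B"
  by (simp add: energy_def sum_nonneg)

lemma sum_rep_mult_le_sqrt_energy:
  assumes "finite A" "finite B" "finite C" "finite D" "finite I"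
  shows "(\<Sum>x\<in>I. real (rep A B x) * real (rep C D x))\<^sup>2 \<le> energy A B * energy C D"
proof -
  have "(\<Sum>x\<in>I. (real (rep A B x))\<^sup>2) \<le> energy A B" if "finite A" "finite B" for A B
    unfolding energy_def sum_rep_power_superset[symmetric, OF finite_UnI[OF assms(5) finite_difference_set[OF that]], of A B 2, simplified]
    by (rule sum_mono2) (use that assms in auto)
  then have "(\<Sum>x\<in>I. (real (rep A B x))\<^sup>2) * (\<Sum>x\<in>I. (real (rep C D x))\<^sup>2) \<le> energy A B * energy C D"
    using assms by (intro mult_mono) (auto intro: sum_nonneg)
  with Cauchy_Schwarz_ineq_sum show ?thesis by (rule order.trans)
qed

lemma cubic_controlD:
  "cubic_control A \<kappa> \<Longrightarrow> finite B \<Longrightarrow>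
    (\<Sum>x\<in>difference_set A B. real (rep A B x) ^ 3) \<le> \<kappa> * (real (card B))\<^sup>2"
  by (simp add: cubic_control_def)

lemma cubic_control_superlevel:
  assumes "cubic_control A \<kappa>" "finite A" "finite B" "finite S" "t > 0"
    "\<And>x. x \<in> S \<Longrightarrow> t \<le> real (rep A B x)"
  shows "real (card S) * t ^ 3 \<le> \<kappa> * (real (card B))\<^sup>2"
proof -
  have "S \<subseteq> difference_set A B" using assms(5,6) rep_eq_0 by fastforce
  then have "(\<Sum>x\<in>S. real (rep A B x) ^ 3) \<le> (\<Sum>x\<in>difference_set A B. real (rep A B x) ^ 3)"
    by (intro sum_mono2) (use assms in auto)
  moreover have "real (card S) * t ^ 3 \<le> (\<Sum>x\<in>S. real (rep A B x) ^ 3)"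
    by (rule sum_bounded_below) (use assms in \<open>auto intro: power_mono\<close>)
  ultimately show ?thesis using cubic_controlD[OF assms(1,3)] by linarith
qed

text \<open>Cauchy-Schwarz puts the second moment of \<open>rep A B\<close> between the first, which
  is |A| |B|, and the third.\<close>

lemma energy_sq_le:
  assumes "cubic_control A \<kappa>" "finite A" "finite B"
  shows "(energy A B)\<^sup>2 \<le> \<kappa> * real (card A) * real (card B) ^ 3"
proof -
  let ?D = "difference_set A B" and ?r = "\<lambda>x. real (rep A B x)"
  have "energy A B = (\<Sum>x\<in>?D. sqrt (?r x) * sqrt (?r x ^ 3))"
    unfolding energy_def by (intro sum.cong) (simp_all flip: real_sqrt_mult add: power2_eq_square power3_eq_cube real_sqrt_mult)
  also have "\<dots>\<^sup>2 \<le> (\<Sum>x\<in>?D. (sqrt (?r x))\<^sup>2) * (\<Sum>x\<in>?D. (sqrt (?r x ^ 3))\<^sup>2)"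
    by (rule Cauchy_Schwarz_ineq_sum)
  also have "\<dots> = (\<Sum>x\<in>?D. ?r x) * (\<Sum>x\<in>?D. ?r x ^ 3)" by simp
  also have "(\<Sum>x\<in>?D. ?r x) = real (card A) * real (card B)"
    using sum_rep[OF assms(2,3)] by (simp flip: of_nat_sum)
  also have "real (card A) * real (card B) * (\<Sum>x\<in>?D. ?r x ^ 3)
      \<le> real (card A) * real (card B) * (\<kappa> * (real (card B))\<^sup>2)"
    by (intro mult_left_mono cubic_controlD assms) simp
  finally show ?thesis by (simp add: power2_eq_square power3_eq_cube ac_simps)
qed

section \<open>Popular products have small third moments\<close>

text \<open>Write z = a - c with a = x y. Then c = y x - z, so (x, c) lies on the line of slope y
  and intercept -z. Each z in Z yields at least s t such incidences, spread over |Y| lines, and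
  incidence bounds for these |Y| |Z| lines limit |Z|.\<close>

lemma superlevel_of_products_weak:
  fixes A C X Y Z :: "real set"
  assumes fin: "finite A" "finite C" "finite X" "finite Y" "finite Z"
    and nz: "0 \<notin> X" "0 \<notin> Y" and t: "t > 0" and s: "s > 0"
    and A: "\<And>a. a \<in> A \<Longrightarrow> t \<le> real (card {x \<in> X. a / x \<in> Y})"
    and Z: "\<And>z. z \<in> Z \<Longrightarrow> s \<le> real (rep A C z)"
    and YX: "card Y \<le> card X"
  shows "real (card Z) * (s * t) ^ 3 \<le> 8192 * ((real (card X))\<^sup>2 * (real (card Y))\<^sup>2 * (real (card C))\<^sup>2)"
proof (cases "Z = {}")
  case False
  then obtain z0 where z0: "z0 \<in> Z" by blast
  let ?x = "real (card X)" and ?y = "real (card Y)" and ?c = "real (card C)" and ?z = "real (card Z)"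
  define I where "I = (\<lambda>(y, z). card (rich_points X C (y, - z)))"
  have rich: "s * t \<le> (\<Sum>y\<in>Y. real (I (y, z)))" if z: "z \<in> Z" for z
  proof -
    let ?B = "{c \<in> C. c + z \<in> A}"
    have "s * t \<le> real (card ?B) * t" using Z[OF z] t by (simp add: rep_def)
    also have "\<dots> \<le> (\<Sum>c\<in>?B. real (card {x \<in> X. (c + z) / x \<in> Y}))"
      by (rule sum_bounded_below) (use A in auto)
    also have "\<dots> = real (card (SIGMA c:?B. {x \<in> X. (c + z) / x \<in> Y}))"
      using fin by simp
    also have "\<dots> \<le> real (card (SIGMA y:Y. rich_points X C (y, - z)))"
    proof (intro of_nat_mono card_inj_on_le)
      let ?h = "\<lambda>(c, x). ((c + z) / x, x)"
      show "inj_on ?h (SIGMA c:?B. {x \<in> X. (c + z) / x \<in> Y})"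
        using nz by (auto simp: inj_on_def)
      show "?h ` (SIGMA c:?B. {x \<in> X. (c + z) / x \<in> Y}) \<subseteq> (SIGMA y:Y. rich_points X C (y, - z))"
        using nz by (auto simp: rich_points_def)
      show "finite (SIGMA y:Y. rich_points X C (y, - z))"
        using fin by (auto simp: rich_points_def)
    qed
    also have "\<dots> = (\<Sum>y\<in>Y. real (I (y, z)))"
      using fin by (simp add: I_def rich_points_def)
    finally show ?thesis .
  qed
  have st: "s * t > 0" using s t by simp
  have "Y \<noteq> {}" using rich[OF z0] st by auto
  then have y1: "?y \<ge> 1" using fin by (simp add: Suc_leI card_gt_0_iff)
  have x1: "?x \<ge> ?y" using YX by simp
  \<comment> \<open>Half of the guaranteed average number of incidences per line: lines with fewer
    than k points account for at most half of |Z| s t.\<close>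
  define k where "k = s * t / (2 * ?y)"
  have k0: "k > 0" using st y1 by (simp add: k_def)
  have total: "?z * (s * t) \<le> (\<Sum>p\<in>Y \<times> Z. real (I p))"
  proof -
    have "?z * (s * t) \<le> (\<Sum>z\<in>Z. \<Sum>y\<in>Y. real (I (y, z)))"
      by (rule sum_bounded_below) (use rich in auto)
    also have "\<dots> = (\<Sum>y\<in>Y. \<Sum>z\<in>Z. real (I (y, z)))" by (rule sum.swap)
    also have "\<dots> = (\<Sum>p\<in>Y \<times> Z. real (I p))" by (simp add: sum.cartesian_product)
    finally show ?thesis .
  qed
  show ?thesis
  proof (cases "k \<ge> 2")
    case True
    define F where "F = {p \<in> Y \<times> Z. k \<le> real (I p)}"
    have fF: "finite F" using fin by (simp add: F_def)
    have "(\<Sum>p\<in>F. real (I p)) \<le> 4 * (144 * ?x\<^sup>2 * ?c\<^sup>2) / k\<^sup>2"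
    proof (rule sum_le_of_cubic_superlevel[OF fF k0])
      fix u assume u: "u \<ge> k"
      let ?n = "\<lambda>p :: real \<times> real. (fst p, - snd p)"
      have inj: "inj_on ?n {p \<in> F. u \<le> real (I p)}" by (auto simp: inj_on_def)
      have "real (card (?n ` {p \<in> F. u \<le> real (I p)})) * u ^ 3 \<le> 144 * ?x\<^sup>2 * ?c\<^sup>2"
        by (rule Szemeredi_Trotter_grid) (use fin fF True u nz in \<open>auto simp: F_def I_def\<close>)
      then show "real (card {p \<in> F. u \<le> real (I p)}) * u ^ 3 \<le> 144 * ?x\<^sup>2 * ?c\<^sup>2"
        by (simp only: card_image[OF inj])
    qed (auto simp: F_def)
    moreover have "(\<Sum>p\<in>Y \<times> Z - F. real (I p)) \<le> ?z * (s * t) / 2"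
    proof -
      have "(\<Sum>p\<in>Y \<times> Z - F. real (I p)) \<le> real (card (Y \<times> Z - F)) * k"
        by (rule sum_bounded_above) (auto simp: F_def)
      also have "\<dots> \<le> real (card (Y \<times> Z)) * k"
        using k0 fin by (intro mult_right_mono of_nat_mono card_mono) auto
      also have "\<dots> = ?z * (s * t) / 2" using y1 by (simp add: k_def card_cartesian_product)
      finally show ?thesis .
    qed
    moreover have "(\<Sum>p\<in>Y \<times> Z. real (I p)) = (\<Sum>p\<in>Y \<times> Z - F. real (I p)) + (\<Sum>p\<in>F. real (I p))"
      using fin by (intro sum.subset_diff) (auto simp: F_def)
    ultimately have "?z * (s * t) / 2 \<le> 4 * (144 * ?x\<^sup>2 * ?c\<^sup>2) / k\<^sup>2" using total by linarith
    also have "\<dots> = 2304 * (?x\<^sup>2 * ?y\<^sup>2 * ?c\<^sup>2) / (s * t)\<^sup>2"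
      using st y1 by (simp add: k_def field_simps)
    finally have "?z * (s * t) \<le> 4608 * (?x\<^sup>2 * ?y\<^sup>2 * ?c\<^sup>2) / (s * t)\<^sup>2" by simp
    then have "?z * (s * t) * (s * t)\<^sup>2 \<le> 4608 * (?x\<^sup>2 * ?y\<^sup>2 * ?c\<^sup>2)"
      using st by (simp only: pos_le_divide_eq zero_less_power)
    then have "?z * (s * t) ^ 3 \<le> 4608 * (?x\<^sup>2 * ?y\<^sup>2 * ?c\<^sup>2)"
      by (simp only: power2_eq_square power3_eq_cube mult.assoc)
    moreover have "0 \<le> ?x\<^sup>2 * ?y\<^sup>2 * ?c\<^sup>2" by simp
    ultimately show ?thesis by linarith
  next
    \<comment> \<open>Below threshold 2 the grid bound says nothing, but then s t <= 4 |Y| and the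
      trivial count |X| |Y| |C| of incidences suffices. Here \<open>card Y \<le> card X\<close>
      enters.\<close>
    case False
    have "C \<noteq> {}" using Z[OF z0] s by (auto simp: rep_def)
    then have c1: "?c \<ge> 1" using fin by (simp add: Suc_leI card_gt_0_iff)
    have st4: "s * t \<le> 4 * ?y" using False y1 by (simp add: k_def field_simps)
    have "(\<Sum>p\<in>Y \<times> Z. real (I p)) = (\<Sum>y\<in>Y. \<Sum>z\<in>Z. real (I (y, z)))"
      by (simp add: sum.cartesian_product)
    also have "\<dots> \<le> (\<Sum>y\<in>Y. ?x * ?c)"
    proof (rule sum_mono)
      fix y
      have "(\<Sum>z\<in>Z. real (I (y, z))) = real (card (SIGMA z:Z. rich_points X C (y, - z)))"
        using fin by (simp add: I_def rich_points_def)
      also have "\<dots> \<le> real (card (X \<times> C))"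
      proof (intro of_nat_mono card_inj_on_le[of "\<lambda>(z, x). (x, y * x - z)"])
        show "inj_on (\<lambda>(z, x). (x, y * x - z)) (SIGMA z:Z. rich_points X C (y, - z))"
          by (auto simp: inj_on_def)
      qed (use fin in \<open>auto simp: rich_points_def\<close>)
      finally show "(\<Sum>z\<in>Z. real (I (y, z))) \<le> ?x * ?c" by (simp add: card_cartesian_product)
    qed
    finally have "?z * (s * t) \<le> ?x * ?y * ?c" using total by (simp add: ac_simps)
    moreover have "(s * t)\<^sup>2 \<le> (4 * ?y)\<^sup>2" using st st4 by (intro power_mono) auto
    ultimately have "?z * (s * t) * (s * t)\<^sup>2 \<le> ?x * ?y * ?c * (4 * ?y)\<^sup>2"
      by (rule mult_mono) simp_all
    also have "\<dots> = 16 * (?x * ?y\<^sup>2 * ?c) * ?y" by (simp add: power2_eq_square)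
    also have "\<dots> \<le> 16 * (?x * ?y\<^sup>2 * ?c) * (?x * ?c)"
      using x1 c1 y1 mult_mono[of ?y ?x 1 ?c] by (intro mult_left_mono) auto
    also have "\<dots> = 16 * (?x\<^sup>2 * ?y\<^sup>2 * ?c\<^sup>2)" by (simp add: power2_eq_square)
    finally have "?z * (s * t) ^ 3 \<le> 16 * (?x\<^sup>2 * ?y\<^sup>2 * ?c\<^sup>2)"
      by (simp only: power2_eq_square power3_eq_cube mult.assoc)
    moreover have "0 \<le> ?x\<^sup>2 * ?y\<^sup>2 * ?c\<^sup>2" by simp
    ultimately show ?thesis by linarith
  qed
qed simp

text \<open>The hypothesis on A is symmetric in X and Y through x -> a / x, so the larger of the two
  sets may serve as X.\<close>

lemma superlevel_of_products:
  fixes A C X Y Z :: "real set"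
  assumes fin: "finite A" "finite C" "finite X" "finite Y" "finite Z"
    and nz: "0 \<notin> X" "0 \<notin> Y" and t: "t > 0" and s: "s > 0"
    and A: "\<And>a. a \<in> A \<Longrightarrow> t \<le> real (card {x \<in> X. a / x \<in> Y})"
    and Z: "\<And>z. z \<in> Z \<Longrightarrow> s \<le> real (rep A C z)"
  shows "real (card Z) * (s * t) ^ 3 \<le> 8192 * ((real (card X))\<^sup>2 * (real (card Y))\<^sup>2 * (real (card C))\<^sup>2)"
proof (cases "card Y \<le> card X")
  case True
  then show ?thesis using superlevel_of_products_weak[OF fin nz t s A Z] by blast
next
  case False
  have "t \<le> real (card {y \<in> Y. a / y \<in> X})" if a: "a \<in> A" for a
  proof -
    have "{x \<in> X. a / x \<in> Y} \<noteq> {}" using A[OF a] t by (metis card.empty of_nat_0 not_le)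
    then have a0: "a \<noteq> 0" using nz by auto
    have "card {x \<in> X. a / x \<in> Y} = card {y \<in> Y. a / y \<in> X}"
      by (rule bij_betw_same_card[of "\<lambda>x. a / x"])
        (rule bij_betwI[of _ _ _ "\<lambda>x. a / x"], use a0 in auto)
    with A[OF a] show ?thesis by simp
  qed
  from superlevel_of_products_weak[OF fin(1,2,4,3,5) nz(2,1) t s this Z] False
  show ?thesis by (simp add: ac_simps)
qed

text \<open>A set whose elements all have many factorisations is additively unstructured, uniformly
  in B. Both sources of controlled sets rest on this: the set extracted from large multiplicative
  third moments and the set of popular products.\<close>

theorem cubic_control_of_products:
  fixes A X Y :: "real set"
  assumes fin: "finite A" "finite X" "finite Y" and nz: "0 \<notin> X" "0 \<notin> Y" and t: "t > 0"
    and A: "\<And>a. a \<in> A \<Longrightarrow> t \<le> real (card {x \<in> X. a / x \<in> Y})"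
    and L: "L \<ge> 1" "L \<ge> 1 + log 2 (real (card A))"
  shows "cubic_control A (65536 * L * (real (card X))\<^sup>2 * (real (card Y))\<^sup>2 / t ^ 3)"
  unfolding cubic_control_def
proof (intro allI impI)
  fix B :: "real set" assume B: "finite B"
  let ?D = "difference_set A B"
  have b: "1 \<le> rep A B x \<and> rep A B x \<le> card A" if "x \<in> ?D" for x
    using rep_pos[OF B that] rep_le_left[OF fin(1) B] by simp
  obtain j where j: "(\<Sum>x\<in>?D. real (rep A B x) ^ 3)
      \<le> 8 * L * (real (card {x \<in> ?D. 2 ^ j \<le> rep A B x}) * (2 ^ j) ^ 3)"
    by (rule exE[OF sum_cube_le_of_superlevel[of ?D "rep A B" "card A" L]]) (use fin B b L in auto)
  let ?Z = "{x \<in> ?D. 2 ^ j \<le> rep A B x}"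
  have "real (card ?Z) * (2 ^ j * t) ^ 3 \<le> 8192 * ((real (card X))\<^sup>2 * (real (card Y))\<^sup>2 * (real (card B))\<^sup>2)"
  proof (rule superlevel_of_products[OF fin(1) B fin(2,3) _ nz t _ A])
    fix z assume "z \<in> ?Z"
    then show "2 ^ j \<le> real (rep A B z)" by simp
  qed (use fin B in auto)
  then have "real (card ?Z) * (2 ^ j) ^ 3 * t ^ 3
      \<le> 8192 * ((real (card X))\<^sup>2 * (real (card Y))\<^sup>2 * (real (card B))\<^sup>2)"
    by (simp only: power_mult_distrib mult.assoc)
  then have "real (card ?Z) * (2 ^ j) ^ 3
      \<le> 8192 * ((real (card X))\<^sup>2 * (real (card Y))\<^sup>2 * (real (card B))\<^sup>2) / t ^ 3"
    using t by (simp only: pos_le_divide_eq zero_less_power)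
  then have "8 * L * (real (card ?Z) * (2 ^ j) ^ 3)
      \<le> 8 * L * (8192 * ((real (card X))\<^sup>2 * (real (card Y))\<^sup>2 * (real (card B))\<^sup>2) / t ^ 3)"
    by (rule mult_left_mono) (use L in simp)
  also have "\<dots> = 65536 * L * (real (card X))\<^sup>2 * (real (card Y))\<^sup>2 / t ^ 3 * (real (card B))\<^sup>2"
    by simp
  finally show "(\<Sum>x\<in>?D. real (rep A B x) ^ 3)
      \<le> 65536 * L * (real (card X))\<^sup>2 * (real (card Y))\<^sup>2 / t ^ 3 * (real (card B))\<^sup>2"
    using j by linarith
qed

section \<open>Differences, energies and sums of a controlled set\<close>

lemma cubic_control_nonneg: "cubic_control A \<kappa> \<Longrightarrow> 0 \<le> \<kappa>"
proof -
  assume "cubic_control A \<kappa>"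
  from cubic_controlD[OF this, of "{0}"] have "(\<Sum>x\<in>difference_set A {0}. real (rep A {0} x) ^ 3) \<le> \<kappa>" by simp
  moreover have "0 \<le> (\<Sum>x\<in>difference_set A {0}. real (rep A {0} x) ^ 3)" by (rule sum_nonneg) simp
  ultimately show ?thesis by linarith
qed

lemma energy_commute: "finite A \<Longrightarrow> finite B \<Longrightarrow> energy A B = energy B A"
  unfolding energy_eq_card
  by (intro arg_cong[where f = real] bij_betw_same_card[of "\<lambda>p. (prod.swap (fst p), prod.swap (snd p))"]
      bij_betwI[of _ _ _ "\<lambda>p. (prod.swap (fst p), prod.swap (snd p))"]) auto

text \<open>The equation a - a' = b - b' is the same as a - b = a' - b'.\<close>

lemma sum_rep_rep_eq_energy:
  assumes "finite A" "finite B"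
  shows "(\<Sum>x\<in>difference_set A A. real (rep A A x) * real (rep B B x)) = energy A B"
proof -
  have "card {p \<in> (A \<times> A) \<times> (B \<times> B). fst (fst p) - snd (fst p) = fst (snd p) - snd (snd p)}
      = card {p \<in> (A \<times> B) \<times> (A \<times> B). fst (fst p) - snd (fst p) = fst (snd p) - snd (snd p)}"
    by (rule bij_betw_same_card[of "\<lambda>((a, b), (c, d)). ((a, c), (b, d))"])
      (rule bij_betwI[of _ _ _ "\<lambda>((a, b), (c, d)). ((a, c), (b, d))"], auto simp: algebra_simps)
  then show ?thesis
    using card_matching_differences[of A A B B "difference_set A A"] assms
    by (simp add: energy_eq_card flip: of_nat_mult of_nat_sum)
qed

lemma mem_difference_set: "a \<in> A \<Longrightarrow> b \<in> B \<Longrightarrow> a - b \<in> difference_set A B"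
  by (force simp: difference_set_eq_image)

lemma difference_set_uminus: "- x \<in> difference_set A A \<longleftrightarrow> x \<in> difference_set A A"
proof -
  have "- x \<in> difference_set A A" if "x \<in> difference_set A A" for x
    using that mem_difference_set[of _ A _ A] unfolding difference_set_def by force
  from this[of x] this[of "- x"] show ?thesis by auto
qed

text \<open>Two triples with the same image differ by a common translation, so the third moment counts them.\<close>

lemma triple_collisions_le:
  fixes A X :: "real set"
  assumes fin: "finite A" "finite X" and X: "\<And>x. rep X X x = rep A A x"
    and \<Theta>: "\<Theta> \<subseteq> X \<times> A \<times> A" and ctl: "cubic_control A \<kappa>"
    and f: "f = (\<lambda>(x, y, z). (x - y, x - z))"
  shows "real (card {p \<in> \<Theta> \<times> \<Theta>. f (fst p) = f (snd p)}) \<le> \<kappa> * (real (card A))\<^sup>2"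
proof -
  let ?D = "difference_set A A"
  let ?T = "SIGMA d:?D. {x \<in> X. x + d \<in> X} \<times> {y \<in> A. y + d \<in> A} \<times> {z \<in> A. z + d \<in> A}"
  let ?h = "\<lambda>((x, y, z), t). (x - fst t, t)"
  have "card {p \<in> \<Theta> \<times> \<Theta>. f (fst p) = f (snd p)} \<le> card ?T"
  proof (rule card_inj_on_le[of ?h])
    show "inj_on ?h {p \<in> \<Theta> \<times> \<Theta>. f (fst p) = f (snd p)}"
      by (auto simp: inj_on_def f)
    show "?h ` {p \<in> \<Theta> \<times> \<Theta>. f (fst p) = f (snd p)} \<subseteq> ?T"
    proof (rule image_subsetI)
      fix p assume p: "p \<in> {p \<in> \<Theta> \<times> \<Theta>. f (fst p) = f (snd p)}"
      obtain x y z x' y' z' where pd: "p = ((x, y, z), (x', y', z'))" by (metis surj_pair)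
      have *: "(x, y, z) \<in> \<Theta>" "(x', y', z') \<in> \<Theta>"
        "f (fst ((x, y, z), (x', y', z'))) = f (snd ((x, y, z), (x', y', z')))"
        using p unfolding pd by auto
      then have m: "x \<in> X" "y \<in> A" "z \<in> A" "x' \<in> X" "y' \<in> A" "z' \<in> A" using \<Theta> by auto
      have e: "x - x' = y - y'" "x - x' = z - z'" using *(3) by (auto simp: f algebra_simps)
      have "y' + (x - x') = y" "z' + (x - x') = z" "x' + (x - x') = x" using e by linarith+
      moreover have "x - x' \<in> ?D" using mem_difference_set[OF m(2,5)] e(1) by simp
      ultimately show "?h p \<in> ?T" using m unfolding pd by simp
    qed
    show "finite ?T" using fin by (intro finite_SigmaI) auto
  qed
  \<comment> \<open>Differences take X = A and sums take X = - A; both have the same representation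
    counts, so the three factors form a cube.\<close>
  also have "card ?T = (\<Sum>d\<in>?D. rep X X d * (rep A A d * rep A A d))"
    using fin by (simp add: card_cartesian_product rep_def)
  also have "\<dots> = (\<Sum>d\<in>?D. rep A A d ^ 3)"
    by (simp add: X power3_eq_cube mult.assoc)
  finally have "real (card {p \<in> \<Theta> \<times> \<Theta>. f (fst p) = f (snd p)}) \<le> (\<Sum>d\<in>?D. real (rep A A d) ^ 3)"
    by (simp flip: of_nat_power of_nat_sum)
  also have "\<dots> \<le> \<kappa> * (real (card A))\<^sup>2" by (rule cubic_controlD[OF ctl fin(1)])
  finally show ?thesis .
qed

text \<open>With D = A - A, triples (x, y, z) with z - y a popular difference are sent to (x - y, x
  - z), a pair in D x D whose difference is again z - y. The third moment bounds the collisions, so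
  there are at least about n^4 / \<kappa> such pairs. Each difference involved has at least \<tau>
  representations in A, so \<tau> times the number of pairs is at most E(A, D), which
  \<open>energy_sq_le\<close> bounds.\<close>

theorem difference_set_lower_bound:
  assumes fin: "finite A" "A \<noteq> {}" and ctl: "cubic_control A \<kappa>"
  shows "real (card A) ^ 11 \<le> 64 * \<kappa> ^ 3 * real (card (difference_set A A)) ^ 5"
proof -
  let ?D = "difference_set A A"
  let ?n = "real (card A)" and ?N = "real (card ?D)"
  have n: "?n > 0" using fin by (simp add: card_gt_0_iff)
  have "?D \<noteq> {}" using fin mem_difference_set by blast
  then have N: "?N > 0" using fin by (simp add: card_gt_0_iff)
  have k: "\<kappa> \<ge> 0" by (rule cubic_control_nonneg[OF ctl])
  \<comment> \<open>Half of the average multiplicity n^2 / N: differences with fewer representations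
    account for at most half of all pairs.\<close>
  define \<tau> where "\<tau> = ?n\<^sup>2 / (2 * ?N)"
  have \<tau>: "\<tau> > 0" using n N by (simp add: \<tau>_def)
  define R where "R = {w \<in> ?D. \<tau> \<le> real (rep A A w)}"
  have fR: "finite R" using fin by (simp add: R_def)
  define \<Theta> where "\<Theta> = A \<times> {p \<in> A \<times> A. snd p - fst p \<in> R}"
  define f where "f = (\<lambda>(x, y, z). (x - y, x - z :: real))"
  have f\<Theta>: "finite \<Theta>" using fin by (simp add: \<Theta>_def)
  have "card {p \<in> A \<times> A. snd p - fst p \<in> R} = (\<Sum>w\<in>R. rep A A w)"
  proof -
    have "{p \<in> A \<times> A. snd p - fst p \<in> R} = (\<lambda>(w, b). (b, b + w)) ` (SIGMA w:R. {b \<in> A. b + w \<in> A})"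
      by (auto simp: image_iff) (metis add_diff_cancel_left' diff_add_cancel add.commute)
    also have "card \<dots> = card (SIGMA w:R. {b \<in> A. b + w \<in> A})"
      by (rule card_image) (auto simp: inj_on_def)
    finally show ?thesis using fin fR by (simp add: rep_def)
  qed
  then have c: "real (card {p \<in> A \<times> A. snd p - fst p \<in> R}) = (\<Sum>w\<in>R. real (rep A A w))" by simp
  have "(\<Sum>w\<in>?D - R. real (rep A A w)) \<le> real (card (?D - R)) * \<tau>"
    by (rule sum_bounded_above) (auto simp: R_def)
  also have "\<dots> \<le> ?N * \<tau>"
    using \<tau> fin by (intro mult_right_mono of_nat_mono card_mono) auto
  also have "\<dots> = ?n\<^sup>2 / 2" using N by (simp add: \<tau>_def)
  finally have "(\<Sum>w\<in>?D - R. real (rep A A w)) \<le> ?n\<^sup>2 / 2" .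
  moreover have "(\<Sum>w\<in>?D. real (rep A A w)) = (\<Sum>w\<in>?D - R. real (rep A A w)) + (\<Sum>w\<in>R. real (rep A A w))"
    using fin by (intro sum.subset_diff) (auto simp: R_def)
  moreover have "(\<Sum>w\<in>?D. real (rep A A w)) = ?n\<^sup>2"
    using sum_rep[OF fin(1,1)] by (simp add: power2_eq_square flip: of_nat_sum)
  ultimately have "real (card {p \<in> A \<times> A. snd p - fst p \<in> R}) \<ge> ?n\<^sup>2 / 2" unfolding c by linarith
  then have "?n * (?n\<^sup>2 / 2) \<le> real (card \<Theta>)"
    unfolding \<Theta>_def card_cartesian_product of_nat_mult using n by (intro mult_left_mono) auto
  then have \<Theta>: "?n ^ 3 / 2 \<le> real (card \<Theta>)" by (simp add: power2_eq_square power3_eq_cube)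
  define V where "V = {p \<in> ?D \<times> ?D. fst p - snd p \<in> R}"
  have fV: "f ` \<Theta> \<subseteq> V" "finite V" using fin
    by (auto simp: V_def \<Theta>_def f_def mem_difference_set)
  have coll: "real (card {p \<in> \<Theta> \<times> \<Theta>. f (fst p) = f (snd p)}) \<le> \<kappa> * ?n\<^sup>2"
    by (rule triple_collisions_le[OF fin(1,1) refl _ ctl f_def]) (auto simp: \<Theta>_def)
  have "(?n ^ 3 / 2)\<^sup>2 \<le> (real (card \<Theta>))\<^sup>2" using \<Theta> n by (intro power_mono) auto
  also have "\<dots> \<le> real (card (f ` \<Theta>)) * real (card {p \<in> \<Theta> \<times> \<Theta>. f (fst p) = f (snd p)})"
    by (rule card_sq_le_image_mult_collisions[OF f\<Theta>])
  also have "\<dots> \<le> real (card V) * (\<kappa> * ?n\<^sup>2)"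
    using coll fV by (intro mult_mono of_nat_mono card_mono) auto
  finally have 1: "(?n ^ 3 / 2)\<^sup>2 \<le> real (card V) * (\<kappa> * ?n\<^sup>2)" .
  have "card V = (\<Sum>w\<in>R. rep ?D ?D w)"
  proof -
    have "V = (\<lambda>(w, b). (b + w, b)) ` (SIGMA w:R. {b \<in> ?D. b + w \<in> ?D})"
      unfolding V_def by (auto simp: image_iff) (metis diff_add_cancel add.commute)
    also have "card \<dots> = card (SIGMA w:R. {b \<in> ?D. b + w \<in> ?D})"
      by (rule card_image) (auto simp: inj_on_def)
    finally show ?thesis using fin fR by (simp add: rep_def)
  qed
  then have "\<tau> * real (card V) = (\<Sum>w\<in>R. \<tau> * real (rep ?D ?D w))" by (simp add: sum_distrib_left)
  also have "\<dots> \<le> (\<Sum>w\<in>R. real (rep A A w) * real (rep ?D ?D w))"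
    by (intro sum_mono mult_right_mono) (auto simp: R_def)
  also have "\<dots> \<le> (\<Sum>w\<in>?D. real (rep A A w) * real (rep ?D ?D w))"
    by (rule sum_mono2) (use fin in \<open>auto simp: R_def\<close>)
  also have "\<dots> = energy A ?D" by (rule sum_rep_rep_eq_energy) (use fin in auto)
  finally have 2: "\<tau> * real (card V) \<le> energy A ?D" .
  have 3: "(energy A ?D)\<^sup>2 \<le> \<kappa> * ?n * ?N ^ 3"
    by (rule energy_sq_le[OF ctl]) (use fin in auto)
  have "?n ^ 4 \<le> 4 * \<kappa> * real (card V)"
  proof -
    have "?n\<^sup>2 * ?n ^ 4 \<le> ?n\<^sup>2 * (4 * \<kappa> * real (card V))"
    proof -
      have "?n\<^sup>2 * ?n ^ 4 = 4 * (?n ^ 3 / 2)\<^sup>2" by (simp add: power_divide)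
      also have "\<dots> \<le> 4 * (real (card V) * (\<kappa> * ?n\<^sup>2))" using 1 by simp
      also have "\<dots> = ?n\<^sup>2 * (4 * \<kappa> * real (card V))" by simp
      finally show ?thesis .
    qed
    then show ?thesis using n by (subst (asm) mult_le_cancel_left_pos) auto
  qed
  then have "?n\<^sup>2 * ?n ^ 4 \<le> ?n\<^sup>2 * (4 * \<kappa> * real (card V))" by (rule mult_left_mono) simp
  also have "\<dots> = 8 * \<kappa> * ?N * (\<tau> * real (card V))" using N by (simp add: \<tau>_def field_simps)
  also have "\<dots> \<le> 8 * \<kappa> * ?N * energy A ?D" using 2 k by (intro mult_left_mono) auto
  finally have "(?n\<^sup>2 * ?n ^ 4)\<^sup>2 \<le> (8 * \<kappa> * ?N * energy A ?D)\<^sup>2" by (rule power_mono) simp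
  also have "\<dots> = 64 * \<kappa>\<^sup>2 * ?N\<^sup>2 * (energy A ?D)\<^sup>2" by (simp add: power_mult_distrib)
  also have "\<dots> \<le> 64 * \<kappa>\<^sup>2 * ?N\<^sup>2 * (\<kappa> * ?n * ?N ^ 3)" using 3 by (intro mult_left_mono) auto
  finally have "?n * ?n ^ 11 \<le> ?n * (64 * \<kappa> ^ 3 * ?N ^ 5)"
  proof -
    assume a: "(?n\<^sup>2 * ?n ^ 4)\<^sup>2 \<le> 64 * \<kappa>\<^sup>2 * ?N\<^sup>2 * (\<kappa> * ?n * ?N ^ 3)"
    have e1: "(?n\<^sup>2 * ?n ^ 4)\<^sup>2 = ?n * ?n ^ 11" by algebra
    have e2: "64 * \<kappa>\<^sup>2 * ?N\<^sup>2 * (\<kappa> * ?n * ?N ^ 3) = ?n * (64 * \<kappa> ^ 3 * ?N ^ 5)" by algebra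
    show ?thesis using a unfolding e1 e2 .
  qed
  then show ?thesis using n by (subst (asm) mult_le_cancel_left_pos) auto
qed

section \<open>Upper bound for the additive energy\<close>

lemma energy_dyadic_level:
  assumes "finite A" "L \<ge> 1" "L \<ge> 1 + log 2 (real (card A))"
  shows "\<exists>j. energy A A \<le> 4 * L * (real (card {x \<in> difference_set A A. 2 ^ j \<le> rep A A x \<and> rep A A x < 2 ^ Suc j}) * (2 ^ j)\<^sup>2)"
  unfolding energy_def
  by (rule sum_squares_le_dyadic_level[of _ "rep A A" "card A" L])
    (use assms rep_pos rep_le_left in auto)

lemma sum_over_pairs_difference:
  fixes h :: "real \<Rightarrow> real"
  assumes "finite P" "finite I" "difference_set P P \<subseteq> I"
  shows "(\<Sum>p\<in>P \<times> P. h (fst p - snd p)) = (\<Sum>w\<in>I. real (rep P P w) * h w)"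
  using sum_fun_comp[of "P \<times> P" I "\<lambda>p. fst p - snd p" h] assms
  by (simp add: rep_eq_fibre difference_set_eq_image)

text \<open>
  For a symmetric graph with \<open>W\<close> directed edges on \<open>n\<close> vertices, discarding the vertices of
  degree below \<open>W / 4n\<close> loses at most half of the edges.
\<close>

lemma sum_degree_products_ge:
  fixes A P :: "real set"
  assumes fin: "finite A" and sym: "\<And>x. - x \<in> P \<longleftrightarrow> x \<in> P"
    and d: "\<And>x. d x = real (card {y \<in> A. x - y \<in> P})"
    and W: "W = (\<Sum>x\<in>A. d x)"
  shows "W ^ 3 \<le> 32 * (real (card A))\<^sup>2 * (\<Sum>p\<in>{p \<in> A \<times> A. fst p - snd p \<in> P}. d (fst p) * d (snd p))"
proof (cases "A = {}")
  case False
  let ?n = "real (card A)" and ?E = "{p \<in> A \<times> A. fst p - snd p \<in> P}"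
  have n: "?n > 0" using False fin by (simp add: card_gt_0_iff)
  have d0: "d x \<ge> 0" for x by (simp add: d)
  have W0: "W \<ge> 0" unfolding W by (rule sum_nonneg) (rule d0)
  define t where "t = W / (4 * ?n)"
  have t0: "t \<ge> 0" using W0 n by (simp add: t_def)
  have cE: "real (card {p \<in> ?E. Q (fst p)}) = (\<Sum>x\<in>{x \<in> A. Q x}. d x)" for Q
  proof -
    have "{p \<in> ?E. Q (fst p)} = (SIGMA x:{x \<in> A. Q x}. {y \<in> A. x - y \<in> P})" by auto
    then show ?thesis using fin by (simp add: d)
  qed
  let ?B1 = "{p \<in> ?E. d (fst p) < t}" and ?B2 = "{p \<in> ?E. d (snd p) < t}"
  let ?G = "{p \<in> ?E. t \<le> d (fst p) \<and> t \<le> d (snd p)}"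
  have fE: "finite ?E" using fin by simp
  have B1: "real (card ?B1) \<le> W / 4"
  proof -
    have "real (card ?B1) \<le> real (card {x \<in> A. d x < t}) * t"
      unfolding cE[of "\<lambda>x. d x < t"] by (rule sum_bounded_above) auto
    also have "\<dots> \<le> ?n * t" using t0 fin by (intro mult_right_mono of_nat_mono card_mono) auto
    finally show ?thesis using n by (simp add: t_def)
  qed
  have B12: "card ?B2 = card ?B1"
  proof (rule bij_betw_same_card[of prod.swap], rule bij_betwI[of _ _ _ prod.swap])
    have "x - y \<in> P \<longleftrightarrow> y - x \<in> P" for x y using sym[of "x - y"] by simp
    then show "prod.swap \<in> ?B2 \<rightarrow> ?B1" "prod.swap \<in> ?B1 \<rightarrow> ?B2" by auto
  qed auto
  have "card ?E \<le> card (?G \<union> (?B1 \<union> ?B2))"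
    by (rule card_mono) (use fin in auto)
  also have "\<dots> \<le> card ?G + (card ?B1 + card ?B2)"
    by (intro order.trans[OF card_Un_le] add_left_mono card_Un_le)
  finally have "real (card ?E) \<le> real (card ?G) + (real (card ?B1) + real (card ?B2))" by linarith
  moreover have "real (card ?E) = W" using cE[of "\<lambda>_. True"] by (simp add: W)
  ultimately have G: "W / 2 \<le> real (card ?G)" using B1 B12 by linarith
  have "W / 2 * (t * t) \<le> real (card ?G) * (t * t)" using G by (intro mult_right_mono) auto
  also have "\<dots> \<le> (\<Sum>p\<in>?G. d (fst p) * d (snd p))"
    by (rule sum_bounded_below) (use t0 in \<open>auto intro: mult_mono\<close>)
  also have "\<dots> \<le> (\<Sum>p\<in>?E. d (fst p) * d (snd p))"
    by (rule sum_mono2) (use fE d0 in auto)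
  finally have "32 * ?n\<^sup>2 * (W / 2 * (t * t)) \<le> 32 * ?n\<^sup>2 * (\<Sum>p\<in>?E. d (fst p) * d (snd p))"
    by (rule mult_left_mono) simp
  moreover have "32 * ?n\<^sup>2 * (W / 2 * (t * t)) = W ^ 3"
    using n by (simp add: t_def power2_eq_square power3_eq_cube)
  ultimately show ?thesis by linarith
qed (simp add: W)

text \<open>Expand \<open>rep A A (z - y)\<close> as the number of shifts s with y + s and z + s in
  A. For fixed s the sum over x is a sum of squares, and Cauchy-Schwarz over x replaces it by the
  square of h(s), the sum of the degrees d(y) over y with y + s in A. Expanding back gives the sum
  of d(y) d(z) \<open>rep A A (z - y)\<close>. On the edges y - z in P the last factor is at least
  \<Delta>, and \<open>sum_degree_products_ge\<close> bounds the degree products from below.\<close>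

lemma triple_sum_lower_bound:
  fixes A P :: "real set"
  assumes fin: "finite A" "A \<noteq> {}" "finite P" and sym: "\<And>x. - x \<in> P \<longleftrightarrow> x \<in> P"
    and P: "\<And>x. x \<in> P \<Longrightarrow> \<Delta> \<le> real (rep A A x)" and \<Delta>: "\<Delta> \<ge> 0"
  shows "\<Delta> ^ 4 * real (card P) ^ 3 \<le> 32 * real (card A) ^ 3 *
    (\<Sum>(x, y, z)\<in>{(x, y, z). x \<in> A \<and> y \<in> A \<and> z \<in> A \<and> x - y \<in> P \<and> x - z \<in> P}. real (rep A A (z - y)))"
    (is "_ \<le> _ * ?U")
proof -
  let ?n = "real (card A)"
  have n: "?n > 0" using fin by (simp add: card_gt_0_iff)
  let ?D = "difference_set A A"
  define N where "N x = {y \<in> A. x - y \<in> P}" for x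
  define d where "d x = real (card (N x))" for x
  have fN: "finite (N x)" for x using fin by (simp add: N_def)
  have symN: "y \<in> A \<and> x \<in> N y \<longleftrightarrow> x \<in> A \<and> y \<in> N x" for x y
    using sym[of "x - y"] by (auto simp: N_def)
  define g where "g s x = real (card {y \<in> N x. y + s \<in> A})" for s x
  have rep_sum: "real (rep A A (z - y)) = (\<Sum>s\<in>?D. (of_bool (y + s \<in> A) * of_bool (z + s \<in> A) :: real))"
    if "y \<in> A" for y z
  proof -
    have "rep A A (z - y) = card {s \<in> ?D. y + s \<in> A \<and> z + s \<in> A}"
      unfolding rep_def
      by (rule bij_betw_same_card[of "\<lambda>b. b - y"], rule bij_betwI[of _ _ _ "\<lambda>s. y + s"])
        (use that mem_difference_set in \<open>auto simp: algebra_simps\<close>)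
    then show ?thesis using fin
      unfolding of_bool_conj[symmetric] by (simp add: Int_def del: of_bool_conj)
  qed
  have g_eq: "g s x = (\<Sum>y\<in>N x. of_bool (y + s \<in> A))" for s x
    unfolding g_def using fN[of x] by (simp add: Int_def)
  have "?U = (\<Sum>x\<in>A. \<Sum>y\<in>N x. \<Sum>z\<in>N x. real (rep A A (z - y)))"
  proof -
    have "{(x, y, z). x \<in> A \<and> y \<in> A \<and> z \<in> A \<and> x - y \<in> P \<and> x - z \<in> P} = (SIGMA x:A. N x \<times> N x)"
      by (auto simp: N_def)
    then show ?thesis using fin fN
      by (simp add: sum.Sigma sum.cartesian_product case_prod_unfold)
  qed
  also have "\<dots> = (\<Sum>x\<in>A. \<Sum>s\<in>?D. (g s x)\<^sup>2)"
  proof (rule sum.cong[OF refl])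
    fix x
    have "(\<Sum>y\<in>N x. \<Sum>z\<in>N x. real (rep A A (z - y)))
        = (\<Sum>y\<in>N x. \<Sum>z\<in>N x. \<Sum>s\<in>?D. of_bool (y + s \<in> A) * of_bool (z + s \<in> A))"
      by (intro sum.cong refl rep_sum) (auto simp: N_def)
    also have "\<dots> = (\<Sum>y\<in>N x. \<Sum>s\<in>?D. \<Sum>z\<in>N x. of_bool (y + s \<in> A) * of_bool (z + s \<in> A))"
      by (intro sum.cong refl sum.swap)
    also have "\<dots> = (\<Sum>s\<in>?D. \<Sum>y\<in>N x. \<Sum>z\<in>N x. of_bool (y + s \<in> A) * of_bool (z + s \<in> A))"
      by (rule sum.swap)
    also have "\<dots> = (\<Sum>s\<in>?D. (g s x)\<^sup>2)"
      unfolding g_eq power2_eq_square sum_product ..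
    finally show "(\<Sum>y\<in>N x. \<Sum>z\<in>N x. real (rep A A (z - y))) = (\<Sum>s\<in>?D. (g s x)\<^sup>2)" .
  qed
  also have "\<dots> = (\<Sum>s\<in>?D. \<Sum>x\<in>A. (g s x)\<^sup>2)" by (rule sum.swap)
  finally have U: "?U = (\<Sum>s\<in>?D. \<Sum>x\<in>A. (g s x)\<^sup>2)" .
  define h where "h s = (\<Sum>y\<in>A. d y * of_bool (y + s \<in> A))" for s
  \<comment> \<open>Symmetry of P lets the double count over edges be read from either end.\<close>
  have gh: "(\<Sum>x\<in>A. g s x) = h s" for s
  proof -
    have "(\<Sum>x\<in>A. g s x) = (\<Sum>x\<in>A. \<Sum>y\<in>{y \<in> A. y \<in> N x}. of_bool (y + s \<in> A))"
      unfolding g_eq by (intro sum.cong) (auto simp: N_def)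
    also have "\<dots> = (\<Sum>y\<in>A. \<Sum>x\<in>{x \<in> A. y \<in> N x}. of_bool (y + s \<in> A))"
      by (rule sum.swap_restrict) (use fin in auto)
    also have "\<dots> = h s" unfolding h_def
    proof (rule sum.cong[OF refl])
      fix y assume "y \<in> A"
      then have "{x \<in> A. y \<in> N x} = N y" using symN by (auto simp: N_def)
      then show "(\<Sum>x\<in>{x \<in> A. y \<in> N x}. of_bool (y + s \<in> A)) = d y * of_bool (y + s \<in> A)"
        by (simp add: d_def)
    qed
    finally show ?thesis .
  qed
  have "(\<Sum>s\<in>?D. (h s)\<^sup>2) \<le> (\<Sum>s\<in>?D. ?n * (\<Sum>x\<in>A. (g s x)\<^sup>2))"
  proof (rule sum_mono)
    fix s show "(h s)\<^sup>2 \<le> ?n * (\<Sum>x\<in>A. (g s x)\<^sup>2)"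
      using Cauchy_Schwarz_ineq_sum[of "\<lambda>_. 1" "g s" A] by (simp add: gh)
  qed
  also have "\<dots> = ?n * ?U" by (simp only: U sum_distrib_left)
  finally have hU: "(\<Sum>s\<in>?D. (h s)\<^sup>2) \<le> ?n * ?U" .
  have d0: "d x \<ge> 0" for x by (simp add: d_def)
  let ?E = "{p \<in> A \<times> A. fst p - snd p \<in> P}"
  have "(\<Sum>s\<in>?D. (h s)\<^sup>2) = (\<Sum>s\<in>?D. \<Sum>y\<in>A. \<Sum>z\<in>A. d y * d z * (of_bool (y + s \<in> A) * of_bool (z + s \<in> A)))"
    unfolding h_def power2_eq_square sum_product by (intro sum.cong refl) (simp only: ac_simps)
  also have "\<dots> = (\<Sum>y\<in>A. \<Sum>s\<in>?D. \<Sum>z\<in>A. d y * d z * (of_bool (y + s \<in> A) * of_bool (z + s \<in> A)))"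
    by (rule sum.swap)
  also have "\<dots> = (\<Sum>y\<in>A. \<Sum>z\<in>A. \<Sum>s\<in>?D. d y * d z * (of_bool (y + s \<in> A) * of_bool (z + s \<in> A)))"
    by (intro sum.cong refl sum.swap)
  also have "\<dots> = (\<Sum>y\<in>A. \<Sum>z\<in>A. d y * d z * real (rep A A (z - y)))"
    by (intro sum.cong refl) (simp only: rep_sum sum_distrib_left)
  also have "\<dots> = (\<Sum>p\<in>A \<times> A. d (fst p) * d (snd p) * real (rep A A (snd p - fst p)))"
    by (simp add: sum.cartesian_product case_prod_unfold)
  also have "\<dots> \<ge> (\<Sum>p\<in>?E. d (fst p) * d (snd p) * real (rep A A (snd p - fst p)))"
    by (rule sum_mono2) (use fin d0 in auto)
  finally have "(\<Sum>p\<in>?E. d (fst p) * d (snd p) * real (rep A A (snd p - fst p))) \<le> ?n * ?U"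
    using hU by linarith
  moreover have "(\<Sum>p\<in>?E. d (fst p) * d (snd p) * \<Delta>)
      \<le> (\<Sum>p\<in>?E. d (fst p) * d (snd p) * real (rep A A (snd p - fst p)))"
  proof (intro sum_mono mult_left_mono)
    fix p assume "p \<in> ?E"
    then have "- (fst p - snd p) \<in> P" using sym by blast
    then show "\<Delta> \<le> real (rep A A (snd p - fst p))" using P by simp
  qed (simp add: d0)
  ultimately have "\<Delta> * (\<Sum>p\<in>?E. d (fst p) * d (snd p)) \<le> ?n * ?U"
    by (simp add: sum_distrib_left ac_simps)
  then have 1: "32 * ?n\<^sup>2 * (\<Delta> * (\<Sum>p\<in>?E. d (fst p) * d (snd p))) \<le> 32 * ?n\<^sup>2 * (?n * ?U)"
    by (rule mult_left_mono) simp
  define W where "W = (\<Sum>x\<in>A. d x)"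
  have W3: "W ^ 3 \<le> 32 * ?n\<^sup>2 * (\<Sum>p\<in>?E. d (fst p) * d (snd p))"
    by (rule sum_degree_products_ge[OF fin(1) sym _ W_def]) (simp add: d_def N_def)
  have W: "real (card P) * \<Delta> \<le> W"
  proof -
    have "real (card P) * \<Delta> \<le> (\<Sum>x\<in>P. real (rep A A x))"
      by (rule sum_bounded_below) (use P in auto)
    also have "\<dots> = real (card (SIGMA x:P. {b \<in> A. b + x \<in> A}))"
      using fin by (simp add: rep_def)
    also have "\<dots> \<le> real (card (SIGMA x:A. N x))"
      by (intro of_nat_mono card_inj_on_le[of "\<lambda>(x, b). (b + x, b)"])
        (use fin fN in \<open>auto simp: inj_on_def N_def\<close>)
    also have "\<dots> = W" using fin fN by (simp add: W_def d_def)
    finally show ?thesis .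
  qed
  have "\<Delta> ^ 4 * real (card P) ^ 3 = \<Delta> * (real (card P) * \<Delta>) ^ 3" by algebra
  also have "\<dots> \<le> \<Delta> * W ^ 3" using W \<Delta> by (intro mult_left_mono power_mono) auto
  also have "\<dots> \<le> \<Delta> * (32 * ?n\<^sup>2 * (\<Sum>p\<in>?E. d (fst p) * d (snd p)))"
    using W3 \<Delta> by (rule mult_left_mono)
  also have "\<dots> \<le> 32 * ?n\<^sup>2 * (?n * ?U)" using 1 by (simp only: ac_simps)
  also have "\<dots> = 32 * ?n ^ 3 * ?U" by algebra
  finally show ?thesis .
qed

text \<open>Resolve each u in P as a - b in at least \<Delta> ways. For a pair (u, v) with t = v - u
  in T this gives a - v = b - t, so the resolved pairs are counted by representations common to A -
  P and A - T, and Cauchy-Schwarz leads to E(A, P) E(A, T).\<close>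

lemma pairs_with_popular_difference_le:
  fixes A P T :: "real set"
  assumes fin: "finite A" "finite P" "finite T" and symT: "\<And>x. - x \<in> T \<longleftrightarrow> x \<in> T"
    and P: "\<And>x. x \<in> P \<Longrightarrow> \<Delta> \<le> real (rep A A x)"
    and ctl: "cubic_control A \<kappa>" and \<Delta>: "\<Delta> \<ge> 0"
  shows "(\<Delta> * real (card {p \<in> P \<times> P. fst p - snd p \<in> T})) ^ 4
    \<le> \<kappa>\<^sup>2 * (real (card A))\<^sup>2 * real (card P) ^ 3 * real (card T) ^ 3"
proof -
  let ?n = "real (card A)" and ?Z = "{p \<in> P \<times> P. fst p - snd p \<in> T}"
  let ?I = "difference_set A P"
  have fZ: "finite ?Z" using fin by simp
  have "\<Delta> * real (card ?Z) \<le> (\<Sum>p\<in>?Z. real (rep A A (fst p)))"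
    using sum_bounded_below[of ?Z \<Delta> "\<lambda>p. real (rep A A (fst p))"] P by (auto simp: mult.commute)
  also have "\<dots> = real (card (SIGMA p:?Z. {b \<in> A. b + fst p \<in> A}))"
    using fZ fin by (simp add: rep_def)
  also have "\<dots> \<le> real (card {p \<in> (A \<times> P) \<times> (A \<times> T). fst (fst p) - snd (fst p) = fst (snd p) - snd (snd p)})"
  proof (intro of_nat_mono card_inj_on_le[of "\<lambda>(p, b). ((b + fst p, snd p), (b, snd p - fst p))"])
    show "(\<lambda>(p, b). ((b + fst p, snd p), (b, snd p - fst p))) ` (SIGMA p:?Z. {b \<in> A. b + fst p \<in> A})
        \<subseteq> {p \<in> (A \<times> P) \<times> (A \<times> T). fst (fst p) - snd (fst p) = fst (snd p) - snd (snd p)}"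
    proof (rule image_subsetI)
      fix q assume q: "q \<in> (SIGMA p:?Z. {b \<in> A. b + fst p \<in> A})"
      obtain u v b where qd: "q = ((u, v), b)" by (metis surj_pair)
      have "v - u \<in> T" using q symT[of "u - v"] unfolding qd by simp
      then show "(\<lambda>(p, b). ((b + fst p, snd p), (b, snd p - fst p))) q
        \<in> {p \<in> (A \<times> P) \<times> (A \<times> T). fst (fst p) - snd (fst p) = fst (snd p) - snd (snd p)}"
        using q unfolding qd by simp
    qed
  qed (use fin in \<open>auto simp: inj_on_def\<close>)
  also have "\<dots> = (\<Sum>x\<in>?I. real (rep A P x) * real (rep A T x))"
    using card_matching_differences[of A P A T ?I] fin by simp
  finally have "(\<Delta> * real (card ?Z))\<^sup>2 \<le> (\<Sum>x\<in>?I. real (rep A P x) * real (rep A T x))\<^sup>2"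
    using \<Delta> by (intro power_mono) auto
  also have "\<dots> \<le> energy A P * energy A T"
    by (rule sum_rep_mult_le_sqrt_energy) (use fin in auto)
  finally have "((\<Delta> * real (card ?Z))\<^sup>2)\<^sup>2 \<le> (energy A P * energy A T)\<^sup>2"
    by (rule power_mono) simp
  also have "\<dots> = (energy A P)\<^sup>2 * (energy A T)\<^sup>2" by (rule power_mult_distrib)
  also have "\<dots> \<le> (\<kappa> * ?n * real (card P) ^ 3) * (\<kappa> * ?n * real (card T) ^ 3)"
    using cubic_control_nonneg[OF ctl]
    by (intro mult_mono energy_sq_le[OF ctl] fin) auto
  also have "\<dots> = \<kappa>\<^sup>2 * ?n\<^sup>2 * real (card P) ^ 3 * real (card T) ^ 3"
    by (simp add: power2_eq_square)
  finally show ?thesis by simp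
qed

text \<open>One dyadic level \<tau> of the representation counts carries the sum; q is its
  contribution. Small \<tau> is handled by q <= 2 \<tau> E(A, P), large \<tau> by the scarcity of
  differences with \<tau> representations. Combining both removes \<tau>, over which there is no
  control.\<close>

lemma dyadic_square_sum_bound:
  fixes A P :: "real set"
  assumes fin: "finite A" "finite P"
    and P: "\<And>x. x \<in> P \<Longrightarrow> \<Delta> \<le> real (rep A A x)" and symP: "\<And>x. - x \<in> P \<longleftrightarrow> x \<in> P"
    and ctl: "cubic_control A \<kappa>" and \<Delta>: "\<Delta> \<ge> 0"
    and L: "L \<ge> 1" "L \<ge> 1 + log 2 (real (card A))"
  shows "\<exists>q\<ge>0. (\<Sum>p\<in>P \<times> P. (real (rep A A (fst p - snd p)))\<^sup>2) \<le> L * q \<and>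
    \<Delta> ^ 8 * q ^ 10 \<le> 2 ^ 18 * \<kappa> ^ 11 * real (card A) ^ 17 * real (card P) ^ 9"
proof -
  let ?n = "real (card A)" and ?p = "real (card P)"
  have k: "\<kappa> \<ge> 0" by (rule cubic_control_nonneg[OF ctl])
  let ?D = "difference_set A A" and ?r = "\<lambda>p. rep A A (fst p - snd p)"
  define S where "S = {p \<in> P \<times> P. fst p - snd p \<in> ?D}"
  have fS: "finite S" using fin by (simp add: S_def)
  have b: "1 \<le> ?r p \<and> ?r p \<le> card A" if "p \<in> S" for p
    using that rep_pos[OF fin(1)] rep_le_left[OF fin(1,1)] by (simp add: S_def)
  have S: "(\<Sum>p\<in>P \<times> P. (real (?r p))\<^sup>2) = (\<Sum>p\<in>S. (real (?r p))\<^sup>2)"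
    by (rule sum.mono_neutral_right) (use fin in \<open>auto simp: S_def rep_eq_0\<close>)
  obtain i where i: "(\<Sum>p\<in>S. (real (?r p))\<^sup>2)
      \<le> L * (\<Sum>p\<in>{p \<in> S. 2 ^ i \<le> ?r p \<and> ?r p < 2 ^ Suc i}. (real (?r p))\<^sup>2)"
    by (rule exE[OF dyadic_pigeonhole[of S ?r "card A" "\<lambda>p. (real (?r p))\<^sup>2" L]])
      (use fS b L in auto)
  define Si where "Si = {p \<in> S. 2 ^ i \<le> ?r p \<and> ?r p < 2 ^ Suc i}"
  define q where "q = (\<Sum>p\<in>Si. (real (?r p))\<^sup>2)"
  define \<tau> :: real where "\<tau> = 2 ^ i"
  have \<tau>: "\<tau> > 0" by (simp add: \<tau>_def)
  have q0: "q \<ge> 0" unfolding q_def by (rule sum_nonneg) simp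
  have fSi: "finite Si" using fS by (simp add: Si_def)
  have rb: "\<tau> \<le> real (?r p)" "real (?r p) \<le> 2 * \<tau>" if "p \<in> Si" for p
  proof -
    have "2 ^ i \<le> ?r p" "?r p \<le> 2 ^ Suc i" using that by (auto simp: Si_def)
    then have "real (2 ^ i) \<le> real (?r p)" "real (?r p) \<le> real (2 ^ Suc i)" by (simp_all only: of_nat_le_iff)
    then show "\<tau> \<le> real (?r p)" "real (?r p) \<le> 2 * \<tau>" by (simp_all add: \<tau>_def)
  qed
  have SiP: "Si \<subseteq> P \<times> P" by (auto simp: Si_def S_def)
  have first: "q \<le> 2 * \<tau> * energy A P"
  proof -
    have "q \<le> (\<Sum>p\<in>Si. 2 * \<tau> * real (?r p))"
      unfolding q_def power2_eq_square by (intro sum_mono mult_right_mono rb) auto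
    also have "\<dots> \<le> (\<Sum>p\<in>P \<times> P. 2 * \<tau> * real (?r p))"
      by (rule sum_mono2) (use fin SiP \<tau> in auto)
    also have "\<dots> = 2 * \<tau> * (\<Sum>p\<in>P \<times> P. real (?r p))" by (simp add: sum_distrib_left)
    also have "(\<Sum>p\<in>P \<times> P. real (?r p))
        = (\<Sum>w\<in>difference_set P P. real (rep P P w) * real (rep A A w))"
      by (rule sum_over_pairs_difference) (use fin in auto)
    also have "\<dots> = energy A P"
      using sum_rep_rep_eq_energy[OF fin(2,1)] energy_commute[OF fin] by simp
    finally show ?thesis .
  qed
  define T where "T = {w \<in> ?D. \<tau> \<le> real (rep A A w)}"
  have fT: "finite T" using fin by (simp add: T_def)
  have symT: "- x \<in> T \<longleftrightarrow> x \<in> T" for x by (simp add: T_def rep_minus difference_set_uminus)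
  let ?t = "real (card T)" and ?z = "real (card {p \<in> P \<times> P. fst p - snd p \<in> T})"
  have T3: "?t * \<tau> ^ 3 \<le> \<kappa> * ?n\<^sup>2"
    by (rule cubic_control_superlevel[OF ctl fin(1,1) fT \<tau>]) (auto simp: T_def)
  have second: "q \<le> 4 * \<tau>\<^sup>2 * ?z"
  proof -
    have "q \<le> real (card Si) * (2 * \<tau>)\<^sup>2"
      unfolding q_def by (rule sum_bounded_above, rule power_mono[OF rb(2)]) auto
    also have "\<dots> \<le> ?z * (2 * \<tau>)\<^sup>2"
      by (intro mult_right_mono of_nat_mono card_mono)
        (use fin rb SiP in \<open>auto simp: T_def Si_def S_def\<close>)
    finally show ?thesis by (simp add: power_mult_distrib ac_simps)
  qed
  have Z: "(\<Delta> * ?z) ^ 4 \<le> \<kappa>\<^sup>2 * ?n\<^sup>2 * ?p ^ 3 * ?t ^ 3"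
    by (rule pairs_with_popular_difference_le[OF fin fT symT P ctl \<Delta>])
  have eP: "(energy A P)\<^sup>2 \<le> \<kappa> * ?n * ?p ^ 3" by (rule energy_sq_le[OF ctl fin])
  have q2: "q\<^sup>2 \<le> 4 * \<tau>\<^sup>2 * (\<kappa> * ?n * ?p ^ 3)"
  proof -
    have "q\<^sup>2 \<le> (2 * \<tau> * energy A P)\<^sup>2" using first q0 by (rule power_mono)
    also have "\<dots> = 4 * \<tau>\<^sup>2 * (energy A P)\<^sup>2" by (simp add: power_mult_distrib)
    also have "\<dots> \<le> 4 * \<tau>\<^sup>2 * (\<kappa> * ?n * ?p ^ 3)" using eP by (rule mult_left_mono) simp
    finally show ?thesis .
  qed
  have q4: "\<tau> * (\<Delta> ^ 4 * q ^ 4) \<le> 256 * \<kappa> ^ 5 * ?n ^ 8 * ?p ^ 3"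
  proof -
    have "(\<Delta> * q) ^ 4 \<le> (4 * \<tau>\<^sup>2 * (\<Delta> * ?z)) ^ 4"
      using second \<Delta> q0 mult_left_mono[OF second \<Delta>] by (intro power_mono) (auto simp: ac_simps)
    also have "\<dots> = 256 * \<tau> ^ 8 * (\<Delta> * ?z) ^ 4" by algebra
    also have "\<dots> \<le> 256 * \<tau> ^ 8 * (\<kappa>\<^sup>2 * ?n\<^sup>2 * ?p ^ 3 * ?t ^ 3)"
      using Z \<tau> by (intro mult_left_mono) auto
    finally have "\<tau> * (\<Delta> * q) ^ 4 \<le> \<tau> * (256 * \<tau> ^ 8 * (\<kappa>\<^sup>2 * ?n\<^sup>2 * ?p ^ 3 * ?t ^ 3))"
      using \<tau> by (intro mult_left_mono) auto
    also have "\<dots> = 256 * \<kappa>\<^sup>2 * ?n\<^sup>2 * ?p ^ 3 * (?t * \<tau> ^ 3) ^ 3" by algebra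
    also have "\<dots> \<le> 256 * \<kappa>\<^sup>2 * ?n\<^sup>2 * ?p ^ 3 * (\<kappa> * ?n\<^sup>2) ^ 3"
      using T3 \<tau> by (intro mult_left_mono power_mono) auto
    also have "\<dots> = 256 * \<kappa> ^ 5 * ?n ^ 8 * ?p ^ 3" by algebra
    finally show ?thesis by (simp add: power_mult_distrib)
  qed
  \<comment> \<open>Squaring the bound for large levels puts \<tau>^2 on the left; the bound for
    small levels has \<tau>^2 on the right, so the level cancels.\<close>
  have "(\<tau> * (\<Delta> ^ 4 * q ^ 4))\<^sup>2 * q\<^sup>2 \<le> (256 * \<kappa> ^ 5 * ?n ^ 8 * ?p ^ 3)\<^sup>2 * (4 * \<tau>\<^sup>2 * (\<kappa> * ?n * ?p ^ 3))"
    by (rule mult_mono[OF power_mono[OF q4] q2]) (use \<tau> \<Delta> q0 in auto)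
  moreover have "(\<tau> * (\<Delta> ^ 4 * q ^ 4))\<^sup>2 * q\<^sup>2 = \<tau>\<^sup>2 * (\<Delta> ^ 8 * q ^ 10)" by algebra
  moreover have "(256 * \<kappa> ^ 5 * ?n ^ 8 * ?p ^ 3)\<^sup>2 * (4 * \<tau>\<^sup>2 * (\<kappa> * ?n * ?p ^ 3))
      = \<tau>\<^sup>2 * (2 ^ 18 * \<kappa> ^ 11 * ?n ^ 17 * ?p ^ 9)" by algebra
  ultimately have "\<tau>\<^sup>2 * (\<Delta> ^ 8 * q ^ 10) \<le> \<tau>\<^sup>2 * (2 ^ 18 * \<kappa> ^ 11 * ?n ^ 17 * ?p ^ 9)" by (simp only:)
  then have "\<Delta> ^ 8 * q ^ 10 \<le> 2 ^ 18 * \<kappa> ^ 11 * ?n ^ 17 * ?p ^ 9"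
    using \<tau> by (subst (asm) mult_le_cancel_left_pos) auto
  with i S q0 show ?thesis unfolding q_def Si_def by (intro exI[of _ q]) (auto simp: q_def Si_def)
qed

text \<open>The energy is about p d^2, but the estimates for triples give p^60 d^88 against p^9. The
  factor (p d^3)^14, bounded by the third moment, brings this to p^74 d^130 = p^9 (p
  d^2)^65.\<close>

lemma energy_bound_arithmetic:
  fixes d p n U \<kappa> L q :: real
  assumes "d ^ 4 * p ^ 3 \<le> 32 * n ^ 3 * U" "U\<^sup>2 \<le> L * q * (\<kappa> * n\<^sup>2)"
    "d ^ 8 * q ^ 10 \<le> 2 ^ 18 * \<kappa> ^ 11 * n ^ 17 * p ^ 9" "p * d ^ 3 \<le> \<kappa> * n\<^sup>2"
    and nn: "p > 0" "d \<ge> 0" "n > 0" "\<kappa> \<ge> 0" "L \<ge> 0" "q \<ge> 0"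
  shows "(p * d\<^sup>2) ^ 65 \<le> 2 ^ 118 * L ^ 10 * \<kappa> ^ 35 * n ^ 125"
proof -
  have "(d ^ 4 * p ^ 3)\<^sup>2 \<le> (32 * n ^ 3 * U)\<^sup>2" using assms by (intro power_mono) auto
  also have "\<dots> = 2 ^ 10 * n ^ 6 * U\<^sup>2" by algebra
  also have "\<dots> \<le> 2 ^ 10 * n ^ 6 * (L * q * (\<kappa> * n\<^sup>2))" using assms by (intro mult_left_mono) auto
  finally have "((d ^ 4 * p ^ 3)\<^sup>2) ^ 10 \<le> (2 ^ 10 * n ^ 6 * (L * q * (\<kappa> * n\<^sup>2))) ^ 10"
    using nn by (intro power_mono) auto
  then have "((d ^ 4 * p ^ 3)\<^sup>2) ^ 10 * d ^ 8 \<le> (2 ^ 10 * n ^ 6 * (L * q * (\<kappa> * n\<^sup>2))) ^ 10 * d ^ 8"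
    using nn by (intro mult_right_mono) auto
  also have "\<dots> = 2 ^ 100 * n ^ 80 * \<kappa> ^ 10 * L ^ 10 * (d ^ 8 * q ^ 10)" by algebra
  also have "\<dots> \<le> 2 ^ 100 * n ^ 80 * \<kappa> ^ 10 * L ^ 10 * (2 ^ 18 * \<kappa> ^ 11 * n ^ 17 * p ^ 9)"
    using assms(3) nn by (intro mult_left_mono) auto
  finally have 1: "((d ^ 4 * p ^ 3)\<^sup>2) ^ 10 * d ^ 8
    \<le> 2 ^ 100 * n ^ 80 * \<kappa> ^ 10 * L ^ 10 * (2 ^ 18 * \<kappa> ^ 11 * n ^ 17 * p ^ 9)" .
  have "p ^ 9 * (p * d\<^sup>2) ^ 65 = ((d ^ 4 * p ^ 3)\<^sup>2) ^ 10 * d ^ 8 * (p * d ^ 3) ^ 14" by algebra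
  also have "\<dots> \<le> 2 ^ 100 * n ^ 80 * \<kappa> ^ 10 * L ^ 10 * (2 ^ 18 * \<kappa> ^ 11 * n ^ 17 * p ^ 9) * (\<kappa> * n\<^sup>2) ^ 14"
    by (rule mult_mono[OF 1 power_mono[OF assms(4)]]) (use nn in auto)
  also have "\<dots> = p ^ 9 * (2 ^ 118 * L ^ 10 * \<kappa> ^ 35 * n ^ 125)" by algebra
  finally show ?thesis using nn by (subst (asm) mult_le_cancel_left_pos) auto
qed

text \<open>Up to logarithms this is E <= \<kappa>^(7/13) n^(25/13), better than the interpolation
  E^2 <= \<kappa> n^4 once \<kappa> < n^2. The triples have x - y and x - z in the level P that
  carries the energy, with weight \<open>rep A A (z - y)\<close>: the graph structure bounds the
  weighted sum from below, the fibres of (x - y, x - z) bound it from above.\<close>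

theorem energy_upper_bound:
  assumes fin: "finite A" and ctl: "cubic_control A \<kappa>"
    and L: "L \<ge> 1" "L \<ge> 1 + log 2 (real (card A))"
  shows "energy A A ^ 65 \<le> 2 ^ 248 * L ^ 75 * \<kappa> ^ 35 * real (card A) ^ 125"
proof -
  let ?n = "real (card A)" and ?D = "difference_set A A"
  have k: "\<kappa> \<ge> 0" by (rule cubic_control_nonneg[OF ctl])
  obtain j where j: "energy A A \<le> 4 * L *
      (real (card {x \<in> ?D. 2 ^ j \<le> rep A A x \<and> rep A A x < 2 ^ Suc j}) * (2 ^ j)\<^sup>2)"
    using energy_dyadic_level[OF fin L] by blast
  define P where "P = {x \<in> ?D. 2 ^ j \<le> rep A A x \<and> rep A A x < 2 ^ Suc j}"
  define d :: real where "d = 2 ^ j"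
  let ?p = "real (card P)"
  have fP: "finite P" using fin by (simp add: P_def)
  have E: "energy A A \<le> 4 * L * (?p * d\<^sup>2)" using j by (simp add: P_def d_def)
  show ?thesis
  proof (cases "P = {}")
    case True
    then have "energy A A = 0" using E energy_nonneg[of A A] by simp
    then show ?thesis using k L by simp
  next
    case False
    then have p: "?p > 0" using fP by (simp add: card_gt_0_iff)
    have ne: "A \<noteq> {}" using False by (auto simp: P_def difference_set_def)
    then have n: "?n > 0" using fin by (simp add: card_gt_0_iff)
    have d: "d > 0" by (simp add: d_def)
    have symP: "- x \<in> P \<longleftrightarrow> x \<in> P" for x by (simp add: P_def rep_minus difference_set_uminus)
    have Pd: "d \<le> real (rep A A x)" if "x \<in> P" for x
      using that by (simp add: P_def d_def)
    define \<Theta> where "\<Theta> = {(x, y, z). x \<in> A \<and> y \<in> A \<and> z \<in> A \<and> x - y \<in> P \<and> x - z \<in> P}"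
    define f where "f = (\<lambda>(x, y, z). (x - y, x - z :: real))"
    define U where "U = (\<Sum>(x, y, z)\<in>\<Theta>. real (rep A A (z - y)))"
    have f\<Theta>: "finite \<Theta>"
      by (rule finite_subset[of _ "A \<times> A \<times> A"]) (use fin in \<open>auto simp: \<Theta>_def\<close>)
    have lower: "d ^ 4 * ?p ^ 3 \<le> 32 * ?n ^ 3 * U"
      unfolding U_def \<Theta>_def by (rule triple_sum_lower_bound) (use fin ne fP symP Pd d in auto)
    obtain q where q: "q \<ge> 0" "(\<Sum>p\<in>P \<times> P. (real (rep A A (fst p - snd p)))\<^sup>2) \<le> L * q"
      "d ^ 8 * q ^ 10 \<le> 2 ^ 18 * \<kappa> ^ 11 * ?n ^ 17 * ?p ^ 9"
      using dyadic_square_sum_bound[OF fin fP Pd symP ctl _ L] d by auto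
    have upper: "U\<^sup>2 \<le> L * q * (\<kappa> * ?n\<^sup>2)"
    proof -
      let ?w = "\<lambda>p. real (rep A A (fst p - snd p))"
      \<comment> \<open>The weight depends only on the image, since z - y = (x - y) - (x -
        z).\<close>
      have "U = (\<Sum>\<theta>\<in>\<Theta>. ?w (f \<theta>))"
        unfolding U_def by (rule sum.cong) (auto simp: f_def)
      then have "U\<^sup>2 \<le> (\<Sum>i\<in>f ` \<Theta>. (?w i)\<^sup>2) * real (card {p \<in> \<Theta> \<times> \<Theta>. f (fst p) = f (snd p)})"
        using sum_fibres_Cauchy_Schwarz[OF f\<Theta>, of ?w f] by simp
      also have "\<dots> \<le> (L * q) * (\<kappa> * ?n\<^sup>2)"
      proof (rule mult_mono)
        have "(\<Sum>i\<in>f ` \<Theta>. (?w i)\<^sup>2) \<le> (\<Sum>i\<in>P \<times> P. (?w i)\<^sup>2)"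
          by (rule sum_mono2) (use fP in \<open>auto simp: f_def \<Theta>_def\<close>)
        with q(2) show "(\<Sum>i\<in>f ` \<Theta>. (?w i)\<^sup>2) \<le> L * q" by linarith
        show "real (card {p \<in> \<Theta> \<times> \<Theta>. f (fst p) = f (snd p)}) \<le> \<kappa> * ?n\<^sup>2"
          by (rule triple_collisions_le[OF fin fin refl _ ctl f_def]) (auto simp: \<Theta>_def)
      qed (use q L in auto)
      finally show ?thesis .
    qed
    have p3: "?p * d ^ 3 \<le> \<kappa> * ?n\<^sup>2"
      by (rule cubic_control_superlevel[OF ctl fin fin fP d Pd])
    have e: "(?p * d\<^sup>2) ^ 65 \<le> 2 ^ 118 * L ^ 10 * \<kappa> ^ 35 * ?n ^ 125"
      using energy_bound_arithmetic[OF lower upper q(3) p3 p _ n k _ q(1)] d L by simp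
    have "energy A A ^ 65 \<le> (4 * L * (?p * d\<^sup>2)) ^ 65"
      using E by (rule power_mono) simp
    also have "\<dots> = (4 * L) ^ 65 * (?p * d\<^sup>2) ^ 65" by (rule power_mult_distrib)
    also have "\<dots> \<le> (4 * L) ^ 65 * (2 ^ 118 * L ^ 10 * \<kappa> ^ 35 * ?n ^ 125)"
      using e L by (intro mult_left_mono) auto
    also have "\<dots> = 2 ^ 248 * L ^ 75 * \<kappa> ^ 35 * ?n ^ 125" by algebra
    finally show ?thesis .
  qed
qed

section \<open>Lower bound for the sumset\<close>

lemma finite_set_plus_real [simp]: "finite A \<Longrightarrow> finite B \<Longrightarrow> finite (A + B :: real set)"
  by (rule finite_set_plus)

text \<open>As a + b = c + d is the same as a - d = c - b, Cauchy-Schwarz for sums bounds the energy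
  of differences. The superset S allows the use for a part of a set together with the sumset of the
  whole.\<close>

lemma energy_ge_of_sumset:
  fixes A :: "real set"
  assumes "finite A" "A + A \<subseteq> S" "finite S"
  shows "real (card A) ^ 4 \<le> real (card S) * energy A A"
proof -
  let ?f = "\<lambda>p. fst p + snd p :: real"
  have "card {p \<in> (A \<times> A) \<times> (A \<times> A). ?f (fst p) = ?f (snd p)}
      = card {p \<in> (A \<times> A) \<times> (A \<times> A). fst (fst p) - snd (fst p) = fst (snd p) - snd (snd p)}"
    by (rule bij_betw_same_card[of "\<lambda>((a, b), (c, d)). ((a, d), (c, b))"])
      (rule bij_betwI[of _ _ _ "\<lambda>((a, b), (c, d)). ((a, d), (c, b))"], auto simp: algebra_simps)
  then have c: "real (card {p \<in> (A \<times> A) \<times> (A \<times> A). ?f (fst p) = ?f (snd p)}) = energy A A"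
    using assms by (simp add: energy_eq_card)
  have "real (card A) ^ 4 = (real (card (A \<times> A)))\<^sup>2"
    by (simp add: card_cartesian_product power2_eq_square power4_eq_xxxx)
  also have "\<dots> \<le> real (card (?f ` (A \<times> A))) * energy A A"
    using card_sq_le_image_mult_collisions[of "A \<times> A" ?f] assms by (simp add: c)
  also have "\<dots> \<le> real (card S) * energy A A"
    by (intro mult_right_mono of_nat_mono card_mono) (use assms in \<open>auto intro: set_plus_intro\<close>)
  finally show ?thesis .
qed

text \<open>A vertex outside \<open>A'\<close> lies in at least n / 2 unpopular pairs, while
  unpopular sums account for at most N \<tau> = n^2 / 4 pairs in all.\<close>

lemma exists_popular_sum_vertices:
  fixes A :: "real set"
  assumes fin: "finite A" "A \<noteq> {}"
  defines "\<tau> \<equiv> (real (card A))\<^sup>2 / (4 * real (card (A + A)))"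
  defines "R \<equiv> {s \<in> A + A. \<tau> \<le> real (card {a \<in> A. s - a \<in> A})}"
  defines "A' \<equiv> {a \<in> A. real (card A) / 2 \<le> real (card {c \<in> A. a + c \<in> R})}"
  shows "real (card A) / 2 \<le> real (card A')"
proof -
  let ?n = "real (card A)" and ?N = "real (card (A + A))"
  have n: "?n > 0" using fin by (simp add: card_gt_0_iff)
  have "A + A \<noteq> {}" using fin by (auto simp: set_plus_def)
  then have N: "?N > 0" using fin by (simp add: card_gt_0_iff)
  have \<tau>: "\<tau> > 0" using n N by (simp add: \<tau>_def)
  let ?B = "SIGMA a:A - A'. {c \<in> A. a + c \<notin> R}"
  have "real (card (A - A')) * (?n / 2) \<le> (\<Sum>a\<in>A - A'. real (card {c \<in> A. a + c \<notin> R}))"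
  proof (rule sum_bounded_below)
    fix a assume a: "a \<in> A - A'"
    have "card {c \<in> A. a + c \<in> R} + card {c \<in> A. a + c \<notin> R} = card A"
      using fin by (subst card_Un_disjoint[symmetric]) (auto intro: arg_cong[where f = card])
    then have "real (card {c \<in> A. a + c \<in> R}) + real (card {c \<in> A. a + c \<notin> R}) = ?n"
      by linarith
    moreover have "real (card {c \<in> A. a + c \<in> R}) < ?n / 2" using a by (auto simp: A'_def)
    ultimately show "?n / 2 \<le> real (card {c \<in> A. a + c \<notin> R})" by linarith
  qed
  also have "\<dots> = real (card ?B)" using fin by simp
  also have "\<dots> \<le> real (card (SIGMA s:A + A - R. {a \<in> A. s - a \<in> A}))"
    by (intro of_nat_mono card_inj_on_le[of "\<lambda>(a, c). (a + c, a)"])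
      (use fin in \<open>auto simp: inj_on_def intro: set_plus_intro\<close>)
  also have "\<dots> = (\<Sum>s\<in>A + A - R. real (card {a \<in> A. s - a \<in> A}))" using fin by simp
  also have "\<dots> \<le> real (card (A + A - R)) * \<tau>"
    by (rule sum_bounded_above) (auto simp: R_def)
  also have "\<dots> \<le> ?N * \<tau>" using fin \<tau> by (intro mult_right_mono of_nat_mono card_mono) auto
  also have "\<dots> = ?n\<^sup>2 / 4" using N by (simp add: \<tau>_def)
  finally have "?n * real (card (A - A')) \<le> ?n * (?n / 2)" by (simp add: power2_eq_square)
  then have "real (card (A - A')) \<le> ?n / 2" using n by (subst (asm) mult_le_cancel_left_pos) auto
  moreover have "card A = card A' + card (A - A')"
    using fin by (subst card_Un_disjoint[symmetric]) (auto simp: A'_def intro: arg_cong[where f = card])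
  ultimately show ?thesis by linarith
qed

text \<open>Eliminating v and m leaves p^8 d^8 against p^3; the factor (p d^3)^2 raises it to p^10
  d^14 = p^3 (p d^2)^7, and n^4 <= 64 N L p d^2 follows from the two energy bounds.\<close>

lemma sumset_arithmetic:
  fixes n N \<kappa> L p d v m E :: real
  assumes 1: "(p * d)\<^sup>2 \<le> 4 * \<kappa> * v" and 2: "n\<^sup>2 * v \<le> 4 * N * m"
    and 3: "m ^ 4 \<le> \<kappa>\<^sup>2 * n\<^sup>2 * p ^ 3 * N ^ 3" and 4: "p * d ^ 3 \<le> \<kappa> * n\<^sup>2"
    and 5: "n ^ 4 \<le> 16 * N * E" and 6: "E \<le> 4 * L * (p * d\<^sup>2)"
    and nn: "n > 0" "N > 0" "\<kappa> \<ge> 0" "L \<ge> 0" "p > 0" "d \<ge> 0" "v \<ge> 0" "m \<ge> 0"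
  shows "n ^ 30 \<le> 2 ^ 58 * L ^ 7 * \<kappa> ^ 8 * N ^ 14"
proof -
  have "(n\<^sup>2 * v) ^ 4 \<le> (4 * N * m) ^ 4" using 2 nn by (intro power_mono) auto
  also have "\<dots> = 256 * N ^ 4 * m ^ 4" by algebra
  also have "\<dots> \<le> 256 * N ^ 4 * (\<kappa>\<^sup>2 * n\<^sup>2 * p ^ 3 * N ^ 3)" using 3 nn by (intro mult_left_mono) auto
  finally have v: "(n\<^sup>2 * v) ^ 4 \<le> 256 * N ^ 4 * (\<kappa>\<^sup>2 * n\<^sup>2 * p ^ 3 * N ^ 3)" .
  have "n ^ 8 * ((p * d)\<^sup>2) ^ 4 \<le> n ^ 8 * (4 * \<kappa> * v) ^ 4"
    using 1 nn by (intro mult_left_mono power_mono) auto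
  also have "\<dots> = 256 * \<kappa> ^ 4 * (n\<^sup>2 * v) ^ 4" by algebra
  also have "\<dots> \<le> 256 * \<kappa> ^ 4 * (256 * N ^ 4 * (\<kappa>\<^sup>2 * n\<^sup>2 * p ^ 3 * N ^ 3))"
    using v nn by (intro mult_left_mono) auto
  finally have "n ^ 8 * ((p * d)\<^sup>2) ^ 4 * (p * d ^ 3)\<^sup>2
      \<le> 256 * \<kappa> ^ 4 * (256 * N ^ 4 * (\<kappa>\<^sup>2 * n\<^sup>2 * p ^ 3 * N ^ 3)) * (\<kappa> * n\<^sup>2)\<^sup>2"
    by (rule mult_mono[OF _ power_mono[OF 4]]) (use nn in auto)
  moreover have "n ^ 8 * ((p * d)\<^sup>2) ^ 4 * (p * d ^ 3)\<^sup>2 = (n ^ 6 * p ^ 3) * (n\<^sup>2 * (p * d\<^sup>2) ^ 7)" by algebra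
  moreover have "256 * \<kappa> ^ 4 * (256 * N ^ 4 * (\<kappa>\<^sup>2 * n\<^sup>2 * p ^ 3 * N ^ 3)) * (\<kappa> * n\<^sup>2)\<^sup>2
      = (n ^ 6 * p ^ 3) * (2 ^ 16 * \<kappa> ^ 8 * N ^ 7)" by algebra
  ultimately have "(n ^ 6 * p ^ 3) * (n\<^sup>2 * (p * d\<^sup>2) ^ 7) \<le> (n ^ 6 * p ^ 3) * (2 ^ 16 * \<kappa> ^ 8 * N ^ 7)"
    by (simp only:)
  then have e: "n\<^sup>2 * (p * d\<^sup>2) ^ 7 \<le> 2 ^ 16 * \<kappa> ^ 8 * N ^ 7"
    using nn by (subst (asm) mult_le_cancel_left_pos) auto
  have "n ^ 4 \<le> 16 * N * (4 * L * (p * d\<^sup>2))"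
    by (rule order.trans[OF 5 mult_left_mono[OF 6]]) (use nn in auto)
  then have "n\<^sup>2 * (n ^ 4) ^ 7 \<le> n\<^sup>2 * (16 * N * (4 * L * (p * d\<^sup>2))) ^ 7"
    using nn by (intro mult_left_mono power_mono) auto
  also have "\<dots> = (64 * N * L) ^ 7 * (n\<^sup>2 * (p * d\<^sup>2) ^ 7)" by algebra
  also have "\<dots> \<le> (64 * N * L) ^ 7 * (2 ^ 16 * \<kappa> ^ 8 * N ^ 7)"
    using e nn by (intro mult_left_mono) auto
  also have "\<dots> = 2 ^ 58 * L ^ 7 * \<kappa> ^ 8 * N ^ 14" by algebra
  also have "n\<^sup>2 * (n ^ 4) ^ 7 = n ^ 30" by algebra
  finally show ?thesis .
qed

text \<open>The triples now have y - z in a level P carrying the energy of \<open>A'\<close>, and y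
  - x a popular sum, with x in - A. Negated, their images are pairs (s, s') of sums with s popular
  and s - s' in P. Writing s = a + a' in at least \<tau> ways gives a - (s - s') = s' - a', which is
  counted through E(A, P) and E(A, A + A). Membership in \<open>A'\<close> ensures that every y has
  at least n / 2 partners x.\<close>

theorem sumset_lower_bound:
  fixes A :: "real set"
  assumes fin: "finite A" "A \<noteq> {}" and ctl: "cubic_control A \<kappa>"
    and L: "L \<ge> 1" "L \<ge> 1 + log 2 (real (card A))"
  shows "real (card A) ^ 30 \<le> 2 ^ 58 * L ^ 7 * \<kappa> ^ 8 * real (card (A + A)) ^ 14"
proof -
  let ?S = "A + A"
  let ?n = "real (card A)" and ?N = "real (card ?S)"
  have n: "?n > 0" using fin by (simp add: card_gt_0_iff)
  have "?S \<noteq> {}" using fin by (auto simp: set_plus_def)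
  then have N: "?N > 0" using fin by (simp add: card_gt_0_iff)
  have k: "\<kappa> \<ge> 0" by (rule cubic_control_nonneg[OF ctl])
  define \<tau> where "\<tau> = ?n\<^sup>2 / (4 * ?N)"
  define R where "R = {s \<in> ?S. \<tau> \<le> real (card {a \<in> A. s - a \<in> A})}"
  define A' where "A' = {a \<in> A. ?n / 2 \<le> real (card {c \<in> A. a + c \<in> R})}"
  have \<tau>: "\<tau> > 0" using n N by (simp add: \<tau>_def)
  have A': "?n / 2 \<le> real (card A')"
    using exists_popular_sum_vertices[OF fin] unfolding A'_def R_def \<tau>_def by simp
  have sA: "A' \<subseteq> A" by (auto simp: A'_def)
  then have fA': "finite A'" using fin finite_subset by auto
  let ?D = "difference_set A' A'"
  have cA: "card A' \<le> card A" by (rule card_mono[OF fin(1) sA])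
  have "card A' \<ge> 1" using A' n by (cases "card A'") auto
  then have "log 2 (real (card A')) \<le> log 2 ?n" using cA by simp
  then have L': "L \<ge> 1 + log 2 (real (card A'))" using L by linarith
  obtain j where j: "energy A' A' \<le> 4 * L *
      (real (card {x \<in> ?D. 2 ^ j \<le> rep A' A' x \<and> rep A' A' x < 2 ^ Suc j}) * (2 ^ j)\<^sup>2)"
    using energy_dyadic_level[OF fA' L(1) L'] by blast
  define P where "P = {x \<in> ?D. 2 ^ j \<le> rep A' A' x \<and> rep A' A' x < 2 ^ Suc j}"
  define d :: real where "d = 2 ^ j"
  let ?p = "real (card P)"
  have fP: "finite P" using fA' by (simp add: P_def)
  have E: "energy A' A' \<le> 4 * L * (?p * d\<^sup>2)" using j by (simp add: P_def d_def)
  have d: "d > 0" by (simp add: d_def)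
  have Pd': "d \<le> real (rep A' A' x)" if "x \<in> P" for x
    using that by (simp add: P_def d_def)
  have Pd: "d \<le> real (rep A A x)" if "x \<in> P" for x
    using Pd'[OF that] rep_mono[OF fin(1) sA sA, of x] by linarith
  have A4: "?n ^ 4 \<le> 16 * ?N * energy A' A'"
  proof -
    have "?n ^ 4 = 16 * (?n / 2) ^ 4" by (simp add: power_divide)
    also have "\<dots> \<le> 16 * real (card A') ^ 4" using A' n by (intro mult_left_mono power_mono) auto
    also have "\<dots> \<le> 16 * (?N * energy A' A')"
      by (intro mult_left_mono energy_ge_of_sumset fA' set_plus_mono2 sA) (use fin in auto)
    finally show ?thesis by simp
  qed
  have "0 < ?N * energy A' A'" using A4 n zero_less_power[of ?n 4] by linarith
  then have "energy A' A' > 0" using N by (simp add: zero_less_mult_iff)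
  then have p: "?p > 0" using E by (cases "card P") auto
  have p3: "?p * d ^ 3 \<le> \<kappa> * ?n\<^sup>2"
    by (rule cubic_control_superlevel[OF ctl fin(1,1) fP d Pd])
  define X where "X = uminus ` A"
  have fX: "finite X" using fin by (simp add: X_def)
  have X_iff: "x \<in> X \<longleftrightarrow> - x \<in> A" for x
    unfolding X_def by (metis image_iff minus_minus)
  have repX: "rep X X x = rep A A x" for x
  proof -
    have "rep X X x = rep A A (- x)"
      unfolding rep_def X_iff
      by (rule bij_betw_same_card[of uminus]) (rule bij_betwI[of _ _ _ uminus], auto)
    then show ?thesis by (simp add: rep_minus)
  qed
  define \<Theta> where "\<Theta> = {(x, y, z). - x \<in> A \<and> y \<in> A' \<and> z \<in> A' \<and> y - z \<in> P \<and> y - x \<in> R}"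
  define f where "f = (\<lambda>(x, y, z). (x - y, x - z :: real))"
  have \<Theta>X: "\<Theta> \<subseteq> X \<times> A \<times> A"
    unfolding \<Theta>_def using sA by (auto simp: X_iff)
  then have f\<Theta>: "finite \<Theta>" by (rule finite_subset) (use fX fin in auto)
  have coll: "real (card {p \<in> \<Theta> \<times> \<Theta>. f (fst p) = f (snd p)}) \<le> \<kappa> * ?n\<^sup>2"
    by (rule triple_collisions_le[OF fin(1) fX repX \<Theta>X ctl f_def])
  define V where "V = {p \<in> R \<times> ?S. fst p - snd p \<in> P}"
  have fV: "finite V" using fin by (auto simp: V_def R_def)
  have fim: "f ` \<Theta> \<subseteq> (\<lambda>p. (- fst p, - snd p)) ` V"
  proof (rule image_subsetI)
    fix q assume q: "q \<in> \<Theta>"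
    obtain x y z where qd: "q = (x, y, z)" by (metis surj_pair)
    have "z + (- x) \<in> ?S" using q sA unfolding qd \<Theta>_def by (intro set_plus_intro) auto
    then have "(y - x, z - x) \<in> V" using q unfolding qd \<Theta>_def V_def by simp
    then show "f q \<in> (\<lambda>p. (- fst p, - snd p)) ` V"
      unfolding f_def qd by (intro image_eqI[of _ _ "(y - x, z - x)"]) auto
  qed
  have "card (f ` \<Theta>) \<le> card ((\<lambda>p. (- fst p, - snd p)) ` V)" using fV fim by (intro card_mono) auto
  also have "\<dots> \<le> card V" by (rule card_image_le[OF fV])
  finally have cim: "card (f ` \<Theta>) \<le> card V" .
  have c\<Theta>: "?p * d * (?n / 2) \<le> real (card \<Theta>)"
  proof -
    let ?G = "SIGMA w:P. {b \<in> A'. b + w \<in> A'}"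
    have fG: "finite ?G" using fP fA' by auto
    have "?p * d \<le> (\<Sum>w\<in>P. real (rep A' A' w))"
      by (rule sum_bounded_below) (use Pd' in auto)
    also have "\<dots> = real (card ?G)" using fP fA' by (simp add: rep_def)
    finally have "?p * d * (?n / 2) \<le> real (card ?G) * (?n / 2)" by (rule mult_right_mono) simp
    also have "\<dots> \<le> (\<Sum>g\<in>?G. real (card {c \<in> A. snd g + fst g + c \<in> R}))"
      by (rule sum_bounded_below) (auto simp: A'_def)
    also have "\<dots> = real (card (SIGMA g:?G. {c \<in> A. snd g + fst g + c \<in> R}))"
      using fG fin by simp
    also have "\<dots> \<le> real (card \<Theta>)"
    proof (intro of_nat_mono card_inj_on_le[of "\<lambda>(g, c). (- c, snd g + fst g, snd g)"])
      show "inj_on (\<lambda>(g, c). (- c, snd g + fst g, snd g)) (SIGMA g:?G. {c \<in> A. snd g + fst g + c \<in> R})"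
        by (auto simp: inj_on_def)
    qed (use f\<Theta> in \<open>auto simp: \<Theta>_def\<close>)
    finally show ?thesis .
  qed
  have "(?p * d * (?n / 2))\<^sup>2 \<le> (real (card \<Theta>))\<^sup>2" using c\<Theta> d by (intro power_mono) auto
  also have "\<dots> \<le> real (card (f ` \<Theta>)) * real (card {p \<in> \<Theta> \<times> \<Theta>. f (fst p) = f (snd p)})"
    by (rule card_sq_le_image_mult_collisions[OF f\<Theta>])
  also have "\<dots> \<le> real (card V) * (\<kappa> * ?n\<^sup>2)"
    by (rule mult_mono) (use coll cim in auto)
  finally have "?n\<^sup>2 * (?p * d)\<^sup>2 \<le> ?n\<^sup>2 * (4 * \<kappa> * real (card V))"
    by (simp add: power_mult_distrib power_divide field_simps)
  then have 1: "(?p * d)\<^sup>2 \<le> 4 * \<kappa> * real (card V)"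
    using n by (subst (asm) mult_le_cancel_left_pos) auto
  let ?I = "difference_set A P"
  define m where "m = (\<Sum>x\<in>?I. real (rep A P x) * real (rep ?S A x))"
  have "\<tau> * real (card V) \<le> m"
  proof -
    have "\<tau> * real (card V) \<le> (\<Sum>p\<in>V. real (card {a \<in> A. fst p - a \<in> A}))"
      using sum_bounded_below[of V \<tau> "\<lambda>p. real (card {a \<in> A. fst p - a \<in> A})"]
      by (auto simp: V_def R_def mult.commute)
    also have "\<dots> = real (card (SIGMA p:V. {a \<in> A. fst p - a \<in> A}))" using fV fin by simp
    also have "\<dots> \<le> real (card {p \<in> (A \<times> P) \<times> (?S \<times> A). fst (fst p) - snd (fst p) = fst (snd p) - snd (snd p)})"
      by (intro of_nat_mono card_inj_on_le[of "\<lambda>(p, a). ((a, fst p - snd p), (snd p, fst p - a))"])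
        (use fin fP in \<open>auto simp: inj_on_def V_def\<close>)
    also have "\<dots> = m"
      using card_matching_differences[of A P ?S A ?I] fin fP by (simp add: m_def)
    finally show ?thesis .
  qed
  then have "4 * ?N * (\<tau> * real (card V)) \<le> 4 * ?N * m" using N by (intro mult_left_mono) auto
  then have 2: "?n\<^sup>2 * real (card V) \<le> 4 * ?N * m" using N by (simp add: \<tau>_def)
  have m2: "m\<^sup>2 \<le> energy A P * energy A ?S"
    using sum_rep_mult_le_sqrt_energy[of A P ?S A ?I] energy_commute[of A ?S] fin fP
    by (simp add: m_def)
  have 3: "m ^ 4 \<le> \<kappa>\<^sup>2 * ?n\<^sup>2 * ?p ^ 3 * ?N ^ 3"
  proof -
    have "(m\<^sup>2)\<^sup>2 \<le> (energy A P * energy A ?S)\<^sup>2" using m2 by (rule power_mono) simp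
    also have "\<dots> = (energy A P)\<^sup>2 * (energy A ?S)\<^sup>2" by (rule power_mult_distrib)
    also have "\<dots> \<le> (\<kappa> * ?n * ?p ^ 3) * (\<kappa> * ?n * ?N ^ 3)"
      using k fin fP by (intro mult_mono energy_sq_le[OF ctl]) auto
    finally show ?thesis by (simp add: power2_eq_square[of \<kappa>] power2_eq_square[of ?n] ac_simps)
  qed
  have "m \<ge> 0" unfolding m_def by (rule sum_nonneg) simp
  then show ?thesis
    using sumset_arithmetic[OF 1 2 3 p3 A4 E n N k _ p] L d by simp
qed

section \<open>The decomposition and the products of translates\<close>

lemma cubic_control_mono: "cubic_control A \<kappa> \<Longrightarrow> \<kappa> \<le> \<kappa>' \<Longrightarrow> cubic_control A \<kappa>'"
  unfolding cubic_control_def by (meson mult_right_mono order.trans zero_le_power2)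

lemma cubic_control_empty: "0 \<le> \<kappa> \<Longrightarrow> cubic_control {} \<kappa>"
  by (simp add: cubic_control_def difference_set_def)

text \<open>Normalised by the cube of the cardinality, control says that the l^3 norm of
  \<open>rep X B\<close> is at most proportional to |X|. Norms are subadditive and cardinalities
  additive over disjoint sets, so the same \<theta> survives however many pieces are joined.\<close>

lemma cubic_control_disjoint_Un:
  assumes fin: "finite X" "finite Y" and dj: "X \<inter> Y = {}" and Y: "Y \<noteq> {}"
    and X: "cubic_control X (\<theta> * real (card X) ^ 3)" and Yc: "cubic_control Y (\<theta> * real (card Y) ^ 3)"
  shows "cubic_control (X \<union> Y) (\<theta> * real (card (X \<union> Y)) ^ 3)"
proof (cases "X = {}")
  case True
  then show ?thesis using Yc by simp
next
  case False
  show ?thesis unfolding cubic_control_def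
  proof (intro allI impI)
    fix B :: "real set" assume B: "finite B"
    let ?D = "difference_set (X \<union> Y) B"
    have fD: "finite ?D" using fin B by simp
    have sub: "difference_set X B \<subseteq> ?D" "difference_set Y B \<subseteq> ?D" by (auto simp: difference_set_def)
    have r: "real (rep (X \<union> Y) B x) = real (rep X B x) + real (rep Y B x)" for x
    proof -
      have "{b \<in> B. b + x \<in> X \<union> Y} = {b \<in> B. b + x \<in> X} \<union> {b \<in> B. b + x \<in> Y}" by auto
      then have "rep (X \<union> Y) B x = rep X B x + rep Y B x"
        unfolding rep_def using B dj by (simp add: card_Un_disjoint disjoint_iff)
      then show ?thesis by simp
    qed
    have "(\<Sum>x\<in>?D. (real (rep X B x) + real (rep Y B x)) ^ 3)
        \<le> (\<theta> * (real (card B))\<^sup>2) * (real (card X) + real (card Y)) ^ 3"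
    proof (rule Minkowski_cubes)
      show "(\<Sum>x\<in>?D. real (rep X B x) ^ 3) \<le> \<theta> * (real (card B))\<^sup>2 * real (card X) ^ 3"
        using cubic_controlD[OF X B] sum_rep_power_superset[OF fD sub(1)] by (simp add: ac_simps)
      show "(\<Sum>x\<in>?D. real (rep Y B x) ^ 3) \<le> \<theta> * (real (card B))\<^sup>2 * real (card Y) ^ 3"
        using cubic_controlD[OF Yc B] sum_rep_power_superset[OF fD sub(2)] by (simp add: ac_simps)
    qed (use fin False Y in \<open>auto simp: card_gt_0_iff\<close>)
    then show "(\<Sum>x\<in>?D. real (rep (X \<union> Y) B x) ^ 3)
        \<le> \<theta> * real (card (X \<union> Y)) ^ 3 * (real (card B))\<^sup>2"
      using fin dj by (simp add: r card_Un_disjoint ac_simps)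
  qed
qed

lemma card_ln_image: "(\<And>a::real. a \<in> A \<Longrightarrow> 0 < a) \<Longrightarrow> card (ln ` A) = card A"
  by (rule card_image) (auto simp: inj_on_def)

text \<open>A set B violating the control of the logarithms of Y has a set P of differences with
  many representations, so elements of Y have many factorisations exp b * exp z with b in B and z in
  P. The elements with at least t of them form Z, which \<open>cubic_control_of_products\<close>
  controls additively.\<close>

lemma extract_additively_controlled:
  fixes Y :: "real set"
  assumes fin: "finite Y" and pos: "\<And>a. a \<in> Y \<Longrightarrow> 0 < a"
    and bad: "\<not> cubic_control (ln ` Y) \<kappa>" and \<kappa>: "\<kappa> > 0"
    and L: "L \<ge> 1" "L \<ge> 1 + log 2 (real (card Y))"
  shows "\<exists>Z\<subseteq>Y. Z \<noteq> {} \<and> cubic_control Z (2 ^ 22 * L ^ 5 / \<kappa> * real (card Z) ^ 3)"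
proof -
  obtain B where B: "finite B" and big: "\<kappa> * (real (card B))\<^sup>2
      < (\<Sum>x\<in>difference_set (ln ` Y) B. real (rep (ln ` Y) B x) ^ 3)"
    using bad by (auto simp: cubic_control_def not_le)
  let ?D = "difference_set (ln ` Y) B" and ?r = "rep (ln ` Y) B"
  have cY: "card (ln ` Y) = card Y" by (rule card_ln_image[OF pos])
  obtain j where j: "(\<Sum>x\<in>?D. real (?r x) ^ 3)
      \<le> 8 * L * (real (card {x \<in> ?D. 2 ^ j \<le> ?r x}) * (2 ^ j) ^ 3)"
    by (rule exE[OF sum_cube_le_of_superlevel[of ?D ?r "card Y" L]])
      (use fin B L rep_pos[OF B] rep_le_left[OF finite_imageI[OF fin] B, of ln] in \<open>auto simp: cY\<close>)
  define P where "P = {x \<in> ?D. 2 ^ j \<le> ?r x}"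
  define \<tau> :: real where "\<tau> = 2 ^ j"
  have \<tau>: "\<tau> > 0" by (simp add: \<tau>_def)
  have fP: "finite P" using fin B by (simp add: P_def)
  let ?p = "real (card P)" and ?b = "real (card B)"
  have kb: "\<kappa> * ?b\<^sup>2 < 8 * L * (?p * \<tau> ^ 3)" using big j by (simp add: P_def \<tau>_def)
  have p0: "?p > 0"
  proof (rule ccontr)
    assume "\<not> ?p > 0"
    then have "\<kappa> * ?b\<^sup>2 < 0" using kb by simp
    moreover have "\<kappa> * ?b\<^sup>2 \<ge> 0" using \<kappa> by simp
    ultimately show False by linarith
  qed
  define XX where "XX = exp ` B"
  define PP where "PP = exp ` P"
  have cc: "card XX = card B" "card PP = card P"
    unfolding XX_def PP_def by (auto intro!: card_image simp: inj_on_def)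
  define h where "h a = real (card {x \<in> XX. a / x \<in> PP})" for a
  have hsum: "?p * \<tau> \<le> sum h Y"
  proof -
    have "?p * \<tau> \<le> (\<Sum>x\<in>P. real (?r x))"
    proof (rule sum_bounded_below)
      fix x assume "x \<in> P"
      then show "\<tau> \<le> real (?r x)" by (simp add: P_def \<tau>_def)
    qed
    also have "\<dots> = real (card (SIGMA z:P. {b \<in> B. b + z \<in> ln ` Y}))"
      using fP B by (simp add: rep_def)
    also have "\<dots> \<le> real (card (SIGMA a:Y. {x \<in> XX. a / x \<in> PP}))"
    proof (intro of_nat_mono card_inj_on_le[of "\<lambda>(z, b). (exp (b + z), exp b)"])
      show "(\<lambda>(z, b). (exp (b + z), exp b)) ` (SIGMA z:P. {b \<in> B. b + z \<in> ln ` Y})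
          \<subseteq> (SIGMA a:Y. {x \<in> XX. a / x \<in> PP})"
      proof (rule image_subsetI)
        fix q assume q: "q \<in> (SIGMA z:P. {b \<in> B. b + z \<in> ln ` Y})"
        obtain z b where qd: "q = (z, b)" by (metis surj_pair)
        obtain y where y: "y \<in> Y" "b + z = ln y" using q unfolding qd by auto
        have "exp (b + z) \<in> Y" using y pos[OF y(1)] by simp
        moreover have "exp (b + z) / exp b = exp z" by (simp add: exp_add)
        ultimately show "(\<lambda>(z, b). (exp (b + z), exp b)) q \<in> (SIGMA a:Y. {x \<in> XX. a / x \<in> PP})"
          using q unfolding qd XX_def PP_def by simp
      qed
    qed (use fin B in \<open>auto simp: inj_on_def XX_def\<close>)
    also have "\<dots> = sum h Y" using fin B by (simp add: h_def XX_def)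
    finally show ?thesis .
  qed
  have "0 < ?p * \<tau>" using p0 \<tau> by simp
  then have W: "sum h Y > 0" using hsum by linarith
  \<comment> \<open>The level t keeps all but a logarithm of the factorisations: p \<tau> is at most
    2 L t |Z|.\<close>
  obtain t where t: "t > 0" "sum h Y \<le> 2 * (1 + log 2 (real (card Y))) * (t * real (card {a \<in> Y. t \<le> h a}))"
    using exists_superlevel[OF fin W] by blast
  define Z where "Z = {a \<in> Y. t \<le> h a}"
  have fZ: "finite Z" using fin by (simp add: Z_def)
  let ?z = "real (card Z)"
  have ptz: "?p * \<tau> \<le> 2 * L * (t * ?z)"
  proof -
    have "2 * (1 + log 2 (real (card Y))) * (t * ?z) \<le> 2 * L * (t * ?z)"
      using L t by (intro mult_right_mono) auto
    then show ?thesis using hsum t(2) unfolding Z_def by linarith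
  qed
  have Z0: "Z \<noteq> {}"
  proof
    assume "Z = {}"
    then have "?p * \<tau> \<le> 0" using ptz by simp
    then show False using p0 \<tau> by (simp add: mult_le_0_iff)
  qed
  have cZ: "card Z \<le> card Y" "card Z \<ge> 1"
    using fin fZ Z0 by (auto simp: Z_def Suc_le_eq card_gt_0_iff intro: card_mono)
  then have "log 2 ?z \<le> log 2 (real (card Y))" by simp
  then have LZ: "L \<ge> 1 + log 2 ?z" using L by linarith
  have "cubic_control Z (65536 * L * (real (card XX))\<^sup>2 * (real (card PP))\<^sup>2 / t ^ 3)"
    by (rule cubic_control_of_products[OF fZ _ _ _ _ t(1) _ L(1) LZ])
      (use B fP in \<open>auto simp: XX_def PP_def Z_def h_def\<close>)
  moreover have "65536 * L * (real (card XX))\<^sup>2 * (real (card PP))\<^sup>2 / t ^ 3 \<le> 2 ^ 22 * L ^ 5 / \<kappa> * ?z ^ 3"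
  proof -
    \<comment> \<open>The failure of control bounds \<kappa> b^2 and leaves (p \<tau>)^3, which the
      choice of t turns into (t |Z|)^3, so that t and the sizes of B and P disappear. The constant
      is 2^16 * 2^3 * 2^3 = 2^22.\<close>
    have "\<kappa> * (65536 * L * ?b\<^sup>2 * ?p\<^sup>2) = 65536 * L * ?p\<^sup>2 * (\<kappa> * ?b\<^sup>2)" by algebra
    also have "\<dots> \<le> 65536 * L * ?p\<^sup>2 * (8 * L * (?p * \<tau> ^ 3))"
      using kb L by (intro mult_left_mono) auto
    also have "\<dots> = 524288 * L\<^sup>2 * (?p * \<tau>) ^ 3" by algebra
    also have "\<dots> \<le> 524288 * L\<^sup>2 * (2 * L * (t * ?z)) ^ 3"
      using ptz \<tau> by (intro mult_left_mono power_mono) auto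
    also have "\<dots> = 2 ^ 22 * L ^ 5 * ?z ^ 3 * t ^ 3" by algebra
    finally have "\<kappa> * (65536 * L * ?b\<^sup>2 * ?p\<^sup>2) \<le> 2 ^ 22 * L ^ 5 * ?z ^ 3 * t ^ 3" .
    then show ?thesis using \<kappa> t by (simp add: cc field_simps)
  qed
  ultimately have "cubic_control Z (2 ^ 22 * L ^ 5 / \<kappa> * ?z ^ 3)" by (rule cubic_control_mono)
  then show ?thesis using Z0 by (intro exI[of _ Z]) (auto simp: Z_def)
qed

text \<open>A maximal additively controlled subset leaves a multiplicatively controlled remainder.\<close>

theorem higher_energy_decomposition:
  fixes A :: "real set"
  assumes fin: "finite A" and pos: "\<And>a. a \<in> A \<Longrightarrow> 0 < a" and \<kappa>: "\<kappa> > 0"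
    and L: "L \<ge> 1" "L \<ge> 1 + log 2 (real (card A))"
  shows "\<exists>X\<subseteq>A. cubic_control X (2 ^ 22 * L ^ 5 / \<kappa> * real (card X) ^ 3) \<and> cubic_control (ln ` (A - X)) \<kappa>"
proof -
  define \<theta> where "\<theta> = 2 ^ 22 * L ^ 5 / \<kappa>"
  define F where "F = {X \<in> Pow A. cubic_control X (\<theta> * real (card X) ^ 3)}"
  have "finite F" using fin by (simp add: F_def)
  moreover have "{} \<in> F" by (simp add: F_def cubic_control_def difference_set_def)
  ultimately obtain X where X: "X \<in> F" "\<And>Z. Z \<in> F \<Longrightarrow> X \<subseteq> Z \<Longrightarrow> X = Z"
    using finite_has_maximal[of F] by blast
  have XA: "X \<subseteq> A" and cX: "cubic_control X (\<theta> * real (card X) ^ 3)" using X(1) by (auto simp: F_def)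
  have "cubic_control (ln ` (A - X)) \<kappa>"
  proof (rule ccontr)
    assume bad: "\<not> cubic_control (ln ` (A - X)) \<kappa>"
    have "A - X \<noteq> {}" using bad \<kappa> cubic_control_empty[of \<kappa>] by (metis image_empty less_imp_le)
    then have "card (A - X) \<ge> 1" using fin by (simp add: Suc_le_eq card_gt_0_iff)
    moreover have "card (A - X) \<le> card A" using fin by (intro card_mono) auto
    ultimately have "log 2 (real (card (A - X))) \<le> log 2 (real (card A))" by simp
    then have "L \<ge> 1 + log 2 (real (card (A - X)))" using L by linarith
    then obtain Z where Z: "Z \<subseteq> A - X" "Z \<noteq> {}" "cubic_control Z (\<theta> * real (card Z) ^ 3)"
      using extract_additively_controlled[OF _ _ bad \<kappa> L(1)] fin pos unfolding \<theta>_def by auto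
    have "cubic_control (X \<union> Z) (\<theta> * real (card (X \<union> Z)) ^ 3)"
    proof (rule cubic_control_disjoint_Un[OF _ _ _ Z(2) cX Z(3)])
      show "finite X" using XA fin by (rule finite_subset)
      show "finite Z" using Z(1) fin by (meson finite_Diff finite_subset)
    qed (use Z(1) in auto)
    then have "X \<union> Z \<in> F" using XA Z(1) by (auto simp: F_def)
    then have "X = X \<union> Z" using X(2) by blast
    then show False using Z(1,2) by blast
  qed
  then show ?thesis using XA cX unfolding \<theta>_def by blast
qed

section \<open>Multiplicative energy and products of translates\<close>

lemma multiplicative_energy_eq:
  fixes A :: "real set"
  assumes fin: "finite A" and pos: "\<And>a. a \<in> A \<Longrightarrow> 0 < a"
  shows "real (card {p \<in> (A \<times> A) \<times> (A \<times> A). fst (fst p) / snd (fst p) = fst (snd p) / snd (snd p)})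
    = energy (ln ` A) (ln ` A)"
proof -
  have e: "ln a - ln b = ln c - ln d \<longleftrightarrow> a / b = c / d" if "a \<in> A" "b \<in> A" "c \<in> A" "d \<in> A" for a b c d
  proof -
    have p: "0 < a" "0 < b" "0 < c" "0 < d" using that pos by auto
    then have "ln a - ln b = ln (a / b)" "ln c - ln d = ln (c / d)" by (simp_all add: ln_div)
    then show ?thesis using p by simp
  qed
  let ?l = "\<lambda>((a, b), (c, d)). ((ln a, ln b), (ln c, ln d :: real))"
  have "card {p \<in> (A \<times> A) \<times> (A \<times> A). fst (fst p) / snd (fst p) = fst (snd p) / snd (snd p)}
    = card {p \<in> (ln ` A \<times> ln ` A) \<times> (ln ` A \<times> ln ` A). fst (fst p) - snd (fst p) = fst (snd p) - snd (snd p)}"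
  proof (rule bij_betw_same_card[of ?l], rule bij_betwI[of _ _ _ "\<lambda>((a, b), (c, d)). ((exp a, exp b), (exp c, exp d))"])
    show "?l \<in> {p \<in> (A \<times> A) \<times> A \<times> A. fst (fst p) / snd (fst p) = fst (snd p) / snd (snd p)} \<rightarrow>
        {p \<in> (ln ` A \<times> ln ` A) \<times> ln ` A \<times> ln ` A. fst (fst p) - snd (fst p) = fst (snd p) - snd (snd p)}"
      using e by auto
    show "(\<lambda>((a, b), (c, d)). ((exp a, exp b), (exp c, exp d)))
      \<in> {p \<in> (ln ` A \<times> ln ` A) \<times> ln ` A \<times> ln ` A. fst (fst p) - snd (fst p) = fst (snd p) - snd (snd p)} \<rightarrow>
        {p \<in> (A \<times> A) \<times> A \<times> A. fst (fst p) / snd (fst p) = fst (snd p) / snd (snd p)}"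
      using e pos by auto
  qed (use pos in auto)
  then show ?thesis using fin by (simp add: energy_eq_card)
qed

lemma energy_self_ge:
  assumes "finite A"
  shows "(real (card A))\<^sup>2 \<le> energy A A"
proof -
  have "card (A \<times> A) \<le> card {p \<in> (A \<times> A) \<times> (A \<times> A). fst (fst p) - snd (fst p) = fst (snd p) - snd (snd p)}"
    by (rule card_inj_on_le[of "\<lambda>p. (p, p)"]) (use assms in \<open>auto simp: inj_on_def\<close>)
  from of_nat_mono[OF this, where 'a = real] have "real (card (A \<times> A)) \<le> energy A A"
    using assms by (simp only: energy_eq_card)
  then show ?thesis by (simp add: card_cartesian_product power2_eq_square)
qed

text \<open>
  Equal ratios mean that \<open>(- \<epsilon> a, - \<epsilon> e)\<close>, \<open>(c, d)\<close> and \<open>(c', d')\<close> are collinear points of a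
  Cartesian product, so the count is a sum of cubes of line richnesses.
\<close>

lemma equal_ratio_pairs_le:
  fixes A :: "real set" and \<epsilon> :: real
  assumes fin: "finite A" and \<epsilon>: "\<epsilon> \<noteq> 0" and L: "L \<ge> 1" "L \<ge> 1 + log 2 (real (card A))"
    and \<Theta>: "\<Theta> = {(a, c, c'). a \<in> A \<and> c \<in> A \<and> c' \<in> A \<and> c + \<epsilon> * a \<noteq> 0 \<and> c' + \<epsilon> * a \<noteq> 0}"
    and f: "f = (\<lambda>(a, c, c'). (c' + \<epsilon> * a) / (c + \<epsilon> * a))"
  shows "real (card {p \<in> \<Theta> \<times> \<Theta>. f (fst p) = f (snd p)}) \<le> 2 ^ 19 * L * real (card A) ^ 4"
proof (cases "A = {}")
  case True
  then have "\<Theta> = {}" using \<Theta> by auto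
  then show ?thesis using L by simp
next
  case False
  let ?n = "real (card A)"
  have n: "?n \<ge> 1" using False fin by (simp add: Suc_leI card_gt_0_iff)
  \<comment> \<open>One set serves for both coordinates: the abscissas - \<epsilon> a, c, c' and the
    ordinates - \<epsilon> e, d, d' all lie in G.\<close>
  define G where "G = A \<union> (\<lambda>a. - \<epsilon> * a) ` A"
  have fG: "finite G" using fin by (simp add: G_def)
  have cG: "real (card G) \<le> 2 * ?n" "card G \<ge> 1"
  proof -
    have "card G \<le> card A + card ((\<lambda>a. - \<epsilon> * a) ` A)" unfolding G_def by (rule card_Un_le)
    also have "\<dots> \<le> card A + card A" by (intro add_left_mono card_image_le fin)
    finally show "real (card G) \<le> 2 * ?n" by simp
    show "card G \<ge> 1" using False fG by (auto simp: G_def Suc_le_eq card_gt_0_iff)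
  qed
  have "log 2 (real (card G)) \<le> log 2 (2 * ?n)" using cG by simp
  also have "\<dots> = 1 + log 2 ?n" using n by (simp add: log_mult)
  \<comment> \<open>Doubling L pays for |G| <= 2 n.\<close>
  finally have LG: "2 * L \<ge> 1 + log 2 (real (card G))" using L by linarith
  \<comment> \<open>The slope of the line through (- \<epsilon> a, - \<epsilon> e) and (c, d); equal
    ratios place (c', d') on it.\<close>
  define m where "m = (\<lambda>((a, c, c' :: real), (e, d, d' :: real)). (d + \<epsilon> * e) / (c + \<epsilon> * a))"
  define l where "l = (\<lambda>p. (m p, fst (snd (snd p)) - m p * fst (snd (fst p))))"
  define C where "C = {p \<in> \<Theta> \<times> \<Theta>. f (fst p) = f (snd p)}"
  have fC: "finite C"
  proof -
    have "finite \<Theta>" by (rule finite_subset[of _ "A \<times> A \<times> A"]) (use fin \<Theta> in auto)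
    then show ?thesis by (simp add: C_def)
  qed
  \<comment> \<open>The line and three abscissas determine the three ordinates, hence also e, d and
    d', as \<epsilon> is not 0.\<close>
  define h where "h = (\<lambda>p. (l p, (- \<epsilon> * fst (fst p), fst (snd (fst p)), snd (snd (fst p)))))"
  let ?R = "rich_points G G"
  have key: "fst (l p) \<noteq> 0 \<and> - \<epsilon> * a \<in> ?R (l p) \<and> c \<in> ?R (l p) \<and> c' \<in> ?R (l p) \<and> - \<epsilon> * a \<noteq> c \<and>
      fst (l p) * (- \<epsilon> * a) + snd (l p) = - \<epsilon> * e \<and> fst (l p) * c + snd (l p) = d \<and> fst (l p) * c' + snd (l p) = d'"
    if p: "p \<in> C" "p = ((a, c, c'), (e, d, d'))" for p a c c' e d d'
  proof -
    have mem: "a \<in> A" "c \<in> A" "c' \<in> A" "e \<in> A" "d \<in> A" "d' \<in> A"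
      and nz: "c + \<epsilon> * a \<noteq> 0" "c' + \<epsilon> * a \<noteq> 0" "d + \<epsilon> * e \<noteq> 0" "d' + \<epsilon> * e \<noteq> 0"
      and eq: "(c' + \<epsilon> * a) / (c + \<epsilon> * a) = (d' + \<epsilon> * e) / (d + \<epsilon> * e)"
      using p by (auto simp: C_def \<Theta> f)
    define \<mu> where "\<mu> = (d + \<epsilon> * e) / (c + \<epsilon> * a)"
    have lp: "l p = (\<mu>, d - \<mu> * c)" by (simp add: l_def m_def \<mu>_def p(2))
    have \<mu>: "\<mu> * (c + \<epsilon> * a) = d + \<epsilon> * e" using nz by (simp add: \<mu>_def)
    have \<mu>': "\<mu> * (c' + \<epsilon> * a) = d' + \<epsilon> * e" using nz eq by (simp add: \<mu>_def field_simps)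
    have e1: "\<mu> * (- \<epsilon> * a) + (d - \<mu> * c) = - \<epsilon> * e" using \<mu> by (simp add: algebra_simps)
    have e2: "\<mu> * c' + (d - \<mu> * c) = d'" using \<mu> \<mu>' by (simp add: algebra_simps)
    have "\<mu> \<noteq> 0" using nz by (simp add: \<mu>_def)
    moreover have "- \<epsilon> * a \<noteq> c" using nz by auto
    ultimately show ?thesis
      unfolding lp rich_points_def using mem e1 e2 by (auto simp: G_def)
  qed
  have img: "h ` C \<subseteq> (SIGMA q:l ` C. ?R q \<times> ?R q \<times> ?R q)"
  proof (rule image_subsetI)
    fix p assume p: "p \<in> C"
    obtain a c c' e d d' where pd: "p = ((a, c, c'), (e, d, d'))" by (metis surj_pair)
    show "h p \<in> (SIGMA q:l ` C. ?R q \<times> ?R q \<times> ?R q)"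
      using key[OF p pd] p by (simp add: h_def pd)
  qed
  have inj: "inj_on h C"
  proof (rule inj_onI)
    fix p q assume pq: "p \<in> C" "q \<in> C" "h p = h q"
    obtain a c c' e d d' where pd: "p = ((a, c, c'), (e, d, d'))" by (metis surj_pair)
    obtain a2 c2 c2' e2 d2 d2' where qd: "q = ((a2, c2, c2'), (e2, d2, d2'))" by (metis surj_pair)
    have ll: "l p = l q" using pq(3) by (simp only: h_def prod.inject)
    have cs: "c = c2" "c' = c2'" and a: "- \<epsilon> * a = - \<epsilon> * a2"
      using pq(3) unfolding h_def pd qd prod.inject fst_conv snd_conv by blast+
    have "a = a2" using a \<epsilon> by simp
    moreover have "- \<epsilon> * e = - \<epsilon> * e2" "d = d2" "d' = d2'"
      using key[OF pq(1) pd] key[OF pq(2) qd] by (metis ll cs a)+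
    ultimately show "p = q" using \<epsilon> cs by (simp add: pd qd)
  qed
  have fR: "finite (?R q)" for q using fG by (simp add: rich_points_def)
  have "real (card C) \<le> real (card (SIGMA q:l ` C. ?R q \<times> ?R q \<times> ?R q))"
    by (intro of_nat_mono card_inj_on_le[OF inj img]) (use fC fR in auto)
  also have "\<dots> = (\<Sum>q\<in>l ` C. real (card (?R q)) ^ 3)"
    using fC fR by (simp add: card_cartesian_product power3_eq_cube mult.assoc)
  also have "\<dots> \<le> 2 ^ 14 * (2 * L) * (real (card G))\<^sup>2 * (real (card G))\<^sup>2"
  proof (rule sum_rich_points_cubes[OF fG fG finite_imageI[OF fC] _ _ _ LG])
    fix q assume "q \<in> l ` C"
    then obtain p where p: "p \<in> C" "q = l p" by blast
    obtain a c c' e d d' where pd: "p = ((a, c, c'), (e, d, d'))" by (metis surj_pair)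
    note k = key[OF p(1) pd, folded p(2)]
    show "fst q \<noteq> 0" using k by simp
    \<comment> \<open>The abscissas - \<epsilon> a and c differ, so every line that occurs has at
      least two points of the grid.\<close>
    have "card {- \<epsilon> * a, c} \<le> card (?R q)" by (rule card_mono[OF fR]) (use k in auto)
    moreover have "card {- \<epsilon> * a, c} = 2" using k by (subst card_2_iff) blast
    ultimately show "2 \<le> card (?R q)" by simp
  qed (use L in simp)
  also have "\<dots> = 32768 * L * real (card G) ^ 4" by algebra
  also have "\<dots> \<le> 32768 * L * (2 * ?n) ^ 4" using cG L by (intro mult_left_mono power_mono) auto
  also have "\<dots> = 2 ^ 19 * L * ?n ^ 4" by algebra
  finally show ?thesis by (simp add: C_def)
qed

text \<open>For each a, Cauchy-Schwarz gives at least n^4 / M solutions of b (c + \<epsilon> a) = b'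
  (c' + \<epsilon> a). Summed over a, these match ratios (c' + \<epsilon> a) / (c + \<epsilon> a)
  with ratios b / b'. A second Cauchy-Schwarz separates the two: one factor counts collinear
  triples, the other is the multiplicative energy.\<close>

theorem energy_lower_bound_of_translates:
  fixes A :: "real set"
  assumes fin: "finite A" "A \<noteq> {}" and pos: "\<And>a. a \<in> A \<Longrightarrow> 0 < a" and \<epsilon>: "\<epsilon> \<noteq> 0"
    and L: "L \<ge> 1" "L \<ge> 1 + log 2 (real (card A))"
    and M: "\<And>a. a \<in> A \<Longrightarrow> real (card (A * translate A (\<epsilon> * a))) \<le> M"
  shows "real (card A) ^ 6 \<le> 2 ^ 21 * L * M\<^sup>2 * energy (ln ` A) (ln ` A)"
proof -
  let ?n = "real (card A)" and ?E = "energy (ln ` A) (ln ` A)"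
  have n: "?n > 0" using fin by (simp add: card_gt_0_iff)
  obtain a0 where "a0 \<in> A" using fin by blast
  then have M0: "M \<ge> 0" using M[of a0] by linarith
  define S where "S = A \<times> A \<times> A"
  have fS: "finite S" using fin by (simp add: S_def)
  define T where "T = {p \<in> S \<times> (A \<times> A). case p of ((a, c, c'), (b, b')) \<Rightarrow> b * (c + \<epsilon> * a) = b' * (c' + \<epsilon> * a)}"
  have fT: "finite T" using fin fS by (simp add: T_def)
  have lower: "?n ^ 5 \<le> M * real (card T)"
  proof -
    define g where "g a = (\<lambda>(b, c). b * (c + \<epsilon> * a :: real))" for a
    let ?C = "\<lambda>a. {p \<in> (A \<times> A) \<times> (A \<times> A). g a (fst p) = g a (snd p)}"
    have each: "?n ^ 4 \<le> M * real (card (?C a))" if a: "a \<in> A" for a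
    proof -
      have "?n ^ 4 = (real (card (A \<times> A)))\<^sup>2"
        by (simp add: card_cartesian_product power2_eq_square power4_eq_xxxx)
      also have "\<dots> \<le> real (card (g a ` (A \<times> A))) * real (card (?C a))"
        by (rule card_sq_le_image_mult_collisions) (use fin in simp)
      also have "\<dots> \<le> M * real (card (?C a))"
      proof (rule mult_right_mono)
        have "finite (A * translate A (\<epsilon> * a))"
          using fin by (intro finite_set_times) (simp_all add: translate_def)
        moreover have "g a ` (A \<times> A) \<subseteq> A * translate A (\<epsilon> * a)"
          by (auto simp: g_def translate_def intro!: set_times_intro)
        ultimately have "card (g a ` (A \<times> A)) \<le> card (A * translate A (\<epsilon> * a))" by (rule card_mono)
        then show "real (card (g a ` (A \<times> A))) \<le> M" using M[OF a] by linarith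
      qed simp
      finally show ?thesis .
    qed
    have "?n * ?n ^ 4 \<le> (\<Sum>a\<in>A. M * real (card (?C a)))"
      by (rule sum_bounded_below) (use each in auto)
    also have "\<dots> = M * real (card (SIGMA a:A. ?C a))"
      using fin by (simp add: sum_distrib_left)
    also have "\<dots> \<le> M * real (card T)"
      by (intro mult_left_mono[OF _ M0] of_nat_mono
          card_inj_on_le[of "\<lambda>(a, p). ((a, snd (fst p), snd (snd p)), (fst (fst p), fst (snd p)))"])
        (use fT in \<open>auto simp: inj_on_def T_def S_def g_def\<close>)
    finally show ?thesis by (simp flip: power_Suc)
  qed
  define \<Theta> where "\<Theta> = {(a, c, c'). a \<in> A \<and> c \<in> A \<and> c' \<in> A \<and> c + \<epsilon> * a \<noteq> 0 \<and> c' + \<epsilon> * a \<noteq> 0}"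
  define f where "f = (\<lambda>(a, c, c'). (c' + \<epsilon> * a) / (c + \<epsilon> * a))"
  define q where "q = (\<lambda>p :: real \<times> real. fst p / snd p)"
  have f\<Theta>: "finite \<Theta>" by (rule finite_subset[OF _ fS]) (auto simp: \<Theta>_def S_def)
  let ?T1 = "{p \<in> \<Theta> \<times> (A \<times> A). f (fst p) = q (snd p)}"
  \<comment> \<open>The solutions with a vanishing bracket: b and b' are positive, so both brackets
    vanish, c and c' are fixed by a, and at most n^3 remain.\<close>
  let ?T0 = "{p \<in> T. fst p \<notin> \<Theta>}"
  have T0: "real (card ?T0) \<le> ?n ^ 3"
  proof -
    have deg: "c = - \<epsilon> * a \<and> c' = - \<epsilon> * a" if "((a, c, c'), (b, b')) \<in> ?T0" for a c c' b b'
    proof -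
      have eq: "b * (c + \<epsilon> * a) = b' * (c' + \<epsilon> * a)" and mem: "a \<in> A" "c \<in> A" "c' \<in> A" "b \<in> A" "b' \<in> A"
        and nt: "(a, c, c') \<notin> \<Theta>"
        using that unfolding T_def S_def by simp_all
      have "b \<noteq> 0" "b' \<noteq> 0" using pos[OF mem(4)] pos[OF mem(5)] by simp_all
      then have "c + \<epsilon> * a = 0 \<longleftrightarrow> c' + \<epsilon> * a = 0" using eq by (metis mult_eq_0_iff)
      then have "c + \<epsilon> * a = 0" "c' + \<epsilon> * a = 0" using nt mem unfolding \<Theta>_def by blast+
      then show ?thesis by linarith
    qed
    have "card ?T0 \<le> card S"
    proof (rule card_inj_on_le[of "\<lambda>p. (fst (fst p), snd p)"])
      show "inj_on (\<lambda>p. (fst (fst p), snd p)) ?T0"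
      proof (rule inj_onI)
        fix u v assume uv: "u \<in> ?T0" "v \<in> ?T0" "(fst (fst u), snd u) = (fst (fst v), snd v)"
        obtain a c c' b b' where ud: "u = ((a, c, c'), (b, b'))" by (metis surj_pair)
        obtain a2 c2 c2' b2 b2' where vd: "v = ((a2, c2, c2'), (b2, b2'))" by (metis surj_pair)
        have e: "a = a2" "b = b2" "b' = b2'" using uv(3) unfolding ud vd by simp_all
        have "c = - \<epsilon> * a \<and> c' = - \<epsilon> * a" "c2 = - \<epsilon> * a2 \<and> c2' = - \<epsilon> * a2"
          by (rule deg[OF uv(1)[unfolded ud]], rule deg[OF uv(2)[unfolded vd]])
        then show "u = v" unfolding ud vd e by simp
      qed
      show "(\<lambda>p. (fst (fst p), snd p)) ` ?T0 \<subseteq> S" by (auto simp: T_def S_def)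
    qed (rule fS)
    moreover have "real (card S) = ?n ^ 3" by (simp add: S_def card_cartesian_product power3_eq_cube)
    ultimately show ?thesis by linarith
  qed
  have "T \<subseteq> ?T0 \<union> ?T1"
  proof
    fix p assume p: "p \<in> T"
    obtain a c c' b b' where pd: "p = ((a, c, c'), (b, b'))" by (metis surj_pair)
    show "p \<in> ?T0 \<union> ?T1"
    proof (cases "(a, c, c') \<in> \<Theta>")
      case True
      have eq: "b * (c + \<epsilon> * a) = b' * (c' + \<epsilon> * a)" and b: "b \<in> A" "b' \<in> A"
        using p unfolding pd T_def by simp_all
      have "b' \<noteq> 0" using pos[OF b(2)] by simp
      moreover have "c + \<epsilon> * a \<noteq> 0" using True unfolding \<Theta>_def by simp
      ultimately have "(c' + \<epsilon> * a) / (c + \<epsilon> * a) = b / b'"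
        using eq by (subst frac_eq_eq) (simp_all only: mult.commute not_False_eq_True)
      then have "p \<in> ?T1" using True b unfolding pd f_def q_def by simp
      then show ?thesis by blast
    next
      case False
      then show ?thesis using p by (simp add: pd)
    qed
  qed
  moreover have "finite ?T0" "finite ?T1" using fT f\<Theta> fin by simp_all
  ultimately have "card T \<le> card ?T0 + card ?T1"
    by (meson card_Un_le card_mono finite_UnI order.trans)
  then have T: "real (card T) \<le> ?n ^ 3 + real (card ?T1)" using T0 by linarith
  have T1: "(real (card ?T1))\<^sup>2 \<le> 2 ^ 19 * L * ?n ^ 4 * ?E"
  proof -
    have "(real (card ?T1))\<^sup>2 \<le> real (card {p \<in> \<Theta> \<times> \<Theta>. f (fst p) = f (snd p)})
        * real (card {p \<in> (A \<times> A) \<times> (A \<times> A). q (fst p) = q (snd p)})"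
      by (rule card_matching_pairs_Cauchy_Schwarz) (use f\<Theta> fin in auto)
    also have "real (card {p \<in> (A \<times> A) \<times> (A \<times> A). q (fst p) = q (snd p)}) = ?E"
      using multiplicative_energy_eq[OF fin(1) pos] by (simp add: q_def)
    also have "real (card {p \<in> \<Theta> \<times> \<Theta>. f (fst p) = f (snd p)}) * ?E \<le> 2 ^ 19 * L * ?n ^ 4 * ?E"
      by (rule mult_right_mono[OF equal_ratio_pairs_le[OF fin(1) \<epsilon> L \<Theta>_def f_def]]) simp
    finally show ?thesis .
  qed
  \<comment> \<open>The diagonal bound E >= n^2 absorbs the n^6 that comes from the degenerate
    solutions.\<close>
  have E2: "?n\<^sup>2 \<le> ?E" using energy_self_ge[of "ln ` A"] fin card_ln_image[of A] pos by simp
  have "(real (card T))\<^sup>2 \<le> (?n ^ 3 + real (card ?T1))\<^sup>2" using T by (rule power_mono) simp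
  also have "\<dots> \<le> 2 * (?n ^ 3)\<^sup>2 + 2 * (real (card ?T1))\<^sup>2"
    using sum_squares_bound[of "?n ^ 3" "real (card ?T1)"] by (simp add: power2_sum)
  also have "(?n ^ 3)\<^sup>2 = ?n ^ 4 * ?n\<^sup>2" by algebra
  also have "2 * (?n ^ 4 * ?n\<^sup>2) + 2 * (real (card ?T1))\<^sup>2 \<le> 2 * (?n ^ 4 * ?E) + 2 * (2 ^ 19 * L * ?n ^ 4 * ?E)"
    using T1 E2 by (intro add_mono mult_left_mono) auto
  also have "\<dots> \<le> 2 ^ 21 * L * ?n ^ 4 * ?E"
  proof -
    have "1 * (?n ^ 4 * ?E) \<le> L * (?n ^ 4 * ?E)" using L by (intro mult_right_mono) auto
    moreover have "0 \<le> ?n ^ 4 * ?E" by simp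
    moreover have "2 ^ 21 * L * ?n ^ 4 * ?E = 2097152 * (L * (?n ^ 4 * ?E))"
      "2 * (2 ^ 19 * L * ?n ^ 4 * ?E) = 1048576 * (L * (?n ^ 4 * ?E))" by simp_all
    ultimately show ?thesis by linarith
  qed
  finally have upper: "(real (card T))\<^sup>2 \<le> 2 ^ 21 * L * ?n ^ 4 * ?E" .
  have "?n ^ 4 * ?n ^ 6 = (?n ^ 5)\<^sup>2" by algebra
  also have "\<dots> \<le> (M * real (card T))\<^sup>2" using lower by (rule power_mono) simp
  also have "\<dots> = M\<^sup>2 * (real (card T))\<^sup>2" by (rule power_mult_distrib)
  also have "\<dots> \<le> M\<^sup>2 * (2 ^ 21 * L * ?n ^ 4 * ?E)" using upper by (rule mult_left_mono) simp
  also have "\<dots> = ?n ^ 4 * (2 ^ 21 * L * M\<^sup>2 * ?E)" by algebra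
  finally show ?thesis using n by (subst (asm) mult_le_cancel_left_pos) auto
qed

text \<open>The lower bound n^6 <= M^2 E, raised to the power 65, meets the upper bound E^65 <=
  \<kappa>^35 n^125; here 265 = 6 * 65 - 125.\<close>

lemma multiplicatively_controlled_bound:
  fixes Y :: "real set"
  assumes fin: "finite Y" "Y \<noteq> {}" and pos: "\<And>a. a \<in> Y \<Longrightarrow> 0 < a" and \<epsilon>: "\<epsilon> \<noteq> 0"
    and ctl: "cubic_control (ln ` Y) \<kappa>"
    and L: "L \<ge> 1" "L \<ge> 1 + log 2 (real (card Y))"
    and M: "\<And>a. a \<in> Y \<Longrightarrow> real (card (Y * translate Y (\<epsilon> * a))) \<le> M"
  shows "real (card Y) ^ 265 \<le> 2 ^ 1613 * L ^ 140 * M ^ 130 * \<kappa> ^ 35"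
proof -
  let ?n = "real (card Y)" and ?E = "energy (ln ` Y) (ln ` Y)"
  have n: "?n > 0" using fin by (simp add: card_gt_0_iff)
  obtain a0 where "a0 \<in> Y" using fin by blast
  then have M0: "M \<ge> 0" using M[of a0] by linarith
  have c: "card (ln ` Y) = card Y" by (rule card_ln_image[OF pos])
  have E: "?E ^ 65 \<le> 2 ^ 248 * L ^ 75 * \<kappa> ^ 35 * ?n ^ 125"
    using energy_upper_bound[OF _ ctl L(1)] L fin by (simp add: c)
  have "(?n ^ 6) ^ 65 \<le> (2 ^ 21 * L * M\<^sup>2 * ?E) ^ 65"
    by (rule power_mono[OF energy_lower_bound_of_translates[OF fin pos \<epsilon> L M]]) simp_all
  also have "\<dots> = (2 ^ 21 * L * M\<^sup>2) ^ 65 * ?E ^ 65" by (rule power_mult_distrib)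
  also have "\<dots> \<le> (2 ^ 21 * L * M\<^sup>2) ^ 65 * (2 ^ 248 * L ^ 75 * \<kappa> ^ 35 * ?n ^ 125)"
    by (rule mult_left_mono[OF E zero_le_power]) (use L in simp)
  finally have "?n ^ 125 * ?n ^ 265 \<le> ?n ^ 125 * (2 ^ 1613 * L ^ 140 * M ^ 130 * \<kappa> ^ 35)"
  proof -
    have e1: "(t ^ 21 * L * M\<^sup>2) ^ 65 * (t ^ 248 * L ^ 75 * \<kappa> ^ 35 * ?n ^ 125)
      = ?n ^ 125 * (t ^ 1613 * L ^ 140 * M ^ 130 * \<kappa> ^ 35)" for t :: real
    proof -
      have "(t ^ 21 * L * M\<^sup>2) ^ 65 = t ^ 1365 * L ^ 65 * M ^ 130"
        by (simp add: power_mult_distrib flip: power_mult)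
      moreover have "t ^ 1613 = t ^ 1365 * t ^ 248" "L ^ 140 = L ^ 65 * L ^ 75" by (simp_all flip: power_add)
      ultimately show ?thesis by (simp only: ac_simps)
    qed
    have e2: "(?n ^ 6) ^ 65 = ?n ^ 125 * ?n ^ 265" by (simp flip: power_mult power_add)
    assume "(?n ^ 6) ^ 65 \<le> (2 ^ 21 * L * M\<^sup>2) ^ 65 * (2 ^ 248 * L ^ 75 * \<kappa> ^ 35 * ?n ^ 125)"
    then show ?thesis by (simp only: e1 e2)
  qed
  then show ?thesis using n by (subst (asm) mult_le_cancel_left_pos) auto
qed

section \<open>Balancing the two parts of the decomposition\<close>

lemma log_card_mono:
  assumes "finite B" "A \<subseteq> B" "A \<noteq> {}"
  shows "log 2 (real (card A)) \<le> log 2 (real (card B))"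
proof -
  have "finite A" using assms finite_subset by blast
  then have "0 < card A" using assms by (simp add: card_gt_0_iff)
  moreover have "card A \<le> card B" using assms by (intro card_mono)
  ultimately show ?thesis by simp
qed

text \<open>
  The parameter \<open>\<kappa>\<close> trades the two alternatives against each other. Balancing them gives
  \<open>\<kappa> = n powr (213/113)\<close> for differences; for sums any exponent between \<open>44/23\<close> and \<open>309/161\<close> will do.
\<close>

lemma decomposition_dichotomy:
  fixes B W :: "real set"
  assumes fin: "finite B" "B \<noteq> {}" and pos: "\<And>a. a \<in> B \<Longrightarrow> 0 < a" and \<epsilon>: "\<epsilon> \<noteq> 0" and \<kappa>: "\<kappa> > 0"
    and L: "L \<ge> 1" "L \<ge> 1 + log 2 (real (card B))"
    and W: "finite W" "\<And>a. a \<in> B \<Longrightarrow> B * translate B (\<epsilon> * a) \<subseteq> W"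
  shows "real (card B) ^ 265 \<le> 2 ^ 1878 * L ^ 140 * real (card W) ^ 130 * \<kappa> ^ 35 \<or>
    (\<exists>X\<subseteq>B. X \<noteq> {} \<and> real (card B) \<le> 2 * real (card X) \<and>
      cubic_control X (2 ^ 22 * L ^ 5 / \<kappa> * real (card X) ^ 3))"
proof -
  let ?n = "real (card B)" and ?M = "real (card W)"
  have n: "?n > 0" using fin by (simp add: card_gt_0_iff)
  obtain X where X: "X \<subseteq> B" "cubic_control X (2 ^ 22 * L ^ 5 / \<kappa> * real (card X) ^ 3)"
    "cubic_control (ln ` (B - X)) \<kappa>"
    using higher_energy_decomposition[OF fin(1) pos \<kappa> L] by blast
  have fX: "finite X" using X(1) fin(1) by (rule finite_subset)
  have split: "real (card X) + real (card (B - X)) = ?n"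
    using card_Diff_subset[OF fX X(1)] card_mono[OF fin(1) X(1)] by linarith
  show ?thesis
  proof (cases "?n \<le> 2 * real (card X)")
    case True
    moreover have "X \<noteq> {}" using True n by auto
    ultimately show ?thesis using X by blast
  next
    case False
    let ?Y = "B - X"
    have Y2: "?n \<le> 2 * real (card ?Y)" using False split by linarith
    then have Y0: "?Y \<noteq> {}" using n by (metis card.empty mult_zero_right not_le of_nat_0)
    have "real (card ?Y) ^ 265 \<le> 2 ^ 1613 * L ^ 140 * ?M ^ 130 * \<kappa> ^ 35"
    proof (rule multiplicatively_controlled_bound[OF _ Y0 _ \<epsilon> X(3) L(1)])
      show "L \<ge> 1 + log 2 (real (card ?Y))"
        using log_card_mono[OF fin(1) _ Y0] L by force
      fix a assume a: "a \<in> ?Y"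
      have "?Y * translate ?Y (\<epsilon> * a) \<subseteq> B * translate B (\<epsilon> * a)"
        by (rule set_times_mono2) (auto simp: translate_def)
      also have "\<dots> \<subseteq> W" using W(2) a by blast
      finally show "real (card (?Y * translate ?Y (\<epsilon> * a))) \<le> ?M"
        using W(1) by (intro of_nat_mono card_mono)
    qed (use fin pos in auto)
    note Y = this
    have e: "t ^ 265 * (t ^ 1613 * L ^ 140 * ?M ^ 130 * \<kappa> ^ 35) = t ^ 1878 * L ^ 140 * ?M ^ 130 * \<kappa> ^ 35"
      for t :: real by (simp add: power_add[symmetric] mult.assoc[symmetric])
    \<comment> \<open>The part Y has at least half of the elements, which costs 2^265; 1878 = 265 +
      1613.\<close>
    have "?n ^ 265 \<le> (2 * real (card ?Y)) ^ 265" by (rule power_mono[OF Y2]) simp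
    also have "\<dots> = 2 ^ 265 * real (card ?Y) ^ 265" by (rule power_mult_distrib)
    also have "\<dots> \<le> 2 ^ 265 * (2 ^ 1613 * L ^ 140 * ?M ^ 130 * \<kappa> ^ 35)"
      by (rule mult_left_mono[OF Y]) (rule zero_le_power, simp)
    also have "\<dots> = 2 ^ 1878 * L ^ 140 * ?M ^ 130 * \<kappa> ^ 35" by (rule e)
    finally show ?thesis by blast
  qed
qed

text \<open>Both alternatives concern the same M, as B (B - B) contains every B (B - a) and also a
  dilate of X - X. In the second, k^3 contributes |X|^9 to
  \<open>difference_set_lower_bound\<close>, leaving |X|^2 of |X|^11.\<close>

lemma product_difference_dichotomy:
  fixes B :: "real set"
  assumes fin: "finite B" "B \<noteq> {}" and pos: "\<And>a. a \<in> B \<Longrightarrow> 0 < a" and \<kappa>: "\<kappa> > 0"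
    and L: "L \<ge> 1" "L \<ge> 1 + log 2 (real (card B))"
  defines "M \<equiv> real (card (B * difference_set B B))"
  shows "real (card B) ^ 265 \<le> 2 ^ 1878 * L ^ 140 * M ^ 130 * \<kappa> ^ 35 \<or>
    real (card B) ^ 2 * \<kappa> ^ 3 \<le> 2 ^ 74 * L ^ 15 * M ^ 5"
proof -
  let ?W = "B * difference_set B B" and ?n = "real (card B)"
  have fW: "finite ?W" using fin by (intro finite_set_times) auto
  have "B * translate B (-1 * a) \<subseteq> ?W" if "a \<in> B" for a
    by (rule set_times_mono2) (use that mem_difference_set[of _ B a B] in \<open>auto simp: translate_def\<close>)
  from decomposition_dichotomy[OF fin pos _ \<kappa> L fW this]
  consider "?n ^ 265 \<le> 2 ^ 1878 * L ^ 140 * M ^ 130 * \<kappa> ^ 35"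
    | X where "X \<subseteq> B" "X \<noteq> {}" "?n \<le> 2 * real (card X)"
      "cubic_control X (2 ^ 22 * L ^ 5 / \<kappa> * real (card X) ^ 3)"
    unfolding M_def by auto
  then show ?thesis
  proof cases
    case 2
    let ?x = "real (card X)"
    have fX: "finite X" using 2(1) fin(1) by (rule finite_subset)
    have x: "?x > 0" using fX 2(2) by (simp add: card_gt_0_iff)
    obtain b where b: "b \<in> X" using 2(2) by blast
    have DM: "real (card (difference_set X X)) \<le> M"
    proof -
      have "card (difference_set X X) \<le> card ?W"
      proof (rule card_inj_on_le[of "\<lambda>z. b * z"])
        show "inj_on ((*) b) (difference_set X X)" using pos[of b] b 2(1) by (auto simp: inj_on_def)
        have "difference_set X X \<subseteq> difference_set B B" using 2(1) unfolding difference_set_def by blast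
        then show "(*) b ` difference_set X X \<subseteq> ?W" using b 2(1) by (auto intro: set_times_intro)
      qed (rule fW)
      then show ?thesis by (simp add: M_def)
    qed
    define k where "k = 2 ^ 22 * L ^ 5 / \<kappa> * ?x ^ 3"
    have k0: "k \<ge> 0" using L \<kappa> by (simp add: k_def)
    have "?x ^ 11 \<le> 64 * k ^ 3 * real (card (difference_set X X)) ^ 5"
      by (rule difference_set_lower_bound[OF fX 2(2)]) (use 2(4) in \<open>simp add: k_def\<close>)
    also have "\<dots> \<le> 64 * k ^ 3 * M ^ 5"
      using DM k0 by (intro mult_left_mono power_mono) auto
    finally have "\<kappa> ^ 3 * ?x ^ 11 \<le> \<kappa> ^ 3 * (64 * k ^ 3 * M ^ 5)" using \<kappa> by (intro mult_left_mono) auto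
    also have "\<dots> = 64 * (\<kappa> * k) ^ 3 * M ^ 5" by algebra
    also have "\<kappa> * k = 2 ^ 22 * L ^ 5 * ?x ^ 3" using \<kappa> by (simp add: k_def)
    also have "64 * (2 ^ 22 * L ^ 5 * ?x ^ 3) ^ 3 * M ^ 5 = ?x ^ 9 * (2 ^ 72 * L ^ 15 * M ^ 5)" by algebra
    also have "\<kappa> ^ 3 * ?x ^ 11 = ?x ^ 9 * (?x\<^sup>2 * \<kappa> ^ 3)" by algebra
    finally have *: "?x\<^sup>2 * \<kappa> ^ 3 \<le> 2 ^ 72 * L ^ 15 * M ^ 5"
      using x by (subst (asm) mult_le_cancel_left_pos) auto
    have "?n\<^sup>2 * \<kappa> ^ 3 \<le> (2 * ?x)\<^sup>2 * \<kappa> ^ 3"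
      using 2(3) \<kappa> by (intro mult_right_mono power_mono) auto
    also have "\<dots> = 4 * (?x\<^sup>2 * \<kappa> ^ 3)" by (simp add: power_mult_distrib)
    also have "\<dots> \<le> 4 * (2 ^ 72 * L ^ 15 * M ^ 5)" using * by (rule mult_left_mono) simp
    also have "\<dots> = 2 ^ 74 * L ^ 15 * M ^ 5" by simp
    finally show ?thesis by blast
  qed blast
qed

text \<open>As for differences, with a dilate of X + X inside B (B + B); now k^8 contributes |X|^24,
  leaving |X|^6 of |X|^30.\<close>

lemma product_sum_dichotomy:
  fixes B :: "real set"
  assumes fin: "finite B" "B \<noteq> {}" and pos: "\<And>a. a \<in> B \<Longrightarrow> 0 < a" and \<kappa>: "\<kappa> > 0"
    and L: "L \<ge> 1" "L \<ge> 1 + log 2 (real (card B))"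
  defines "M \<equiv> real (card (B * (B + B)))"
  shows "real (card B) ^ 265 \<le> 2 ^ 1878 * L ^ 140 * M ^ 130 * \<kappa> ^ 35 \<or>
    real (card B) ^ 6 * \<kappa> ^ 8 \<le> 2 ^ 240 * L ^ 47 * M ^ 14"
proof -
  let ?W = "B * (B + B)" and ?n = "real (card B)"
  have fW: "finite ?W" using fin by (intro finite_set_times) auto
  have "B * translate B (1 * a) \<subseteq> ?W" if "a \<in> B" for a
    by (rule set_times_mono2) (use that in \<open>auto simp: translate_def intro: set_plus_intro\<close>)
  from decomposition_dichotomy[OF fin pos _ \<kappa> L fW this]
  consider "?n ^ 265 \<le> 2 ^ 1878 * L ^ 140 * M ^ 130 * \<kappa> ^ 35"
    | X where "X \<subseteq> B" "X \<noteq> {}" "?n \<le> 2 * real (card X)"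
      "cubic_control X (2 ^ 22 * L ^ 5 / \<kappa> * real (card X) ^ 3)"
    unfolding M_def by auto
  then show ?thesis
  proof cases
    case 2
    let ?x = "real (card X)"
    have fX: "finite X" using 2(1) fin(1) by (rule finite_subset)
    have x: "?x > 0" using fX 2(2) by (simp add: card_gt_0_iff)
    obtain b where b: "b \<in> X" using 2(2) by blast
    have SM: "real (card (X + X)) \<le> M"
    proof -
      have "card (X + X) \<le> card ?W"
      proof (rule card_inj_on_le[of "\<lambda>z. b * z"])
        show "inj_on ((*) b) (X + X)" using pos[of b] b 2(1) by (auto simp: inj_on_def)
        have "X + X \<subseteq> B + B" using 2(1) by (rule set_plus_mono2[OF _ 2(1)])
        then show "(*) b ` (X + X) \<subseteq> ?W" using b 2(1) by (auto intro: set_times_intro)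
      qed (rule fW)
      then show ?thesis by (simp add: M_def)
    qed
    define k where "k = 2 ^ 22 * L ^ 5 / \<kappa> * ?x ^ 3"
    have k0: "k \<ge> 0" using L \<kappa> by (simp add: k_def)
    have LX: "L \<ge> 1 + log 2 ?x" using log_card_mono[OF fin(1) 2(1,2)] L by linarith
    have "?x ^ 30 \<le> 2 ^ 58 * L ^ 7 * k ^ 8 * real (card (X + X)) ^ 14"
      by (rule sumset_lower_bound[OF fX 2(2) _ L(1) LX]) (use 2(4) in \<open>simp add: k_def\<close>)
    also have "\<dots> \<le> 2 ^ 58 * L ^ 7 * k ^ 8 * M ^ 14"
      using SM k0 L by (intro mult_left_mono power_mono) auto
    finally have "\<kappa> ^ 8 * ?x ^ 30 \<le> \<kappa> ^ 8 * (2 ^ 58 * L ^ 7 * k ^ 8 * M ^ 14)"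
      using \<kappa> by (intro mult_left_mono) auto
    also have "\<dots> = 2 ^ 58 * L ^ 7 * (\<kappa> * k) ^ 8 * M ^ 14" by algebra
    also have "\<kappa> * k = 2 ^ 22 * L ^ 5 * ?x ^ 3" using \<kappa> by (simp add: k_def)
    also have "2 ^ 58 * L ^ 7 * (2 ^ 22 * L ^ 5 * ?x ^ 3) ^ 8 * M ^ 14 = ?x ^ 24 * (2 ^ 234 * L ^ 47 * M ^ 14)"
      by algebra
    also have "\<kappa> ^ 8 * ?x ^ 30 = ?x ^ 24 * (?x ^ 6 * \<kappa> ^ 8)" by algebra
    finally have *: "?x ^ 6 * \<kappa> ^ 8 \<le> 2 ^ 234 * L ^ 47 * M ^ 14"
      using x by (subst (asm) mult_le_cancel_left_pos) auto
    have "?n ^ 6 * \<kappa> ^ 8 \<le> (2 * ?x) ^ 6 * \<kappa> ^ 8"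
      using 2(3) \<kappa> by (intro mult_right_mono power_mono) auto
    also have "\<dots> = 2 ^ 6 * (?x ^ 6 * \<kappa> ^ 8)" by (simp add: power_mult_distrib)
    also have "\<dots> \<le> 2 ^ 6 * (2 ^ 234 * L ^ 47 * M ^ 14)" using * by (rule mult_left_mono) simp
    also have "\<dots> = 2 ^ 240 * L ^ 47 * M ^ 14" by simp
    finally show ?thesis by blast
  qed blast
qed

section \<open>Popular products and translates by a single element\<close>

text \<open>The base t stands for 2 and is kept symbolic. The energy H of the popular products is
  eliminated first: multiplying by d^105 turns k^35 into (k d^3)^35 and leaves an upper bound for
  p^135 d^300 = (p d^2)^135 d^30. The multiplicative energy bounds p d^2 from below and, because p d
  <= n^2, also d.\<close>

lemma popular_products_arithmetic:
  fixes n M L p d E H k t :: real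
  assumes 1: "n ^ 6 \<le> t ^ 21 * L * M\<^sup>2 * E" and 2: "E \<le> t ^ 2 * L * (p * d\<^sup>2)"
    and 3: "p * d \<le> n\<^sup>2" and 4: "p ^ 4 * d ^ 3 \<le> t * n ^ 3 * M * H"
    and 5: "H ^ 65 \<le> t ^ 248 * (t * L) ^ 75 * k ^ 35 * p ^ 125" and 6: "k * d ^ 3 = t ^ 17 * L * n ^ 4"
    and nn: "n > 0" "M \<ge> 0" "L \<ge> 0" "p > 0" "d \<ge> 0" "H \<ge> 0" "t \<ge> 0"
  shows "n ^ 595 \<le> t ^ 4778 * L ^ 440 * M ^ 395"
proof -
  have a: "(p ^ 4 * d ^ 3) ^ 65 \<le> (t * n ^ 3 * M * H) ^ 65" by (rule power_mono[OF 4]) (use nn in simp)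
  have "(d ^ 3) ^ 35 * H ^ 65 \<le> (d ^ 3) ^ 35 * (t ^ 248 * (t * L) ^ 75 * k ^ 35 * p ^ 125)"
    by (rule mult_left_mono[OF 5]) (use nn in simp)
  also have "\<dots> = t ^ 248 * (t * L) ^ 75 * (k * d ^ 3) ^ 35 * p ^ 125"
    unfolding power_mult_distrib[of k] by (simp only: ac_simps)
  finally have b: "(d ^ 3) ^ 35 * H ^ 65 \<le> t ^ 248 * (t * L) ^ 75 * (t ^ 17 * L * n ^ 4) ^ 35 * p ^ 125"
    unfolding 6 .
  have "(p ^ 4 * d ^ 3) ^ 65 * (d ^ 3) ^ 35 \<le> (t * n ^ 3 * M * H) ^ 65 * (d ^ 3) ^ 35"
    by (rule mult_right_mono[OF a]) (use nn in simp)
  also have "\<dots> = (t * n ^ 3 * M) ^ 65 * ((d ^ 3) ^ 35 * H ^ 65)"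
    unfolding power_mult_distrib[of _ H] by (simp only: ac_simps)
  also have "\<dots> \<le> (t * n ^ 3 * M) ^ 65 * (t ^ 248 * (t * L) ^ 75 * (t ^ 17 * L * n ^ 4) ^ 35 * p ^ 125)"
    by (rule mult_left_mono[OF b]) (use nn in simp)
  finally have c0: "(p ^ 4 * d ^ 3) ^ 65 * (d ^ 3) ^ 35
    \<le> (t * n ^ 3 * M) ^ 65 * (t ^ 248 * (t * L) ^ 75 * (t ^ 17 * L * n ^ 4) ^ 35 * p ^ 125)" .
  have "(p ^ 4 * d ^ 3) ^ 65 * (d ^ 3) ^ 35 = p ^ 125 * (p ^ 135 * d ^ 300)"
  proof -
    have "(p ^ 4 * d ^ 3) ^ 65 = p ^ 260 * d ^ 195" "(d ^ 3) ^ 35 = d ^ 105"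
      by (simp_all add: power_mult_distrib flip: power_mult)
    moreover have "p ^ 260 = p ^ 125 * p ^ 135" "d ^ 300 = d ^ 195 * d ^ 105" by (simp_all flip: power_add)
    ultimately show ?thesis by (simp only: ac_simps)
  qed
  moreover have "(t * n ^ 3 * M) ^ 65 * (t ^ 248 * (t * L) ^ 75 * (t ^ 17 * L * n ^ 4) ^ 35 * p ^ 125)
    = p ^ 125 * (t ^ 983 * L ^ 110 * n ^ 335 * M ^ 65)"
  proof -
    have "(t * n ^ 3 * M) ^ 65 = t ^ 65 * n ^ 195 * M ^ 65" "(t * L) ^ 75 = t ^ 75 * L ^ 75"
      "(t ^ 17 * L * n ^ 4) ^ 35 = t ^ 595 * L ^ 35 * n ^ 140"
      by (simp_all add: power_mult_distrib flip: power_mult)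
    moreover have "t ^ 983 = t ^ 65 * (t ^ 248 * (t ^ 75 * t ^ 595))" "L ^ 110 = L ^ 75 * L ^ 35"
      "n ^ 335 = n ^ 195 * n ^ 140" by (simp_all flip: power_add)
    ultimately show ?thesis by (simp only: ac_simps)
  qed
  ultimately have "p ^ 125 * (p ^ 135 * d ^ 300) \<le> p ^ 125 * (t ^ 983 * L ^ 110 * n ^ 335 * M ^ 65)"
    using c0 by (simp only:)
  then have c: "p ^ 135 * d ^ 300 \<le> t ^ 983 * L ^ 110 * n ^ 335 * M ^ 65"
    using nn by (subst (asm) mult_le_cancel_left_pos) auto
  define Q where "Q = t ^ 23 * L\<^sup>2 * M\<^sup>2"
  have Q0: "Q \<ge> 0" using nn by (simp add: Q_def)
  have "n ^ 6 \<le> t ^ 21 * L * M\<^sup>2 * (t ^ 2 * L * (p * d\<^sup>2))"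
    by (rule order.trans[OF 1 mult_left_mono[OF 2]]) (use nn in simp)
  also have "\<dots> = Q * (p * d\<^sup>2)" unfolding Q_def by algebra
  finally have d: "n ^ 6 \<le> Q * (p * d\<^sup>2)" .
  have "n\<^sup>2 * n ^ 4 = n ^ 6" by (simp flip: power_add)
  also have "\<dots> \<le> Q * d * (p * d)" using d by (simp add: power2_eq_square ac_simps)
  also have "\<dots> \<le> Q * d * n\<^sup>2" by (rule mult_left_mono[OF 3]) (use Q0 nn in simp)
  finally have "n\<^sup>2 * n ^ 4 \<le> n\<^sup>2 * (Q * d)" by (simp only: ac_simps)
  then have e: "n ^ 4 \<le> Q * d" using nn by (subst (asm) mult_le_cancel_left_pos) auto
  have "n ^ 335 * n ^ 595 = (n ^ 6) ^ 135 * (n ^ 4) ^ 30" by (simp flip: power_mult power_add)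
  also have "\<dots> \<le> (Q * (p * d\<^sup>2)) ^ 135 * (Q * d) ^ 30"
    by (rule mult_mono[OF power_mono[OF d] power_mono[OF e]]) (use nn Q0 in simp_all)
  also have "\<dots> = Q ^ 165 * (p ^ 135 * d ^ 300)"
  proof -
    have "(Q * (p * d\<^sup>2)) ^ 135 = Q ^ 135 * p ^ 135 * d ^ 270" "(Q * d) ^ 30 = Q ^ 30 * d ^ 30"
      by (simp_all add: power_mult_distrib flip: power_mult)
    moreover have "Q ^ 165 = Q ^ 135 * Q ^ 30" "d ^ 300 = d ^ 270 * d ^ 30" by (simp_all flip: power_add)
    ultimately show ?thesis by (simp only: ac_simps)
  qed
  also have "\<dots> \<le> Q ^ 165 * (t ^ 983 * L ^ 110 * n ^ 335 * M ^ 65)"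
    by (rule mult_left_mono[OF c]) (use Q0 in simp)
  also have "\<dots> = n ^ 335 * (t ^ 4778 * L ^ 440 * M ^ 395)"
  proof -
    have "Q ^ 165 = t ^ 3795 * L ^ 330 * M ^ 330"
      by (simp add: Q_def power_mult_distrib flip: power_mult)
    moreover have "t ^ 4778 = t ^ 3795 * t ^ 983" "L ^ 440 = L ^ 330 * L ^ 110" "M ^ 395 = M ^ 330 * M ^ 65"
      by (simp_all flip: power_add)
    ultimately show ?thesis by (simp only: ac_simps)
  qed
  finally show ?thesis using nn by (subst (asm) mult_le_cancel_left_pos) auto
qed

text \<open>The multiplicative energy is counted through a b = c d instead of a / c = d / b, because
  the level must consist of products to fit the equation b (c + \<epsilon> a) = b' (c' + \<epsilon>
  a).\<close>

lemma product_energy_dyadic_level: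
  fixes B :: "real set"
  assumes fin: "finite B" and pos: "\<And>a. a \<in> B \<Longrightarrow> 0 < a"
    and L: "L \<ge> 1" "L \<ge> 1 + log 2 (real (card B))"
  defines "r \<equiv> \<lambda>y. card {b \<in> B. y / b \<in> B}"
  shows "\<exists>j. energy (ln ` B) (ln ` B)
    \<le> 4 * L * (real (card {y \<in> B * B. 2 ^ j \<le> r y \<and> r y < 2 ^ Suc j}) * (2 ^ j)\<^sup>2)"
proof -
  let ?S = "B * B" and ?g = "\<lambda>p :: real \<times> real. fst p * snd p"
  have fS: "finite ?S" using fin by (rule finite_set_times[OF _ fin])
  have nz: "b \<noteq> 0" if "b \<in> B" for b using pos[OF that] by simp
  have r: "card {p \<in> B \<times> B. ?g p = y} = r y" for y
  proof -
    have "{p \<in> B \<times> B. ?g p = y} = (\<lambda>b. (b, y / b)) ` {b \<in> B. y / b \<in> B}"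
      using nz by (auto simp: image_iff)
    then show ?thesis by (simp add: r_def card_image inj_on_def)
  qed
  have gS: "?g ` (B \<times> B) \<subseteq> ?S" by (auto intro: set_times_intro)
  have "card {p \<in> (B \<times> B) \<times> (B \<times> B). ?g (fst p) = ?g (snd p)} = (\<Sum>y\<in>?S. r y * r y)"
    using card_matching_pairs[of "B \<times> B" "B \<times> B" ?S ?g ?g] fin fS gS by (simp add: r)
  moreover have "card {p \<in> (B \<times> B) \<times> (B \<times> B). ?g (fst p) = ?g (snd p)}
      = card {p \<in> (B \<times> B) \<times> (B \<times> B). fst (fst p) / snd (fst p) = fst (snd p) / snd (snd p)}"
    by (rule bij_betw_same_card[of "\<lambda>((a, b), (c, d)). ((a, c), (d, b))"])
      (rule bij_betwI[of _ _ _ "\<lambda>((a, c), (d, b)). ((a, b), (c, d))"], use nz in \<open>auto simp: field_simps\<close>)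
  ultimately have E: "energy (ln ` B) (ln ` B) = (\<Sum>y\<in>?S. (real (r y))\<^sup>2)"
    using multiplicative_energy_eq[OF fin pos] by (simp add: power2_eq_square)
  have b: "1 \<le> r y \<and> r y \<le> card B" if "y \<in> ?S" for y
  proof
    obtain a c where ac: "a \<in> B" "c \<in> B" "y = a * c" using \<open>y \<in> ?S\<close> by (rule set_times_elim)
    then have "a \<in> {b \<in> B. y / b \<in> B}" using nz by simp
    then show "1 \<le> r y" unfolding r_def using fin by (auto simp: Suc_le_eq card_gt_0_iff)
    show "r y \<le> card B" unfolding r_def using fin by (intro card_mono) auto
  qed
  show ?thesis
    unfolding E by (rule sum_squares_le_dyadic_level[of ?S r "card B" L]) (use fS b L in auto)
qed

text \<open>Three uses of Cauchy-Schwarz on the pairs (b, c) with product in P: over b, to pass to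
  two such pairs (b, c) and (b, a) with common b; over a; and for the map (b, c) -> b (c +
  \<epsilon> a), whose image has at most M elements.\<close>

lemma card_quartic_le_collisions:
  fixes B P :: "real set"
  assumes fin: "finite B" "B \<noteq> {}"
    and M: "\<And>a. a \<in> B \<Longrightarrow> real (card (B * translate B (\<epsilon> * a))) \<le> M"
  defines "N \<equiv> \<lambda>b. {c \<in> B. b * c \<in> P}"
  defines "S \<equiv> \<lambda>a. {p \<in> B \<times> B. fst p * snd p \<in> P \<and> fst p * a \<in> P}"
  defines "g \<equiv> \<lambda>a p. fst p * (snd p + \<epsilon> * a)"
  shows "real (card (SIGMA b:B. N b)) ^ 4 \<le> real (card B) ^ 3 * M *
    real (card (SIGMA a:B. {q \<in> S a \<times> S a. g a (fst q) = g a (snd q)}))"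
proof -
  let ?n = "real (card B)" and ?G = "real (card (SIGMA b:B. N b))"
  let ?C = "\<lambda>a. {q \<in> S a \<times> S a. g a (fst q) = g a (snd q)}"
  have fN: "finite (N b)" for b using fin by (simp add: N_def)
  have fS: "finite (S a)" for a using fin by (simp add: S_def)
  have each: "(real (card (S a)))\<^sup>2 \<le> M * real (card (?C a))" if a: "a \<in> B" for a
  proof -
    have "(real (card (S a)))\<^sup>2 \<le> real (card (g a ` S a)) * real (card (?C a))"
      by (rule card_sq_le_image_mult_collisions[OF fS])
    also have "\<dots> \<le> M * real (card (?C a))"
    proof (rule mult_right_mono)
      have "finite (B * translate B (\<epsilon> * a))"
        using fin by (intro finite_set_times) (simp_all add: translate_def)
      moreover have "g a ` S a \<subseteq> B * translate B (\<epsilon> * a)"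
        by (auto simp: g_def S_def translate_def intro!: set_times_intro)
      ultimately have "card (g a ` S a) \<le> card (B * translate B (\<epsilon> * a))" by (rule card_mono)
      then show "real (card (g a ` S a)) \<le> M" using M[OF a] by linarith
    qed simp
    finally show ?thesis .
  qed
  have "(\<Sum>a\<in>B. real (card (S a))) = (\<Sum>b\<in>B. (real (card (N b)))\<^sup>2)"
  proof -
    have "card (SIGMA a:B. S a) = card (SIGMA b:B. N b \<times> N b)"
      by (rule bij_betw_same_card[of "\<lambda>(a, (b, c)). (b, (c, a))"])
        (rule bij_betwI[of _ _ _ "\<lambda>(b, (c, a)). (a, (b, c))"], auto simp: S_def N_def)
    then have "(\<Sum>a\<in>B. card (S a)) = (\<Sum>b\<in>B. card (N b) * card (N b))"
      using fin fS fN by (simp add: card_cartesian_product)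
    then show ?thesis by (simp add: power2_eq_square flip: of_nat_sum of_nat_mult)
  qed
  moreover have "?G\<^sup>2 \<le> ?n * (\<Sum>b\<in>B. (real (card (N b)))\<^sup>2)"
    using Cauchy_Schwarz_ineq_sum[of "\<lambda>_. 1" "\<lambda>b. real (card (N b))" B] fin fN by simp
  ultimately have "?G\<^sup>2 \<le> ?n * (\<Sum>a\<in>B. real (card (S a)))" by simp
  then have "(?G\<^sup>2)\<^sup>2 \<le> (?n * (\<Sum>a\<in>B. real (card (S a))))\<^sup>2" by (rule power_mono) simp
  also have "\<dots> = ?n\<^sup>2 * (\<Sum>a\<in>B. real (card (S a)))\<^sup>2" by (rule power_mult_distrib)
  also have "(\<Sum>a\<in>B. real (card (S a)))\<^sup>2 \<le> ?n * (\<Sum>a\<in>B. (real (card (S a)))\<^sup>2)"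
    using Cauchy_Schwarz_ineq_sum[of "\<lambda>_. 1" "\<lambda>a. real (card (S a))" B] by simp
  also have "(\<Sum>a\<in>B. (real (card (S a)))\<^sup>2) \<le> (\<Sum>a\<in>B. M * real (card (?C a)))"
    by (rule sum_mono) (rule each)
  also have "\<dots> = M * real (card (SIGMA a:B. ?C a))" using fin fS by (simp add: sum_distrib_left)
  finally have "(?G\<^sup>2)\<^sup>2 \<le> ?n\<^sup>2 * (?n * (M * real (card (SIGMA a:B. ?C a))))"
    by (simp add: mult_left_mono)
  then show ?thesis by (simp add: power2_eq_square power3_eq_cube power4_eq_xxxx ac_simps)
qed

text \<open>Expanded, b c + \<epsilon> b a = b' c' + \<epsilon> b' a is an additive relation between
  four elements of P. Together with b these four determine c, a, b' and c', and for a given product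
  b c there are at most d choices of b.\<close>

lemma collisions_le_energy:
  fixes B P :: "real set"
  assumes fin: "finite B" "finite P" and pos: "\<And>a. a \<in> B \<Longrightarrow> 0 < a" and \<epsilon>: "\<epsilon> = 1 \<or> \<epsilon> = -1"
    and P: "\<And>y. y \<in> P \<Longrightarrow> real (card {b \<in> B. y / b \<in> B}) \<le> d"
  defines "S \<equiv> \<lambda>a. {p \<in> B \<times> B. fst p * snd p \<in> P \<and> fst p * a \<in> P}"
  defines "g \<equiv> \<lambda>a p. fst p * (snd p + \<epsilon> * a)"
  shows "real (card (SIGMA a:B. {q \<in> S a \<times> S a. g a (fst q) = g a (snd q)})) \<le> energy P P * d"
proof -
  let ?Q = "{p \<in> (P \<times> P) \<times> (P \<times> P). fst (fst p) - snd (fst p) = fst (snd p) - snd (snd p)}"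
  let ?T = "SIGMA q:?Q. {b \<in> B. fst (fst q) / b \<in> B}"
  \<comment> \<open>Orders the products b a and b' a so that their difference is b c - b' c' for
    either sign.\<close>
  define w where "w = (\<lambda>z z' :: real. if \<epsilon> = 1 then (z', z) else (z, z'))"
  define h where "h = (\<lambda>(a, ((b, c), (b', c'))). (((b * c, b' * c'), w (b * a) (b' * a)), b :: real))"
  let ?C = "SIGMA a:B. {q \<in> S a \<times> S a. g a (fst q) = g a (snd q)}"
  have nz: "b \<noteq> 0" if "b \<in> B" for b using pos[OF that] by simp
  have fT: "finite ?T" using fin by auto
  have memC: "a \<in> B \<and> b \<in> B \<and> c \<in> B \<and> b' \<in> B \<and> c' \<in> B \<and> b * c \<in> P \<and> b * a \<in> P \<and> b' * c' \<in> P \<and> b' * a \<in> P \<and>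
      b * (c + \<epsilon> * a) = b' * (c' + \<epsilon> * a)" if "(a, ((b, c), (b', c'))) \<in> ?C" for a b c b' c'
    using that unfolding S_def g_def by simp
  have "card ?C \<le> card ?T"
  proof (rule card_inj_on_le[of h])
    show "inj_on h ?C"
    proof (rule inj_onI)
      fix u v assume uv: "u \<in> ?C" "v \<in> ?C" "h u = h v"
      obtain a b c b' c' where ud: "u = (a, ((b, c), (b', c')))" by (metis surj_pair)
      obtain a2 b2 c2 b2' c2' where vd: "v = (a2, ((b2, c2), (b2', c2')))" by (metis surj_pair)
      note mu = memC[OF uv(1)[unfolded ud]] and mv = memC[OF uv(2)[unfolded vd]]
      have hh: "b = b2" "b * c = b2 * c2" "b' * c' = b2' * c2'" "w (b * a) (b' * a) = w (b2 * a2) (b2' * a2)"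
        using uv(3) unfolding h_def ud vd prod.inject prod.case by blast+
      have ww: "b * a = b2 * a2" "b' * a = b2' * a2" using hh(4) unfolding w_def by (auto split: if_splits)
      have c: "c = c2" using hh(1,2) nz[of b] mu by simp
      have a: "a = a2" using hh(1) ww(1) nz[of b] mu by simp
      have b': "b' = b2'" using ww(2) a nz[of a] mu by simp
      have "c' = c2'" using hh(3) b' nz[of b'] mu by simp
      then show "u = v" unfolding ud vd using hh(1) c a b' by simp
    qed
    show "h ` ?C \<subseteq> ?T"
    proof (rule image_subsetI)
      fix u assume u: "u \<in> ?C"
      obtain a b c b' c' where ud: "u = (a, ((b, c), (b', c')))" by (metis surj_pair)
      note mu = memC[OF u[unfolded ud]]
      have eq: "b * c + \<epsilon> * (b * a) = b' * c' + \<epsilon> * (b' * a)" using mu by (simp add: algebra_simps)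
      have "fst (w (b * a) (b' * a)) \<in> P \<and> snd (w (b * a) (b' * a)) \<in> P \<and>
          b * c - b' * c' = fst (w (b * a) (b' * a)) - snd (w (b * a) (b' * a))"
      proof (cases "\<epsilon> = 1")
        case True
        then show ?thesis using eq mu unfolding w_def by simp
      next
        case False
        then have "\<epsilon> = -1" using \<epsilon> by simp
        then show ?thesis using eq mu unfolding w_def by simp
      qed
      moreover have "b * c / b = c" using nz[of b] mu by simp
      ultimately show "h u \<in> ?T" using mu unfolding h_def ud by (simp add: mem_Times_iff)
    qed
  qed (rule fT)
  then have "real (card ?C) \<le> real (card ?T)" by simp
  also have "\<dots> = (\<Sum>q\<in>?Q. real (card {b \<in> B. fst (fst q) / b \<in> B}))" using fin by simp
  also have "\<dots> \<le> real (card ?Q) * d"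
    by (rule sum_bounded_above) (use P in auto)
  also have "real (card ?Q) = energy P P" using fin by (simp add: energy_eq_card)
  finally show ?thesis .
qed

text \<open>
  If all \<open>B (B + \<epsilon> a)\<close> are small, the multiplicative energy is large, so \<open>B\<close> has many popular
  products. Restricting the equation \<open>b (c + \<epsilon> a) = b' (c' + \<epsilon> a)\<close> to popular products then gives many
  additive quadruples among them, although they have small additive energy.
\<close>

theorem translates_lower_bound:
  fixes B :: "real set"
  assumes fin: "finite B" "B \<noteq> {}" and pos: "\<And>a. a \<in> B \<Longrightarrow> 0 < a" and \<epsilon>: "\<epsilon> = 1 \<or> \<epsilon> = -1"
    and L: "L \<ge> 1" "L \<ge> 1 + log 2 (real (card B))"
    and M: "\<And>a. a \<in> B \<Longrightarrow> real (card (B * translate B (\<epsilon> * a))) \<le> M"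
  shows "real (card B) ^ 595 \<le> 2 ^ 4778 * L ^ 440 * M ^ 395"
proof -
  let ?n = "real (card B)" and ?E = "energy (ln ` B) (ln ` B)"
  have n: "?n > 0" using fin by (simp add: card_gt_0_iff)
  obtain a0 where "a0 \<in> B" using fin by blast
  then have M0: "M \<ge> 0" using M[of a0] by linarith
  have nz: "b \<noteq> 0" if "b \<in> B" for b using pos[OF that] by simp
  have E1: "?n ^ 6 \<le> 2 ^ 21 * L * M\<^sup>2 * ?E"
    by (rule energy_lower_bound_of_translates[OF fin pos _ L M]) (use \<epsilon> in auto)
  define r where "r = (\<lambda>y. card {b \<in> B. y / b \<in> B})"
  obtain j where j: "?E \<le> 4 * L * (real (card {y \<in> B * B. 2 ^ j \<le> r y \<and> r y < 2 ^ Suc j}) * (2 ^ j)\<^sup>2)"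
    using product_energy_dyadic_level[OF fin(1) pos L] unfolding r_def by blast
  define P where "P = {y \<in> B * B. 2 ^ j \<le> r y \<and> r y < 2 ^ Suc j}"
  define d :: real where "d = 2 ^ j"
  let ?p = "real (card P)"
  have d: "d > 0" by (simp add: d_def)
  have fP: "finite P" using finite_set_times[OF fin(1,1)] by (simp add: P_def)
  have E2: "?E \<le> 2 ^ 2 * L * (?p * d\<^sup>2)" using j by (simp add: P_def d_def)
  have rd: "d \<le> real (r y)" "real (r y) \<le> 2 * d" if "y \<in> P" for y
  proof -
    have "2 ^ j \<le> r y" "r y \<le> 2 ^ Suc j" using that by (auto simp: P_def)
    then have "real (2 ^ j) \<le> real (r y)" "real (r y) \<le> real (2 ^ Suc j)" by (simp_all only: of_nat_le_iff)
    then show "d \<le> real (r y)" "real (r y) \<le> 2 * d" by (simp_all add: d_def)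
  qed
  have p: "?p > 0"
  proof (rule ccontr)
    assume "\<not> ?p > 0"
    then have "?E \<le> 0" using E2 by simp
    then have "2 ^ 21 * L * M\<^sup>2 * ?E \<le> 0" using L by (intro mult_nonneg_nonpos) auto
    then show False using E1 n zero_less_power[of ?n 6] by linarith
  qed
  have P0: "P \<noteq> {}" using p by auto
  define N where "N b = {c \<in> B. b * c \<in> P}" for b
  define S where "S a = {p \<in> B \<times> B. fst p * snd p \<in> P \<and> fst p * a \<in> P}" for a
  define g where "g a p = fst p * (snd p + \<epsilon> * a)" for a and p :: "real \<times> real"
  let ?G = "real (card (SIGMA b:B. N b))"
  let ?C = "SIGMA a:B. {q \<in> S a \<times> S a. g a (fst q) = g a (snd q)}"
  have G: "?p * d \<le> ?G"
  proof -
    have "?p * d \<le> (\<Sum>y\<in>P. real (r y))" by (rule sum_bounded_below) (use rd in auto)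
    also have "\<dots> = real (card (SIGMA y:P. {b \<in> B. y / b \<in> B}))" using fP fin by (simp add: r_def)
    also have "\<dots> \<le> ?G"
      by (intro of_nat_mono card_inj_on_le[of "\<lambda>(y, b). (b, y / b)"])
        (use fin nz in \<open>auto simp: inj_on_def N_def\<close>)
    finally show ?thesis .
  qed
  have "?G \<le> real (card (B \<times> B))"
    by (intro of_nat_mono card_mono) (use fin in \<open>auto simp: N_def\<close>)
  then have pd: "?p * d \<le> ?n\<^sup>2" using G by (simp add: card_cartesian_product power2_eq_square)
  have H: "?p ^ 4 * d ^ 3 \<le> 2 * ?n ^ 3 * M * energy P P"
  proof -
    have "(?p * d) ^ 4 \<le> ?G ^ 4" using G d by (intro power_mono) auto
    also have "\<dots> \<le> ?n ^ 3 * M * real (card ?C)"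
      using card_quartic_le_collisions[OF fin M, of P] unfolding N_def S_def g_def .
    \<comment> \<open>The upper end 2 d of the level bounds the choices of b; it cancels one factor
      d of (p d)^4.\<close>
    also have "\<dots> \<le> ?n ^ 3 * M * (energy P P * (2 * d))"
      by (rule mult_left_mono)
        (use collisions_le_energy[OF fin(1) fP pos \<epsilon>, of "2 * d"] rd M0 in \<open>auto simp: S_def g_def r_def\<close>)
    finally have "d * (?p ^ 4 * d ^ 3) \<le> d * (2 * ?n ^ 3 * M * energy P P)"
      by (simp add: power_mult_distrib power4_eq_xxxx power3_eq_cube ac_simps)
    then show ?thesis using d by (subst (asm) mult_le_cancel_left_pos) auto
  qed
  \<comment> \<open>P may have up to n^2 elements, which doubles the logarithm.\<close>
  have LP: "2 * L \<ge> 1 + log 2 ?p"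
  proof -
    have "d \<ge> 1" by (simp add: d_def)
    then have "?p * 1 \<le> ?p * d" by (intro mult_left_mono) auto
    then have "?p \<le> ?n\<^sup>2" using pd by linarith
    then have "log 2 ?p \<le> log 2 (?n\<^sup>2)" using p n by simp
    also have "\<dots> = 2 * log 2 ?n" using n by (simp add: log_nat_power)
    finally show ?thesis using L by linarith
  qed
  \<comment> \<open>Each element of P has at least d factorisations in \<open>B \<times> B\<close>,
    so \<open>cubic_control_of_products\<close> applies with X = Y = B and t = d.\<close>
  define k where "k = 65536 * (2 * L) * ?n\<^sup>2 * ?n\<^sup>2 / d ^ 3"
  have "cubic_control P k" unfolding k_def
    by (rule cubic_control_of_products[OF fP fin(1,1) _ _ d]) (use nz rd L LP in \<open>auto simp: r_def\<close>)
  then have HP: "energy P P ^ 65 \<le> 2 ^ 248 * (2 * L) ^ 75 * k ^ 35 * ?p ^ 125"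
    using L LP by (intro energy_upper_bound[OF fP]) auto
  have kd: "k * d ^ 3 = 2 ^ 17 * L * ?n ^ 4" using d by (simp add: k_def power2_eq_square power4_eq_xxxx)
  show ?thesis
    by (rule popular_products_arithmetic[OF E1 E2 pd H HP kd]) (use n M0 L p d in auto)
qed

section \<open>The growth bounds\<close>

text \<open>For x at least 2 one has \<open>1 + log 2 x \<le> 2 / ln 2 * ln x\<close>, so powers of
  L become powers of the natural logarithm.\<close>

lemma gtrsimI:
  fixes K :: real and c :: nat
  assumes "K > 0" "c > 0" "\<And>A. 0 \<le> b A"
    and le: "\<And>A. finite A \<Longrightarrow> 2 \<le> card A \<Longrightarrow> a A \<le> K * (1 + log 2 (real (card A))) ^ c * b A"
  shows "gtrsim b a"
proof -
  have *: "a A \<le> K * (2 / ln 2) ^ c * (b A * ln (real (card A)) powr real c)"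
    if A: "finite A \<and> 2 \<le> card A" for A
  proof -
    let ?x = "real (card A)"
    have x: "?x \<ge> 2" using A by simp
    then have l: "ln ?x \<ge> ln 2" "ln ?x > 0" by simp_all
    have "1 + log 2 ?x \<le> 2 / ln 2 * ln ?x" using l by (simp add: log_def field_simps)
    moreover have "0 \<le> 1 + log 2 ?x" using x zero_le_log_cancel_iff[of 2 ?x] by linarith
    ultimately have "(1 + log 2 ?x) ^ c \<le> (2 / ln 2 * ln ?x) ^ c" by (rule power_mono)
    also have "\<dots> = (2 / ln 2) ^ c * ln ?x powr real c"
      unfolding power_mult_distrib using l by (simp add: powr_realpow)
    finally have "K * (1 + log 2 ?x) ^ c * b A \<le> K * ((2 / ln 2) ^ c * ln ?x powr real c) * b A"
      using assms by (intro mult_right_mono mult_left_mono) auto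
    also have "\<dots> = K * (2 / ln 2) ^ c * (b A * ln ?x powr real c)" by (simp only: ac_simps)
    finally show ?thesis using le A by force
  qed
  have "real c > 0" "K * (2 / ln 2) ^ c > 0" using assms by simp_all
  with * show ?thesis unfolding gtrsim_def by blast
qed

text \<open>Passes from natural to real exponents; the weight \<open>x powr w\<close> carries the
  power of \<kappa>. The constant and the loss of a factor 4 in n form a number at least 1, which
  only grows when raised to the power k, so that the k-th root can be taken.\<close>

lemma powr_le_of_power_bound:
  fixes x n K L M e w :: real
  assumes x: "x \<ge> 1" "x \<le> 4 * n" and KL: "K \<ge> 1" "L \<ge> 1" and M: "M \<ge> 0" and k: "k > 0"
    and le: "n ^ a * x powr w \<le> K * L ^ c * M ^ k" and e: "e * real k \<le> real a + w"
  shows "x powr e \<le> 4 ^ a * K * L ^ c * M"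
proof -
  let ?C = "4 ^ a * K * L ^ c"
  have "(1::real) * 1 * 1 \<le> ?C"
    using KL by (intro mult_mono one_le_power) auto
  then have C: "?C \<ge> 1" by simp
  have "(x powr e) ^ k = x powr (e * real k)"
    using x by (simp add: powr_powr flip: powr_realpow)
  also have "\<dots> \<le> x powr (real a + w)" using x e by (intro powr_mono) auto
  also have "\<dots> = x ^ a * x powr w" using x by (simp add: powr_add powr_realpow)
  also have "\<dots> \<le> (4 * n) ^ a * x powr w" using x by (intro mult_right_mono power_mono) auto
  also have "\<dots> = 4 ^ a * (n ^ a * x powr w)" by (simp add: power_mult_distrib)
  also have "\<dots> \<le> 4 ^ a * (K * L ^ c * M ^ k)" using le by (rule mult_left_mono) simp
  also have "\<dots> = ?C * M ^ k" by (simp only: ac_simps)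
  also have "\<dots> \<le> ?C ^ k * M ^ k"
    using C k M by (intro mult_right_mono self_le_power) auto
  also have "\<dots> = (?C * M) ^ k" by (rule power_mult_distrib[symmetric])
  finally show ?thesis
    using k M C by (subst (asm) power_mono_iff) auto
qed

lemma le_polylog_mono:
  fixes y K L M :: real
  assumes "y \<le> K * L ^ c * M" "K \<le> K'" "c \<le> c'" "L \<ge> 1" "M \<ge> 0" "K \<ge> 0"
  shows "y \<le> K' * L ^ c' * M"
proof -
  have "K * L ^ c * M \<le> K' * L ^ c' * M"
    using assms by (intro mult_right_mono mult_mono power_increasing) auto
  with assms(1) show ?thesis by linarith
qed

section \<open>Reduction to a positive set and choice of the parameter\<close>

text \<open>Zero is at most one element and the more frequent sign gives B; since B is nonempty, |A|
  <= 1 + 2 |B| <= 4 |B|. A negative part is reflected, and \<sigma> records the sign.\<close>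

lemma exists_large_positive_part:
  fixes A :: "real set"
  assumes fin: "finite A" and two: "2 \<le> card A"
  obtains B \<sigma> where "finite B" "B \<noteq> {}" "\<And>b. b \<in> B \<Longrightarrow> 0 < b" "card A \<le> 4 * card B" "card B \<le> card A"
    "\<sigma> * \<sigma> = 1" "\<And>b. b \<in> B \<Longrightarrow> \<sigma> * b \<in> A"
proof -
  let ?P = "{a \<in> A. 0 < a}" and ?N = "{a \<in> A. a < 0}"
  have "A \<subseteq> insert 0 (?P \<union> ?N)" by auto
  then have "card A \<le> card (insert 0 (?P \<union> ?N))" using fin by (intro card_mono) auto
  also have "\<dots> \<le> Suc (card (?P \<union> ?N))" by (rule card_insert_le_m1[of "Suc _", simplified]) simp_all
  also have "\<dots> \<le> Suc (card ?P + card ?N)" using card_Un_le[of ?P ?N] by simp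
  finally have c: "card A \<le> Suc (card ?P + card ?N)" .
  have sub: "card ?P \<le> card A" "card ?N \<le> card A" using fin by (auto intro: card_mono)
  show thesis
  proof (cases "card ?N \<le> card ?P")
    case True
    then have "card ?P > 0" using c two by linarith
    then have "?P \<noteq> {}" by (metis card.empty less_irrefl)
    then show thesis
      by (rule that[of ?P 1, rotated]) (use fin True c two sub in auto)
  next
    case False
    have cu: "card (uminus ` ?N) = card ?N" by (rule card_image) (simp add: inj_on_def)
    have "card ?N > 0" using False by linarith
    then have "uminus ` ?N \<noteq> {}" by (metis card.empty less_irrefl image_is_empty)
    then show thesis
      by (rule that[of "uminus ` ?N" "-1", rotated]) (use fin False c two sub cu in auto)
  qed
qed

text \<open>Multiplication by \<sigma> sends B into A and, since \<sigma> squares to 1, does not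
  change a product whose two factors are both scaled; hence B (B - B), B (B + B) and B (B +
  \<epsilon> b) lie inside the corresponding sets of A.\<close>

locale positive_part =
  fixes A B :: "real set" and \<sigma> :: real
  assumes finA: "finite A" and two: "2 \<le> card A" and finB: "finite B" "B \<noteq> {}"
    and pos: "\<And>b. b \<in> B \<Longrightarrow> 0 < b" and large: "card A \<le> 4 * card B" and le: "card B \<le> card A"
    and sq: "\<sigma> * \<sigma> = 1" and mem: "\<And>b. b \<in> B \<Longrightarrow> \<sigma> * b \<in> A"
begin

abbreviation "x \<equiv> real (card A)"
abbreviation "L \<equiv> 1 + log 2 x"

lemma x_bounds: "x \<ge> 1" "x \<le> 4 * real (card B)" "L \<ge> 1" "L \<ge> 1 + log 2 (real (card B))"
proof -
  show x: "x \<ge> 1" using two by simp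
  show "x \<le> 4 * real (card B)" using large by linarith
  show "L \<ge> 1" using x by simp
  have "0 < card B" using finB by (simp add: card_gt_0_iff)
  then show "L \<ge> 1 + log 2 (real (card B))" using le by simp
qed

lemma scale: "u * v = (\<sigma> * u) * (\<sigma> * v)"
proof -
  have "(\<sigma> * u) * (\<sigma> * v) = (\<sigma> * \<sigma>) * (u * v)" by (simp only: ac_simps)
  then show ?thesis by (simp add: sq)
qed

lemma times_scaled_subset:
  assumes "\<And>v. v \<in> V \<Longrightarrow> \<sigma> * v \<in> W"
  shows "B * V \<subseteq> A * W"
proof
  fix z assume "z \<in> B * V"
  then obtain u v where uv: "u \<in> B" "v \<in> V" "z = u * v" by (rule set_times_elim)
  then show "z \<in> A * W"
    using set_times_intro[OF mem[OF uv(1)] assms[OF uv(2)]] scale[of u v] by simp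
qed

lemma card_difference_le: "real (card (B * difference_set B B)) \<le> real (card (A * difference_set A A))"
proof (intro of_nat_mono card_mono finite_set_times finA times_scaled_subset)
  fix v assume "v \<in> difference_set B B"
  then obtain y z where yz: "y \<in> B" "z \<in> B" "v = y - z" unfolding difference_set_def by blast
  then show "\<sigma> * v \<in> difference_set A A"
    using mem_difference_set[OF mem[OF yz(1)] mem[OF yz(2)]] by (simp add: right_diff_distrib)
qed (simp add: finA)

lemma card_sum_le: "real (card (B * (B + B))) \<le> real (card (A * (A + A)))"
proof (intro of_nat_mono card_mono finite_set_times finA times_scaled_subset)
  fix v assume "v \<in> B + B"
  then obtain y z where yz: "v = y + z" "y \<in> B" "z \<in> B" by (rule set_plus_elim)
  then show "\<sigma> * v \<in> A + A"
    using set_plus_intro[OF mem[OF yz(2)] mem[OF yz(3)]] by (simp add: distrib_left)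
qed (simp add: finA)

lemma card_translate_le:
  assumes "b \<in> B"
  shows "real (card (B * translate B (\<epsilon> * b))) \<le> real (Max ((\<lambda>a. card (A * translate A (\<epsilon> * a))) ` A))"
proof -
  have "B * translate B (\<epsilon> * b) \<subseteq> A * translate A (\<epsilon> * (\<sigma> * b))"
  proof (rule times_scaled_subset)
    fix v assume "v \<in> translate B (\<epsilon> * b)"
    then obtain y where y: "y \<in> B" "v = y + \<epsilon> * b" unfolding translate_def by blast
    have "\<sigma> * v = \<sigma> * y + \<epsilon> * (\<sigma> * b)" by (simp add: y(2) algebra_simps)
    then show "\<sigma> * v \<in> translate A (\<epsilon> * (\<sigma> * b))" using mem[OF y(1)] unfolding translate_def by blast
  qed
  moreover have "finite (A * translate A (\<epsilon> * (\<sigma> * b)))"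
    using finA by (intro finite_set_times) (simp_all add: translate_def)
  ultimately have "card (B * translate B (\<epsilon> * b)) \<le> card (A * translate A (\<epsilon> * (\<sigma> * b)))"
    by (intro card_mono)
  also have "\<dots> \<le> Max ((\<lambda>a. card (A * translate A (\<epsilon> * a))) ` A)"
    using finA mem[OF assms] by (intro Max_ge) auto
  finally show ?thesis by simp
qed

text \<open>With \<kappa> = \<open>x powr v\<close> the alternatives give the exponents (265 - 35 v)
  / 130 and (a + b v) / k; the hypotheses say that e exceeds neither.\<close>

lemma optimise:
  fixes M v e :: real and a b c k :: nat
  assumes "real (card B) ^ 265 \<le> 2 ^ 1878 * L ^ 140 * M ^ 130 * (x powr v) ^ 35 \<or>
      real (card B) ^ a * (x powr v) ^ b \<le> 2 ^ q * L ^ c * M ^ k"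
    and M: "M \<ge> 0" and k: "k > 0" and c: "c \<le> 140"
    and e: "e * 130 \<le> 265 - 35 * v" "e * real k \<le> real a + real b * v"
  shows "x powr e \<le> (4 ^ 265 * 2 ^ 1878 + 4 ^ a * 2 ^ q) * L ^ 140 * M"
  using assms(1)
proof
  assume 1: "real (card B) ^ 265 \<le> 2 ^ 1878 * L ^ 140 * M ^ 130 * (x powr v) ^ 35"
  have p: "(x powr v) ^ 35 * x powr (- (35 * v)) = 1"
    using x_bounds(1) by (simp add: powr_powr mult.commute flip: powr_realpow powr_add)
  have "real (card B) ^ 265 * x powr (- (35 * v))
      \<le> 2 ^ 1878 * L ^ 140 * M ^ 130 * (x powr v) ^ 35 * x powr (- (35 * v))"
    by (rule mult_right_mono[OF 1]) simp
  also have "\<dots> = 2 ^ 1878 * L ^ 140 * M ^ 130 * ((x powr v) ^ 35 * x powr (- (35 * v)))"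
    by (rule mult.assoc)
  also have "\<dots> = 2 ^ 1878 * L ^ 140 * M ^ 130" unfolding p by (rule mult_1_right)
  finally have *: "real (card B) ^ 265 * x powr (- (35 * v)) \<le> 2 ^ 1878 * L ^ 140 * M ^ 130" .
  have "x powr e \<le> 4 ^ 265 * 2 ^ 1878 * L ^ 140 * M"
    by (rule powr_le_of_power_bound[OF x_bounds(1,2) one_le_power x_bounds(3) M _ *])
      (use e(1) in simp_all)
  then show ?thesis by (rule le_polylog_mono) (use x_bounds M in simp_all)
next
  assume 2: "real (card B) ^ a * (x powr v) ^ b \<le> 2 ^ q * L ^ c * M ^ k"
  have p: "(x powr v) ^ b = x powr (real b * v)"
    using x_bounds(1) by (simp add: powr_powr mult.commute flip: powr_realpow)
  have "x powr e \<le> 4 ^ a * 2 ^ q * L ^ c * M"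
    by (rule powr_le_of_power_bound[OF x_bounds(1,2) one_le_power x_bounds(3) M k 2[unfolded p] e(2)]) simp
  then show ?thesis by (rule le_polylog_mono) (use x_bounds M c in simp_all)
qed

lemma difference_bound:
  "x powr (3/2 + 7/226) \<le> (4 ^ 265 * 2 ^ 1878 + 4 ^ 2 * 2 ^ 74) * L ^ 140 * real (card (A * difference_set A A))"
proof -
  let ?M = "real (card (B * difference_set B B))"
  \<comment> \<open>The value 213/113 makes both exponents equal to 173/113 = 3/2 + 7/226.\<close>
  have \<kappa>: "x powr (213/113) > 0" using x_bounds(1) by simp
  have "x powr (3/2 + 7/226) \<le> (4 ^ 265 * 2 ^ 1878 + 4 ^ 2 * 2 ^ 74) * L ^ 140 * ?M"
    by (rule optimise[OF product_difference_dichotomy[OF finB pos \<kappa> x_bounds(3,4)]]) simp_all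
  also have "\<dots> \<le> (4 ^ 265 * 2 ^ 1878 + 4 ^ 2 * 2 ^ 74) * L ^ 140 * real (card (A * difference_set A A))"
    by (rule mult_left_mono[OF card_difference_le]) (use x_bounds(3) in simp)
  finally show ?thesis .
qed

lemma sum_bound:
  "x powr (3/2 + 1/46) \<le> (4 ^ 265 * 2 ^ 1878 + 4 ^ 6 * 2 ^ 240) * L ^ 140 * real (card (A * (A + A)))"
proof -
  let ?M = "real (card (B * (B + B)))"
  \<comment> \<open>At 44/23 the additive alternative gives exactly 35/23 = 3/2 + 1/46; the
    multiplicative one gives more.\<close>
  have \<kappa>: "x powr (44/23) > 0" using x_bounds(1) by simp
  have "x powr (3/2 + 1/46) \<le> (4 ^ 265 * 2 ^ 1878 + 4 ^ 6 * 2 ^ 240) * L ^ 140 * ?M"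
    by (rule optimise[OF product_sum_dichotomy[OF finB pos \<kappa> x_bounds(3,4)]]) simp_all
  also have "\<dots> \<le> (4 ^ 265 * 2 ^ 1878 + 4 ^ 6 * 2 ^ 240) * L ^ 140 * real (card (A * (A + A)))"
    by (rule mult_left_mono[OF card_sum_le]) (use x_bounds(3) in simp)
  finally show ?thesis .
qed

lemma translate_bound:
  assumes \<epsilon>: "\<epsilon> = 1 \<or> \<epsilon> = -1"
  shows "x powr (3/2 + 1/182)
    \<le> 4 ^ 595 * 2 ^ 4778 * L ^ 440 * real (Max ((\<lambda>a. card (A * translate A (\<epsilon> * a))) ` A))"
proof -
  let ?M = "real (Max ((\<lambda>a. card (A * translate A (\<epsilon> * a))) ` A))"
  have "real (card B) ^ 595 \<le> 2 ^ 4778 * L ^ 440 * ?M ^ 395"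
    by (rule translates_lower_bound[OF finB pos \<epsilon> x_bounds(3,4) card_translate_le])
  moreover have "x powr 0 = 1" using x_bounds(1) by simp
  ultimately have *: "real (card B) ^ 595 * x powr 0 \<le> 2 ^ 4778 * L ^ 440 * ?M ^ 395"
    by (simp only: mult_1_right)
  \<comment> \<open>The exponent 595/395 = 3/2 + 1/158 exceeds the required 3/2 + 1/182.\<close>
  show ?thesis
    by (rule powr_le_of_power_bound[OF x_bounds(1,2) one_le_power x_bounds(3) _ _ *]) simp_all
qed

end

theorem theorem1p14:
  shows "gtrsim (\<lambda>A. real (card (A * difference_set A A))) (\<lambda>A. real (card A) powr (3/2 + 7/226)) \<and>
    gtrsim (\<lambda>A. real (card (A * (A + A)))) (\<lambda>A. real (card A) powr (3/2 + 1/46)) \<and>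
    gtrsim (\<lambda>A. real (Max ((\<lambda>a. card (A * translate A a)) ` A)))
      (\<lambda>A. real (card A) powr (3/2 + 1/182)) \<and>
    gtrsim (\<lambda>A. real (Max ((\<lambda>a. card (A * translate A (- a))) ` A)))
      (\<lambda>A. real (card A) powr (3/2 + 1/182))"
proof -
  have part: "\<exists>B \<sigma>. positive_part A B \<sigma>" if A: "finite A" "2 \<le> card A" for A
  proof -
    obtain B \<sigma> where "finite B" "B \<noteq> {}" "\<And>b. b \<in> B \<Longrightarrow> 0 < b" "card A \<le> 4 * card B"
      "card B \<le> card A" "\<sigma> * \<sigma> = 1" "\<And>b. b \<in> B \<Longrightarrow> \<sigma> * b \<in> A"
      using exists_large_positive_part[OF A] by blast
    then have "positive_part A B \<sigma>" using A by unfold_locales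
    then show ?thesis by blast
  qed
  show ?thesis
  proof (intro conjI)
    show "gtrsim (\<lambda>A. real (card (A * difference_set A A))) (\<lambda>A. real (card A) powr (3/2 + 7/226))"
      by (rule gtrsimI[of "4 ^ 265 * 2 ^ 1878 + 4 ^ 2 * 2 ^ 74" 140])
        (use part positive_part.difference_bound in \<open>simp_all, blast\<close>)
    show "gtrsim (\<lambda>A. real (card (A * (A + A)))) (\<lambda>A. real (card A) powr (3/2 + 1/46))"
      by (rule gtrsimI[of "4 ^ 265 * 2 ^ 1878 + 4 ^ 6 * 2 ^ 240" 140])
        (use part positive_part.sum_bound in \<open>simp_all, blast\<close>)
    show "gtrsim (\<lambda>A. real (Max ((\<lambda>a. card (A * translate A a)) ` A)))
      (\<lambda>A. real (card A) powr (3/2 + 1/182))"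
      by (rule gtrsimI[of "4 ^ 595 * 2 ^ 4778" 440])
        (use part positive_part.translate_bound[of _ _ _ 1] in \<open>simp_all, blast\<close>)
    show "gtrsim (\<lambda>A. real (Max ((\<lambda>a. card (A * translate A (- a))) ` A)))
      (\<lambda>A. real (card A) powr (3/2 + 1/182))"
      by (rule gtrsimI[of "4 ^ 595 * 2 ^ 4778" 440])
        (use part positive_part.translate_bound[of _ _ _ "-1"] in \<open>simp_all, blast\<close>)
  qed
qed

end
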